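(* There exists a potential $V:\mathbb N\to\mathbb R$ such that, for the associated operator $H$ on $\ell_2(\mathbb N)$, the set $\sigma(H)\setminus[-2,2]$ is an infinite set $\{E_n\}_{n\ge 1}$ of discrete eigenvalues, enumerated so that $d_n=\operatorname{dist}(E_n,[-2,2])$ satisfies $d_1\ge d_2\ge\dots$ and $d_n\to 0$, and the following hold: (1) For $E=0$, the Schrödinger equation $u(n+1)+u(n-1)+V(n)u(n)=Eu(n)$ has a (not identically zero) solution $u\in\ell_2$. (2) There is a constant $c>0$ such that $d_n\le e^{-cn^2}$ for all $n$.
   Context: Given a potential $V:\mathbb N\to\mathbb R$ (with $\mathbb N=\{1,2,\dots\}$), the discrete Schrödinger operator $H$ on $\ell_2(\mathbb N)$ is the self-adjoint operator given by $(Hu)(n)=u(n+1)+u(n-1)+V(n)u(n)$ for $n\ge 2$ and $(Hu)(1)=u(2)+V(1)u(1)$. In (1), "solution" means a solution of the difference equation (the equation is required for $n\ge2$; no boundary condition at $n=1$ is imposed), so $u$ need not be an eigenvector of $H$. *)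

theory Defs
  imports "HOL-Analysis.Analysis"
begin

text \<open>
  Sequences on \<open>{1, 2, \<dots>}\<close> are functions on \<^typ>\<open>nat\<close>. The entry at \<open>0\<close> carries no
  information: it is fixed to \<open>0\<close> for elements of the Hilbert space, and the value \<open>V 0\<close> of a
  potential is never used.
\<close>

definition ell2 :: "(nat \<Rightarrow> complex) set" where
  "ell2 = {u. u 0 = 0 \<and> summable (\<lambda>n. (norm (u n))\<^sup>2)}"

definition ell2_norm :: "(nat \<Rightarrow> complex) \<Rightarrow> real" where
  "ell2_norm u = sqrt (\<Sum>n. (norm (u n))\<^sup>2)"

definition schroedinger :: "(nat \<Rightarrow> real) \<Rightarrow> (nat \<Rightarrow> complex) \<Rightarrow> nat \<Rightarrow> complex" where
  "schroedinger V u n =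
     (if n = 0 then 0
      else if n = 1 then u 2 + of_real (V 1) * u 1
      else u (n + 1) + u (n - 1) + of_real (V n) * u n)"

text \<open>
  The potential may be unbounded, so the operator is taken on its maximal domain. Since the
  off-diagonal entries are all \<open>1\<close>, this is the (unique) self-adjoint realisation in \<open>\<ell>\<^sub>2\<close>; for
  bounded \<open>V\<close> the domain is all of \<open>\<ell>\<^sub>2\<close>.
\<close>

definition schroedinger_dom :: "(nat \<Rightarrow> real) \<Rightarrow> (nat \<Rightarrow> complex) set" where
  "schroedinger_dom V = {u \<in> ell2. schroedinger V u \<in> ell2}"

definition resolvent_set :: "(nat \<Rightarrow> real) \<Rightarrow> complex set" where
  "resolvent_set V =
     {z. bij_betw (\<lambda>u n. schroedinger V u n - z * u n) (schroedinger_dom V) ell2 \<and>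
         (\<exists>C. \<forall>u\<in>schroedinger_dom V.
            ell2_norm u \<le> C * ell2_norm (\<lambda>n. schroedinger V u n - z * u n))}"

definition spectrum :: "(nat \<Rightarrow> real) \<Rightarrow> complex set" where
  "spectrum V = - resolvent_set V"

definition eigenspace :: "(nat \<Rightarrow> real) \<Rightarrow> complex \<Rightarrow> (nat \<Rightarrow> complex) set" where
  "eigenspace V z = {u \<in> schroedinger_dom V. \<forall>n. schroedinger V u n = z * u n}"

definition finite_dimensional :: "(nat \<Rightarrow> complex) set \<Rightarrow> bool" where
  "finite_dimensional W \<longleftrightarrow>
     (\<exists>B. finite B \<and> B \<subseteq> W \<and> (\<forall>u\<in>W. \<exists>c. u = (\<lambda>n. \<Sum>b\<in>B. c b * b n)))"

text \<open>Discrete eigenvalues: isolated points of the spectrum that are eigenvalues of finite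
  multiplicity.\<close>

definition discrete_eigenvalue :: "(nat \<Rightarrow> real) \<Rightarrow> complex \<Rightarrow> bool" where
  "discrete_eigenvalue V z \<longleftrightarrow>
     z isolated_in spectrum V \<and> (\<exists>u\<in>eigenspace V z. u \<noteq> (\<lambda>n. 0)) \<and>
     finite_dimensional (eigenspace V z)"

text \<open>Solutions of the difference equation; nothing is imposed at \<open>n = 1\<close>.\<close>

definition solves_schroedinger :: "(nat \<Rightarrow> real) \<Rightarrow> real \<Rightarrow> (nat \<Rightarrow> complex) \<Rightarrow> bool" where
  "solves_schroedinger V E u \<longleftrightarrow>
     (\<forall>n\<ge>2. u (n + 1) + u (n - 1) + of_real (V n) * u n = of_real E * u n)"

end

theory Submission
  imports Defs "HOL-Real_Asymp.Real_Asymp"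
begin

text \<open>
  For every positive function \<open>r\<close> the sequence \<open>u(n) = s(n) r(n)\<close> with the period-four sign pattern
  \<open>s = + + - -\<close> is an exact zero-energy solution for the oscillating potential
  \<open>V(n) = (-1)^n v(n)\<close>, \<open>v(n) = (r(n-1) - r(n+1)) / r(n)\<close>. The choice \<open>r(x) = 1 / (\<surd>x ln x)\<close> is only
  just square-summable and gives \<open>v(x) \<approx> (1 + 2 / ln x) / x\<close>. This is the potential of the theorem, up to
  a shift of \<open>n\<close> by a large constant \<open>m\<close>, which makes all asymptotic estimates valid from the first site on.

  Near the band edges \<open>\<plusminus>2\<close> an oscillating potential acts in second order like the attractive potential
  \<open>v\<^sup>2 / 4\<close>: on sequences \<open>(1 \<plusminus> (-1)^n v / 4) \<surd>n \<psi>(ln n)\<close> the operator \<open>\<plusminus>H - 2\<close> becomes, to leading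
  order and up to the factor \<open>n^(-3/2)\<close>, the operator \<open>\<psi> \<mapsto> \<psi>'' + \<psi> / t\<close> in the variable \<open>t = ln n\<close>. The
  main part \<open>1/n\<close> of \<open>v\<close> sits exactly at the threshold of Hardy's inequality, and the factor \<open>\<surd>n\<close>
  absorbs it; what remains is the potential \<open>1/t\<close> that the logarithm in \<open>r\<close> produces. Solutions of
  \<open>\<psi>'' + \<psi>/t = 0\<close> change sign about once in an interval of length \<open>\<surd>t\<close>, hence infinitely often, but only
  about \<open>\<surd>T\<close> times up to \<open>t = T\<close>. Since \<open>\<bar>V\<bar> \<le> 2 e^(-T)\<close> beyond \<open>n = e^T\<close>, only about \<open>\<surd>T\<close> bound states
  can be farther than \<open>2 e^(-T)\<close> from the band, which is the bound \<open>d\<^sub>n \<le> e^(-cn\<^sup>2)\<close>.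

  Both halves are made rigorous by quadratic forms rather than by oscillation theory. For the upper
  bound, the concave functions \<open>c/2 - (t - c)\<^sup>2\<close> are positive supersolutions on intervals of length
  comparable to \<open>\<surd>c\<close> (\<open>supersolution_step\<close>). Sequences that vanish at the ends of these intervals
  therefore have energy at most at the band edge (\<open>energy_decoupled\<close>), and the number of vanishing conditions
  bounds the number of bound states (\<open>card_bound_states_le\<close>, \<open>count_bound_states\<close>). For the lower bound,
  quartic bumps in \<open>t\<close>, cut off where they become negative, are strict subsolutions (\<open>subsolution_step\<close>) and
  yield infinitely many test functions with separated supports and energy above the band edge
  (\<open>test_function\<close>); the variational principle \<open>another_bound_state\<close> turns them into bound states.

  The spectral theory needed is that of a potential tending to \<open>0\<close>. Its core is
  \<open>weyl_sequence\<close>: an approximate eigenvector for a point \<open>z\<close> off the band cannot escape to infinity, where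
  the operator is close to the free one, so a limit exists, and by the three-term recursion it is a
  multiple of the solution \<open>dirichlet V z\<close>. Hence off the band either \<open>z\<close> is an eigenvalue or \<open>H - z\<close> is bounded
  below, and in the latter case \<open>H - z\<close> is onto (\<open>surjective_if_adjoint_bounded_below\<close>).
\<close>

section \<open>The Hilbert space of square-summable sequences\<close>

definition ell2_inner :: "(nat \<Rightarrow> complex) \<Rightarrow> (nat \<Rightarrow> complex) \<Rightarrow> complex" where
  "ell2_inner u w = (\<Sum>n. u n * cnj (w n))"

lemma ell2_I: "u 0 = 0 \<Longrightarrow> summable (\<lambda>n. (norm (u n))\<^sup>2) \<Longrightarrow> u \<in> ell2"
  by (simp add: ell2_def)

lemma ell2_0: "u \<in> ell2 \<Longrightarrow> u 0 = 0"
  by (simp add: ell2_def)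

lemma ell2_summable: "u \<in> ell2 \<Longrightarrow> summable (\<lambda>n. (norm (u n))\<^sup>2)"
  by (simp add: ell2_def)

lemma ell2_norm_sq: "u \<in> ell2 \<Longrightarrow> (ell2_norm u)\<^sup>2 = (\<Sum>n. (norm (u n))\<^sup>2)"
  by (simp add: ell2_norm_def ell2_def suminf_nonneg)

lemma ell2_norm_nonneg: "u \<in> ell2 \<Longrightarrow> 0 \<le> ell2_norm u"
  by (simp add: ell2_norm_def ell2_def suminf_nonneg)

lemma ell2_summable_mult:
  assumes "u \<in> ell2" "w \<in> ell2"
  shows "summable (\<lambda>n. norm (u n) * norm (w n))"
proof (rule summable_comparison_test')
  show "summable (\<lambda>n. (norm (u n))\<^sup>2 + (norm (w n))\<^sup>2)"
    by (intro summable_add ell2_summable assms)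
  fix n
  have "2 * (norm (u n) * norm (w n)) \<le> (norm (u n))\<^sup>2 + (norm (w n))\<^sup>2"
    using sum_squares_bound[of "norm (u n)" "norm (w n)"] by simp
  moreover have "0 \<le> norm (u n) * norm (w n)" by simp
  ultimately show "norm (norm (u n) * norm (w n)) \<le> (norm (u n))\<^sup>2 + (norm (w n))\<^sup>2"
    unfolding real_norm_def by linarith
qed

lemma ell2_summable_inner:
  assumes "u \<in> ell2" "w \<in> ell2"
  shows "summable (\<lambda>n. u n * cnj (w n))"
  by (rule summable_norm_cancel) (use ell2_summable_mult[OF assms] in \<open>simp add: norm_mult\<close>)

lemma ell2_dominated:
  assumes "summable g" "u 0 = 0" "\<And>n. (norm (u n))\<^sup>2 \<le> g n"
  shows "u \<in> ell2"
  by (rule ell2_I, rule assms(2), rule summable_comparison_test'[OF assms(1), where N=0])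
     (use assms(3) in auto)

lemma ell2_add:
  assumes "u \<in> ell2" "w \<in> ell2"
  shows "(\<lambda>n. u n + w n) \<in> ell2"
proof (rule ell2_dominated)
  show "summable (\<lambda>n. 2 * (norm (u n))\<^sup>2 + 2 * (norm (w n))\<^sup>2)"
    by (intro summable_add summable_mult ell2_summable assms)
  fix n
  have "(norm (u n + w n))\<^sup>2 \<le> (norm (u n) + norm (w n))\<^sup>2"
    by (intro power_mono norm_triangle_ineq) auto
  also have "\<dots> \<le> 2 * (norm (u n))\<^sup>2 + 2 * (norm (w n))\<^sup>2"
    using sum_squares_bound[of "norm (u n)" "norm (w n)"] by (simp add: power2_sum)
  finally show "(norm (u n + w n))\<^sup>2 \<le> \<dots>" .
qed (simp add: ell2_0[OF assms(1)] ell2_0[OF assms(2)])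

lemma ell2_mult_bounded:
  fixes v :: "nat \<Rightarrow> complex"
  assumes "u \<in> ell2" "\<And>n. norm (v n) \<le> K"
  shows "(\<lambda>n. v n * u n) \<in> ell2"
proof (rule ell2_dominated)
  show "summable (\<lambda>n. K\<^sup>2 * (norm (u n))\<^sup>2)"
    by (intro summable_mult ell2_summable assms)
  fix n show "(norm (v n * u n))\<^sup>2 \<le> K\<^sup>2 * (norm (u n))\<^sup>2"
    unfolding norm_mult power_mult_distrib using assms(2)[of n]
    by (intro mult_right_mono power_mono) auto
qed (simp add: ell2_0[OF assms(1)])

lemma ell2_scale: "u \<in> ell2 \<Longrightarrow> (\<lambda>n. c * u n) \<in> ell2"
  by (rule ell2_mult_bounded[where K = "norm c"]) auto

lemma ell2_diff:
  assumes "u \<in> ell2" "w \<in> ell2"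
  shows "(\<lambda>n. u n - w n) \<in> ell2"
  using ell2_add[OF assms(1) ell2_scale[OF assms(2), of "-1"]] by simp

lemma ell2_zero: "(\<lambda>n. 0) \<in> ell2"
  by (simp add: ell2_def)

lemma ell2_sum: "(\<And>i. i \<in> I \<Longrightarrow> e i \<in> ell2) \<Longrightarrow> (\<lambda>n. \<Sum>i\<in>I. e i n) \<in> ell2"
  by (induction I rule: infinite_finite_induct) (auto intro: ell2_add ell2_zero)

lemma ell2_finite_support:
  assumes "u 0 = 0" "\<And>n. n > N \<Longrightarrow> u n = 0"
  shows "u \<in> ell2"
  by (rule ell2_I, rule assms(1), rule summable_finite[of "{..N}"])
    (use assms(2) in \<open>auto simp: not_le\<close>)

lemma ell2_inner_add_left: "u \<in> ell2 \<Longrightarrow> v \<in> ell2 \<Longrightarrow> w \<in> ell2 \<Longrightarrow> ell2_inner (\<lambda>n. u n + v n) w = ell2_inner u w + ell2_inner v w"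
  unfolding ell2_inner_def by (subst suminf_add) (auto intro: ell2_summable_inner simp: distrib_right)

lemma ell2_inner_diff_left: "u \<in> ell2 \<Longrightarrow> v \<in> ell2 \<Longrightarrow> w \<in> ell2 \<Longrightarrow> ell2_inner (\<lambda>n. u n - v n) w = ell2_inner u w - ell2_inner v w"
  unfolding ell2_inner_def by (subst suminf_diff) (auto intro: ell2_summable_inner simp: left_diff_distrib)

lemma ell2_inner_scale_left: "u \<in> ell2 \<Longrightarrow> w \<in> ell2 \<Longrightarrow> ell2_inner (\<lambda>n. c * u n) w = c * ell2_inner u w"
  unfolding ell2_inner_def by (subst suminf_mult[symmetric]) (auto intro: ell2_summable_inner simp: mult.assoc)

lemma ell2_inner_cnj: "u \<in> ell2 \<Longrightarrow> w \<in> ell2 \<Longrightarrow> cnj (ell2_inner u w) = ell2_inner w u"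
proof -
  assume "u \<in> ell2" "w \<in> ell2"
  hence "(\<lambda>n. u n * cnj (w n)) sums ell2_inner u w"
    unfolding ell2_inner_def by (intro summable_sums ell2_summable_inner)
  hence "(\<lambda>n. cnj (u n * cnj (w n))) sums cnj (ell2_inner u w)"
    by (subst sums_cnj)
  thus ?thesis
    unfolding ell2_inner_def[of w u] by (simp add: sums_iff mult.commute)
qed

lemma ell2_inner_diff_right: "u \<in> ell2 \<Longrightarrow> v \<in> ell2 \<Longrightarrow> w \<in> ell2 \<Longrightarrow> ell2_inner w (\<lambda>n. u n - v n) = ell2_inner w u - ell2_inner w v"
  unfolding ell2_inner_def by (subst suminf_diff) (auto intro: ell2_summable_inner simp: right_diff_distrib)

lemma ell2_inner_scale_right: "u \<in> ell2 \<Longrightarrow> w \<in> ell2 \<Longrightarrow> ell2_inner w (\<lambda>n. c * u n) = cnj c * ell2_inner w u"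
  unfolding ell2_inner_def by (subst suminf_mult[symmetric]) (auto intro: ell2_summable_inner simp: mult_ac)

lemma ell2_inner_sum_left:
  "(\<And>i. i \<in> I \<Longrightarrow> e i \<in> ell2) \<Longrightarrow> w \<in> ell2 \<Longrightarrow> ell2_inner (\<lambda>n. \<Sum>i\<in>I. e i n) w = (\<Sum>i\<in>I. ell2_inner (e i) w)"
proof (induction I rule: infinite_finite_induct)
  case (insert x F)
  thus ?case by (simp add: ell2_inner_add_left ell2_sum)
qed (simp_all add: ell2_inner_def)

lemma ell2_inner_self: "u \<in> ell2 \<Longrightarrow> ell2_inner u u = of_real ((ell2_norm u)\<^sup>2)"
  unfolding ell2_inner_def ell2_norm_sq
  by (subst suminf_of_real) (auto intro: ell2_summable simp: complex_norm_square simp del: of_real_power)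

lemma finite_sum_le_ell2_norm:
  assumes "u \<in> ell2" "finite A"
  shows "(\<Sum>n\<in>A. (norm (u n))\<^sup>2) \<le> (ell2_norm u)\<^sup>2"
  unfolding ell2_norm_sq[OF assms(1)] using assms
  by (intro sum_le_suminf ell2_summable) auto

lemma norm_le_ell2_norm: "u \<in> ell2 \<Longrightarrow> norm (u n) \<le> ell2_norm u"
  using finite_sum_le_ell2_norm[of u "{n}"] ell2_norm_nonneg[of u]
  by (simp add: power2_le_iff_abs_le)

lemma ell2_norm_eq_0: "u \<in> ell2 \<Longrightarrow> ell2_norm u = 0 \<longleftrightarrow> u = (\<lambda>n. 0)"
proof
  assume "u \<in> ell2" "ell2_norm u = 0"
  thus "u = (\<lambda>n. 0)" using norm_le_ell2_norm[of u] by fastforce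
qed (simp add: ell2_norm_def)

lemma ell2_bounded_partial_sums:
  assumes "u 0 = 0" "\<And>N. (\<Sum>n<N. (norm (u n))\<^sup>2) \<le> B"
  shows "u \<in> ell2" "(ell2_norm u)\<^sup>2 \<le> B"
proof -
  have s: "summable (\<lambda>n. (norm (u n))\<^sup>2)"
    by (rule summableI_nonneg_bounded) (use assms in auto)
  thus e: "u \<in> ell2" using assms(1) by (rule ell2_I[rotated])
  show "(ell2_norm u)\<^sup>2 \<le> B"
    unfolding ell2_norm_sq[OF e] using s assms(2) by (rule suminf_le_const)
qed

text \<open>
  Absolute values inside the sum, by passing to the limit in the finite inequality.
\<close>

lemma Cauchy_Schwarz_ell2:
  assumes "u \<in> ell2" "w \<in> ell2"
  shows "(\<Sum>n. norm (u n) * norm (w n)) \<le> ell2_norm u * ell2_norm w"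
proof (rule suminf_le_const[OF ell2_summable_mult[OF assms]])
  fix N
  have b: "L2_set (\<lambda>n. norm (v n)) {..<N} \<le> ell2_norm v" if "v \<in> ell2" for v
    unfolding L2_set_def using finite_sum_le_ell2_norm[OF that, of "{..<N}"] ell2_norm_nonneg[OF that]
    by (simp add: real_le_lsqrt sum_nonneg)
  have "(\<Sum>n<N. norm (u n) * norm (w n)) \<le> L2_set (\<lambda>n. norm (u n)) {..<N} * L2_set (\<lambda>n. norm (w n)) {..<N}"
    using L2_set_mult_ineq[of "\<lambda>n. norm (u n)" "\<lambda>n. norm (w n)" "{..<N}"] by simp
  also have "\<dots> \<le> ell2_norm u * ell2_norm w"
    using assms by (intro mult_mono b L2_set_nonneg ell2_norm_nonneg)
  finally show "(\<Sum>n<N. norm (u n) * norm (w n)) \<le> ell2_norm u * ell2_norm w" .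
qed

lemma norm_ell2_inner_le:
  assumes "u \<in> ell2" "w \<in> ell2"
  shows "norm (ell2_inner u w) \<le> ell2_norm u * ell2_norm w"
proof -
  have "norm (ell2_inner u w) \<le> (\<Sum>n. norm (u n * cnj (w n)))"
    unfolding ell2_inner_def by (rule summable_norm) (use ell2_summable_mult[OF assms] in \<open>simp add: norm_mult\<close>)
  also have "\<dots> \<le> ell2_norm u * ell2_norm w"
    using Cauchy_Schwarz_ell2[OF assms] by (simp add: norm_mult)
  finally show ?thesis .
qed

lemma ell2_norm_scale: "u \<in> ell2 \<Longrightarrow> ell2_norm (\<lambda>n. c * u n) = norm c * ell2_norm u"
  unfolding ell2_norm_def
  by (simp add: norm_mult power_mult_distrib suminf_mult ell2_summable real_sqrt_mult)

text \<open>
  The two shifts are adjoint to each other; at site \<open>1\<close> the right shift reads the entry at \<open>0\<close>, which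
  is \<open>0\<close> on \<open>ell2\<close>. This is how the boundary condition at \<open>n = 1\<close> enters.
\<close>

definition shift_left :: "(nat \<Rightarrow> complex) \<Rightarrow> nat \<Rightarrow> complex" where
  "shift_left u n = (if n = 0 then 0 else u (n + 1))"

definition shift_right :: "(nat \<Rightarrow> complex) \<Rightarrow> nat \<Rightarrow> complex" where
  "shift_right u n = (if n = 0 then 0 else u (n - 1))"

lemma shift_left_ell2: "u \<in> ell2 \<Longrightarrow> shift_left u \<in> ell2"
  by (rule ell2_dominated[of "\<lambda>n. (norm (u (Suc n)))\<^sup>2"])
    (simp_all add: shift_left_def ell2_summable summable_Suc_iff[of "\<lambda>n. (norm (u n))\<^sup>2"])

lemma shift_right_ell2:
  assumes "u \<in> ell2"
  shows "shift_right u \<in> ell2"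
proof (rule ell2_I)
  have "summable (\<lambda>n. (norm (shift_right u (Suc n)))\<^sup>2)"
    using ell2_summable[OF assms] by (simp add: shift_right_def)
  thus "summable (\<lambda>n. (norm (shift_right u n))\<^sup>2)"
    by (subst (asm) summable_Suc_iff[of "\<lambda>n. (norm (shift_right u n))\<^sup>2"])
qed (simp add: shift_right_def)

lemma ell2_inner_shift_left:
  assumes "u \<in> ell2" "w \<in> ell2"
  shows "ell2_inner (shift_left u) w = ell2_inner u (shift_right w)"
proof -
  have "ell2_inner u (shift_right w) = (\<Sum>n. u (Suc n) * cnj (w n))"
    unfolding ell2_inner_def using suminf_split_head[OF ell2_summable_inner[OF assms(1) shift_right_ell2[OF assms(2)]]]
    by (simp add: shift_right_def)
  also have "\<dots> = ell2_inner (shift_left u) w"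
    unfolding ell2_inner_def using ell2_0[OF assms(2)] by (intro suminf_cong) (auto simp: shift_left_def)
  finally show ?thesis ..
qed

lemma schroedinger_shifts:
  "u 0 = 0 \<Longrightarrow> schroedinger V u n = (shift_left u n + shift_right u n) + of_real (V n) * u n"
  by (auto simp: schroedinger_def shift_left_def shift_right_def numeral_2_eq_2)

section \<open>Symmetry and quadratic form of the operator\<close>

lemma bounded_potential_ell2:
  assumes "u \<in> ell2" "\<And>n. \<bar>V n\<bar> \<le> K"
  shows "(\<lambda>n. of_real (V n) * u n) \<in> ell2"
  by (rule ell2_mult_bounded[where K = K]) (use assms in auto)

lemma schroedinger_eq_shifts:
  "u \<in> ell2 \<Longrightarrow> schroedinger V u = (\<lambda>n. (shift_left u n + shift_right u n) + of_real (V n) * u n)"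
  by (rule ext, rule schroedinger_shifts, rule ell2_0)

lemma schroedinger_ell2:
  assumes "u \<in> ell2" "\<And>n. \<bar>V n\<bar> \<le> K"
  shows "schroedinger V u \<in> ell2"
  unfolding schroedinger_eq_shifts[OF assms(1)]
  by (intro ell2_add shift_left_ell2 shift_right_ell2 bounded_potential_ell2[OF assms] assms(1))

lemma schroedinger_dom_eq: "(\<And>n. \<bar>V n\<bar> \<le> K) \<Longrightarrow> schroedinger_dom V = ell2"
  unfolding schroedinger_dom_def using schroedinger_ell2 by blast

lemma schroedinger_linear:
  "schroedinger V (\<lambda>n. a * u n + b * w n) n = a * schroedinger V u n + b * schroedinger V w n"
  by (simp add: schroedinger_def algebra_simps)

lemma schroedinger_sum:
  "schroedinger V (\<lambda>n. \<Sum>i\<in>I. x i * e i n) n = (\<Sum>i\<in>I. x i * schroedinger V (e i) n)"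
  by (simp add: schroedinger_def sum.distrib sum_distrib_left distrib_left mult_ac)

lemma ell2_inner_shift_right:
  assumes "u \<in> ell2" "w \<in> ell2"
  shows "ell2_inner (shift_right u) w = ell2_inner u (shift_left w)"
  using ell2_inner_shift_left[OF assms(2,1)] ell2_inner_cnj assms shift_left_ell2 shift_right_ell2 by metis

lemma schroedinger_symmetric:
  assumes "u \<in> ell2" "w \<in> ell2" "\<And>n. \<bar>V n\<bar> \<le> K"
  shows "ell2_inner (schroedinger V u) w = ell2_inner u (schroedinger V w)"
proof -
  note m = shift_left_ell2 shift_right_ell2 assms(1,2) bounded_potential_ell2[OF assms(1,3)] bounded_potential_ell2[OF assms(2,3)] ell2_add
  have r: "ell2_inner u (\<lambda>n. v n + v' n) = ell2_inner u v + ell2_inner u v'" if "v \<in> ell2" "v' \<in> ell2" for v v'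
    using ell2_inner_diff_right[of v "\<lambda>n. - v' n" u] that assms(1) ell2_scale[of v' "-1"]
      ell2_inner_scale_right[of v' u "-1"] by simp
  have "ell2_inner (\<lambda>n. of_real (V n) * u n) w = ell2_inner u (\<lambda>n. of_real (V n) * w n)"
    unfolding ell2_inner_def by (simp add: mult_ac)
  thus ?thesis
    unfolding schroedinger_eq_shifts[OF assms(1)] schroedinger_eq_shifts[OF assms(2)]
    by (simp add: ell2_inner_add_left r m ell2_inner_shift_left ell2_inner_shift_right add.commute)
qed

definition energy :: "(nat \<Rightarrow> real) \<Rightarrow> (nat \<Rightarrow> complex) \<Rightarrow> real" where
  "energy V u = Re (ell2_inner (schroedinger V u) u)"

lemma ell2_inner_schroedinger_real:
  assumes "u \<in> ell2" "\<And>n. \<bar>V n\<bar> \<le> K"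
  shows "ell2_inner (schroedinger V u) u = of_real (energy V u)"
proof -
  have "cnj (ell2_inner (schroedinger V u) u) = ell2_inner (schroedinger V u) u"
    using ell2_inner_cnj[OF schroedinger_ell2[OF assms] assms(1)] schroedinger_symmetric[OF assms(1,1,2)] by simp
  thus ?thesis unfolding energy_def by (simp add: complex_eq_iff)
qed

lemma norm_sq_shift:
  assumes "u \<in> ell2" "summable (\<lambda>n. b n * (norm (u n))\<^sup>2)"
  shows "summable (\<lambda>n. b (Suc n) * (norm (u (Suc n)))\<^sup>2)"
    and "(\<Sum>n. b (Suc n) * (norm (u (Suc n)))\<^sup>2) = (\<Sum>n. b n * (norm (u n))\<^sup>2)"
  using summable_Suc_iff[of "\<lambda>n. b n * (norm (u n))\<^sup>2"] assms
    suminf_split_head[OF assms(2)] by (auto simp: ell2_0)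

lemma energy_sums:
  assumes "u \<in> ell2" "\<And>n. \<bar>V n\<bar> \<le> K"
  shows "(\<lambda>n. 2 * Re (u (Suc n) * cnj (u n)) + V n * (norm (u n))\<^sup>2) sums energy V u"
proof -
  note m = shift_left_ell2 shift_right_ell2 assms(1) bounded_potential_ell2[OF assms] ell2_add
  have "ell2_inner (shift_right u) u = cnj (ell2_inner (shift_left u) u)"
    using ell2_inner_cnj[of "shift_left u" u] ell2_inner_shift_right[of u u] m by simp
  hence e: "energy V u = 2 * Re (ell2_inner (shift_left u) u) + Re (ell2_inner (\<lambda>n. of_real (V n) * u n) u)"
    unfolding energy_def schroedinger_eq_shifts[OF assms(1)] by (simp add: ell2_inner_add_left m)
  have "(\<lambda>n. shift_left u n * cnj (u n)) sums ell2_inner (shift_left u) u"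
    unfolding ell2_inner_def by (intro summable_sums ell2_summable_inner m)
  moreover have "shift_left u n * cnj (u n) = u (Suc n) * cnj (u n)" for n
    using ell2_0[OF assms(1)] by (auto simp: shift_left_def)
  ultimately have 1: "(\<lambda>n. Re (u (Suc n) * cnj (u n))) sums Re (ell2_inner (shift_left u) u)"
    by (simp only: sums_Re)
  have "(\<lambda>n. of_real (V n) * u n * cnj (u n)) sums ell2_inner (\<lambda>n. of_real (V n) * u n) u"
    unfolding ell2_inner_def by (intro summable_sums ell2_summable_inner m)
  hence "(\<lambda>n. Re (of_real (V n) * u n * cnj (u n))) sums Re (ell2_inner (\<lambda>n. of_real (V n) * u n) u)"
    by (rule sums_Re)
  moreover have "Re (of_real (V n) * u n * cnj (u n)) = V n * (norm (u n))\<^sup>2" for n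
    by (metis Re_complex_of_real complex_norm_square mult.assoc of_real_mult)
  ultimately have 2: "(\<lambda>n. V n * (norm (u n))\<^sup>2) sums Re (ell2_inner (\<lambda>n. of_real (V n) * u n) u)"
    by simp
  show ?thesis unfolding e by (intro sums_add sums_mult 1 2)
qed

text \<open>
  The weighted inequality \<open>2 \<bar>u(n) u(n+1)\<bar> \<le> a(n) \<bar>u(n)\<bar>\<^sup>2 + b(n+1) \<bar>u(n+1)\<bar>\<^sup>2\<close> reduces the form to a
  diagonal one. For a positive sequence \<open>p\<close> the weights \<open>a(n) = p(n+1) / p(n)\<close>, \<open>b(n) = p(n-1) / p(n)\<close>
  are admissible, and the condition at a site then says that \<open>p\<close> is a supersolution. It is
  only required where \<open>u\<close> does not vanish, so \<open>p\<close> may change from block to block if \<open>u\<close> vanishes in between.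
  The sign \<open>\<sigma>\<close> treats both band edges at once.
\<close>

lemma energy_le:
  fixes a b :: "nat \<Rightarrow> real"
  assumes u: "u \<in> ell2" and V: "\<And>n. \<bar>V n\<bar> \<le> K" and \<sigma>: "\<sigma> \<in> {1,-1}"
    and edge: "\<And>n. 2 * (norm (u (Suc n)) * norm (u n)) \<le> a n * (norm (u n))\<^sup>2 + b (Suc n) * (norm (u (Suc n)))\<^sup>2"
    and pos: "\<And>n. a n \<ge> 0" "\<And>n. b n \<ge> 0"
    and site: "\<And>n. u n \<noteq> 0 \<Longrightarrow> a n + b n + \<sigma> * V n \<le> C"
  shows "\<sigma> * energy V u \<le> C * (ell2_norm u)\<^sup>2"
proof -
  have sm: "summable (\<lambda>n. c n * (norm (u n))\<^sup>2)" if "\<And>n. u n \<noteq> 0 \<Longrightarrow> 0 \<le> c n \<and> c n \<le> D" for c D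
  proof (rule summable_comparison_test'[where N=0])
    show "summable (\<lambda>n. D * (norm (u n))\<^sup>2)" by (intro summable_mult ell2_summable u)
    fix n show "norm (c n * (norm (u n))\<^sup>2) \<le> D * (norm (u n))\<^sup>2"
      using that[of n] by (cases "u n = 0") (auto intro!: mult_right_mono)
  qed
  have bd: "0 \<le> a n \<and> a n \<le> C + K" "0 \<le> b n \<and> b n \<le> C + K" if "u n \<noteq> 0" for n
    using site[OF that] pos[of n] V[of n] \<sigma> by auto
  have sa: "summable (\<lambda>n. a n * (norm (u n))\<^sup>2)" by (rule sm) (rule bd)
  have sb: "summable (\<lambda>n. b n * (norm (u n))\<^sup>2)" by (rule sm) (rule bd)
  have "0 \<le> \<sigma> * V n + K \<and> \<sigma> * V n + K \<le> 2 * K" for n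
    using V[of n] \<sigma> by (auto simp: abs_le_iff)
  hence "summable (\<lambda>n. (\<sigma> * V n + K) * (norm (u n))\<^sup>2 - K * (norm (u n))\<^sup>2)"
    by (intro summable_diff sm summable_mult ell2_summable u) blast
  hence sv: "summable (\<lambda>n. (\<sigma> * V n) * (norm (u n))\<^sup>2)"
    by (simp add: distrib_right)
  have "(\<lambda>n. \<sigma> * (2 * Re (u (Suc n) * cnj (u n)) + V n * (norm (u n))\<^sup>2)) sums (\<sigma> * energy V u)"
    by (intro sums_mult energy_sums[OF u V])
  moreover have "(\<lambda>n. a n * (norm (u n))\<^sup>2 + b (Suc n) * (norm (u (Suc n)))\<^sup>2 + (\<sigma> * V n) * (norm (u n))\<^sup>2)
     sums ((\<Sum>n. a n * (norm (u n))\<^sup>2) + (\<Sum>n. b n * (norm (u n))\<^sup>2) + (\<Sum>n. (\<sigma> * V n) * (norm (u n))\<^sup>2))"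
    using norm_sq_shift[OF u sb] sa sv by (intro sums_add) (auto simp: sums_iff)
  moreover have "\<sigma> * (2 * Re (u (Suc n) * cnj (u n)) + V n * (norm (u n))\<^sup>2)
     \<le> a n * (norm (u n))\<^sup>2 + b (Suc n) * (norm (u (Suc n)))\<^sup>2 + (\<sigma> * V n) * (norm (u n))\<^sup>2" for n
  proof -
    have "\<bar>Re (u (Suc n) * cnj (u n))\<bar> \<le> norm (u (Suc n)) * norm (u n)"
      using abs_Re_le_cmod[of "u (Suc n) * cnj (u n)"] by (simp add: norm_mult)
    hence "\<sigma> * (2 * Re (u (Suc n) * cnj (u n))) \<le> 2 * (norm (u (Suc n)) * norm (u n))"
      using \<sigma> by auto
    thus ?thesis using edge[of n] by (simp add: distrib_left)
  qed
  ultimately have "\<sigma> * energy V u \<le> (\<Sum>n. a n * (norm (u n))\<^sup>2) + (\<Sum>n. b n * (norm (u n))\<^sup>2) + (\<Sum>n. (\<sigma> * V n) * (norm (u n))\<^sup>2)"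
    by (rule sums_le[rotated])
  also have "\<dots> = (\<Sum>n. (a n + b n + \<sigma> * V n) * (norm (u n))\<^sup>2)"
    unfolding distrib_right by (simp add: suminf_add[symmetric] sa sb sv summable_add)
  also have "\<dots> \<le> (\<Sum>n. C * (norm (u n))\<^sup>2)"
  proof (rule suminf_le)
    show "(a n + b n + \<sigma> * V n) * (norm (u n))\<^sup>2 \<le> C * (norm (u n))\<^sup>2" for n
      using site[of n] by (cases "u n = 0") (auto intro!: mult_right_mono)
    show "summable (\<lambda>n. (a n + b n + \<sigma> * V n) * (norm (u n))\<^sup>2)"
      unfolding distrib_right by (intro summable_add sa sb sv)
  qed (intro summable_mult ell2_summable u)
  also have "\<dots> = C * (ell2_norm u)\<^sup>2"
    unfolding ell2_norm_sq[OF u] by (intro suminf_mult ell2_summable u)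
  finally show ?thesis .
qed

text \<open>
  The case \<open>p = 1\<close>.
\<close>

lemma energy_crude:
  assumes u: "u \<in> ell2" and V: "\<And>n. \<bar>V n\<bar> \<le> K" and \<sigma>: "\<sigma> \<in> {1,-1}"
    and d: "\<And>n. u n \<noteq> 0 \<Longrightarrow> \<bar>V n\<bar> \<le> \<delta>"
  shows "\<sigma> * energy V u \<le> (2 + \<delta>) * (ell2_norm u)\<^sup>2"
proof (rule energy_le[OF u V \<sigma>, of "\<lambda>_. 1" "\<lambda>_. 1"])
  show "2 * (norm (u (Suc n)) * norm (u n)) \<le> 1 * (norm (u n))\<^sup>2 + 1 * (norm (u (Suc n)))\<^sup>2" for n
    using sum_squares_bound[of "norm (u (Suc n))" "norm (u n)"] by simp
  show "u n \<noteq> 0 \<Longrightarrow> 1 + 1 + \<sigma> * V n \<le> 2 + \<delta>" for n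
    using d[of n] \<sigma> by auto
qed auto

section \<open>Weyl sequences outside the band\<close>

text \<open>
  The solution normalised at the boundary. It spans the solutions vanishing at \<open>0\<close>, so \<open>z\<close> is an eigenvalue
  exactly if this sequence is square-summable.
\<close>

fun dirichlet :: "(nat \<Rightarrow> real) \<Rightarrow> complex \<Rightarrow> nat \<Rightarrow> complex" where
  "dirichlet V z 0 = 0"
| "dirichlet V z (Suc 0) = 1"
| "dirichlet V z (Suc (Suc n)) = (z - of_real (V (Suc n))) * dirichlet V z (Suc n) - dirichlet V z n"

lemma schroedinger_Suc:
  "u 0 = 0 \<Longrightarrow> schroedinger V u (Suc n) = u (Suc (Suc n)) + u n + of_real (V (Suc n)) * u (Suc n)"
  by (auto simp: schroedinger_def numeral_2_eq_2)

lemma schroedinger_dirichlet: "schroedinger V (dirichlet V z) n = z * dirichlet V z n"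
  by (cases n) (simp_all add: schroedinger_Suc, simp_all add: schroedinger_def algebra_simps)

lemma eigenfunction_unique:
  assumes "u 0 = 0" "\<And>n. schroedinger V u n = z * u n"
  shows "u n = u 1 * dirichlet V z n"
proof (induction n rule: dirichlet.induct[where ?a0.0 = V and ?a1.0 = z, of "\<lambda>_ _ n. u n = u 1 * dirichlet V z n"])
  case (3 V' z' n)
  have "u (Suc (Suc n)) = (z - of_real (V (Suc n))) * u (Suc n) - u n"
    using assms(2)[of "Suc n"] unfolding schroedinger_Suc[of u, OF assms(1)] by (simp add: algebra_simps)
  thus ?case using 3 by (simp add: algebra_simps)
qed (use assms in auto)

text \<open>
  The quadratic form of the free operator takes values in \<open>{-2..2}\<close> on unit vectors, at distance at least \<open>\<eta>\<close>
  from \<open>z\<close>. The potential changes it by at most \<open>\<eta>/2\<close> apart from the contribution of the first \<open>N\<close> sites.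
  Hence a unit vector is an approximate eigenvector only if it has mass on these sites.
\<close>

lemma energy_gap:
  assumes w: "w \<in> ell2" "ell2_norm w = 1" and V: "\<And>n. \<bar>V n\<bar> \<le> K"
    and tail: "\<And>n. n > N \<Longrightarrow> \<bar>V n\<bar> \<le> \<eta> / 2"
    and z: "\<And>q. q \<in> {-2..2} \<Longrightarrow> \<eta> \<le> norm (of_real q - z)" and \<eta>: "\<eta> > 0"
  shows "\<eta> / 2 \<le> ell2_norm (\<lambda>n. schroedinger V w n - z * w n) + K * (\<Sum>n\<le>N. (norm (w n))\<^sup>2)"
proof -
  define q where "q = energy (\<lambda>_. 0) w"
  have "q \<in> {-2..2}"
    using energy_crude[OF w(1), of "\<lambda>_. 0" 0 1 0] energy_crude[OF w(1), of "\<lambda>_. 0" 0 "-1" 0] w(2)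
    by (simp add: q_def)
  hence "\<eta> \<le> norm (of_real q - z)" by (rule z)
  have K: "K \<ge> 0" using V[of 0] by linarith
  have "(\<lambda>n. (2 * Re (w (Suc n) * cnj (w n)) + V n * (norm (w n))\<^sup>2)
      - (2 * Re (w (Suc n) * cnj (w n)) + 0 * (norm (w n))\<^sup>2)) sums (energy V w - q)"
    unfolding q_def by (intro sums_diff energy_sums[OF w(1), where K=K] V energy_sums[OF w(1), where K=0]) auto
  hence pot: "(\<lambda>n. V n * (norm (w n))\<^sup>2) sums (energy V w - q)" by simp
  define g where "g n = (if n \<in> {..N} then K * (norm (w n))\<^sup>2 else 0) + \<eta> / 2 * (norm (w n))\<^sup>2" for n
  have gs: "g sums ((\<Sum>n\<le>N. K * (norm (w n))\<^sup>2) + \<eta> / 2 * (ell2_norm w)\<^sup>2)"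
    unfolding g_def ell2_norm_sq[OF w(1)]
    by (intro sums_add sums_If_finite_set sums_mult summable_sums ell2_summable w) auto
  have g: "\<bar>V n * (norm (w n))\<^sup>2\<bar> \<le> g n" for n
  proof (cases "n \<le> N")
    case True
    have "\<bar>V n\<bar> * (norm (w n))\<^sup>2 \<le> K * (norm (w n))\<^sup>2" by (intro mult_right_mono V) auto
    thus ?thesis using True \<eta> by (simp add: g_def abs_mult add_increasing2)
  next
    case False
    have "\<bar>V n\<bar> * (norm (w n))\<^sup>2 \<le> \<eta> / 2 * (norm (w n))\<^sup>2" using False by (intro mult_right_mono tail) auto
    thus ?thesis using False by (simp add: g_def abs_mult)
  qed
  have "\<bar>energy V w - q\<bar> \<le> suminf g"
  proof -
    have s: "summable (\<lambda>n. \<bar>V n * (norm (w n))\<^sup>2\<bar>)"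
      by (rule summable_comparison_test'[OF sums_summable[OF gs], where N=0]) (use g in auto)
    have "\<bar>\<Sum>n. V n * (norm (w n))\<^sup>2\<bar> \<le> (\<Sum>n. \<bar>V n * (norm (w n))\<^sup>2\<bar>)"
      by (rule summable_rabs[OF s])
    also have "\<dots> \<le> suminf g" by (rule suminf_le[OF g s sums_summable[OF gs]])
    finally show ?thesis using sums_unique[OF pot] by simp
  qed
  also have "suminf g = K * (\<Sum>n\<le>N. (norm (w n))\<^sup>2) + \<eta> / 2"
    using sums_unique[OF gs] w(2) by (simp add: sum_distrib_left)
  finally have d: "\<bar>energy V w - q\<bar> \<le> K * (\<Sum>n\<le>N. (norm (w n))\<^sup>2) + \<eta> / 2" .
  have Hw: "schroedinger V w \<in> ell2" by (rule schroedinger_ell2[OF w(1) V])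
  have "of_real (energy V w) - z = ell2_inner (\<lambda>n. schroedinger V w n - z * w n) w"
    using w ell2_inner_schroedinger_real[OF w(1) V] by (simp add: ell2_inner_diff_left Hw ell2_scale ell2_inner_scale_left ell2_inner_self)
  hence "norm (of_real (energy V w) - z) \<le> ell2_norm (\<lambda>n. schroedinger V w n - z * w n)"
    using norm_ell2_inner_le[OF ell2_diff[OF Hw ell2_scale[OF w(1)]] w(1)] w(2) by simp
  moreover have "norm (of_real q - z) \<le> norm (of_real (energy V w) - z) + \<bar>energy V w - q\<bar>"
  proof -
    have "of_real q - z = (of_real (energy V w) - z) - of_real (energy V w - q)" by simp
    thus ?thesis by (metis norm_of_real norm_triangle_ineq4)
  qed
  ultimately show ?thesis using d \<open>\<eta> \<le> norm (of_real q - z)\<close> by simp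
qed

lemma dist_to_band:
  assumes "z \<notin> complex_of_real ` {-2..2}"
  shows "\<exists>\<eta>>0. \<forall>q\<in>{-2..2}. \<eta> \<le> norm (complex_of_real q - z)"
proof -
  have "closed (complex_of_real ` {-2..2})"
    by (intro compact_imp_closed compact_continuous_image continuous_intros) auto
  then obtain e where "e > 0" "\<forall>x\<in>complex_of_real ` {-2..2}. e \<le> dist z x"
    using separate_point_closed[of "complex_of_real ` {-2..2}" z] assms by blast
  thus ?thesis by (intro exI[of _ e]) (auto simp: dist_norm norm_minus_commute)
qed

text \<open>
  By compactness the entries \<open>w k 1\<close> converge along a subsequence, and the recursion propagates this
  convergence to every site. If the limit \<open>t\<close> were \<open>0\<close>, the mass on every finite set of sites would vanish,
  against \<open>energy_gap\<close>. Square-summability of the limit is Fatou's lemma.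
\<close>

lemma weyl_sequence:
  assumes V0: "V \<longlonglongrightarrow> 0" and V: "\<And>n. \<bar>V n\<bar> \<le> K"
    and z: "z \<notin> complex_of_real ` {-2..2}"
    and w: "\<And>k. w k \<in> ell2" "\<And>k. ell2_norm (w k) = 1"
    and lim: "(\<lambda>k. ell2_norm (\<lambda>n. schroedinger V (w k) n - z * w k n)) \<longlonglongrightarrow> 0"
  obtains r t where "strict_mono r" "t \<noteq> 0" "dirichlet V z \<in> ell2"
    "\<And>n. (\<lambda>k. w (r k) n) \<longlonglongrightarrow> t * dirichlet V z n"
proof -
  have K: "K \<ge> 0" using V[of 0] by linarith
  define f where "f k n = schroedinger V (w k) n - z * w k n" for k n
  have f: "f k \<in> ell2" for k
    unfolding f_def by (intro ell2_diff schroedinger_ell2[OF _ V] ell2_scale w)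
  have fl: "(\<lambda>k. f k n) \<longlonglongrightarrow> 0" for n
  proof (rule tendsto_norm_zero_cancel, rule tendsto_sandwich[OF _ _ tendsto_const lim])
    show "\<forall>\<^sub>F k in sequentially. norm (f k n) \<le> ell2_norm (\<lambda>n. schroedinger V (w k) n - z * w k n)"
      using norm_le_ell2_norm[OF f] unfolding f_def by simp
  qed simp
  have "bounded (range (\<lambda>k. w k 1))"
    unfolding bounded_iff using norm_le_ell2_norm[OF w(1)] w(2) by auto
  then obtain t r where r: "strict_mono r" and t: "((\<lambda>k. w k 1) \<circ> r) \<longlonglongrightarrow> t"
    using bounded_imp_convergent_subsequence by blast
  have rl: "(\<lambda>k. X (r k)) \<longlonglongrightarrow> L" if "X \<longlonglongrightarrow> L" for X :: "nat \<Rightarrow> complex" and L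
    using LIMSEQ_subseq_LIMSEQ[OF that r] by (simp add: o_def)
  have conv: "(\<lambda>k. w (r k) n) \<longlonglongrightarrow> t * dirichlet V z n \<and> (\<lambda>k. w (r k) (Suc n)) \<longlonglongrightarrow> t * dirichlet V z (Suc n)" for n
  proof (induction n)
    case 0
    show ?case using t ell2_0[OF w(1)] by (simp add: o_def)
  next
    case (Suc n)
    have "w k (Suc (Suc n)) = f k (Suc n) + (z - of_real (V (Suc n))) * w k (Suc n) - w k n" for k
      unfolding f_def schroedinger_Suc[of "w k", OF ell2_0[OF w(1)]] by (simp add: algebra_simps)
    moreover have "(\<lambda>k. f (r k) (Suc n) + (z - of_real (V (Suc n))) * w (r k) (Suc n) - w (r k) n)
        \<longlonglongrightarrow> 0 + (z - of_real (V (Suc n))) * (t * dirichlet V z (Suc n)) - t * dirichlet V z n"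
      using Suc by (intro tendsto_intros rl[OF fl]) auto
    ultimately have "(\<lambda>k. w (r k) (Suc (Suc n))) \<longlonglongrightarrow>
        0 + (z - of_real (V (Suc n))) * (t * dirichlet V z (Suc n)) - t * dirichlet V z n"
      by (simp only:)
    hence "(\<lambda>k. w (r k) (Suc (Suc n))) \<longlonglongrightarrow> t * dirichlet V z (Suc (Suc n))"
      by (simp add: algebra_simps)
    thus ?case using Suc by blast
  qed
  have "t \<noteq> 0"
  proof
    assume "t = 0"
    obtain \<eta> where \<eta>: "\<eta> > 0" "\<And>q. q \<in> {-2..2} \<Longrightarrow> \<eta> \<le> norm (of_real q - z)"
      using dist_to_band[OF z] by blast
    obtain N where N: "\<And>n. n \<ge> N \<Longrightarrow> \<bar>V n\<bar> < \<eta> / 2"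
      using LIMSEQ_D[OF V0, of "\<eta> / 2"] \<eta>(1) by auto
    have "(\<lambda>k. ell2_norm (\<lambda>n. schroedinger V (w (r k)) n - z * w (r k) n) + K * (\<Sum>n\<le>N. (norm (w (r k) n))\<^sup>2))
        \<longlonglongrightarrow> 0 + K * (\<Sum>n\<le>N. (norm (t * dirichlet V z n))\<^sup>2)"
      using conv LIMSEQ_subseq_LIMSEQ[OF lim r] by (intro tendsto_intros) (auto simp: o_def)
    hence "\<eta> / 2 \<le> 0 + K * (\<Sum>n\<le>N. (norm (t * dirichlet V z n))\<^sup>2)"
    proof (rule LIMSEQ_le_const, intro exI allI impI)
      fix k show "\<eta> / 2 \<le> ell2_norm (\<lambda>n. schroedinger V (w (r k)) n - z * w (r k) n) + K * (\<Sum>n\<le>N. (norm (w (r k) n))\<^sup>2)"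
        using N by (intro energy_gap w V \<eta>) (auto intro: less_imp_le)
    qed
    thus False using \<open>t = 0\<close> \<eta> by simp
  qed
  have "(\<lambda>n. t * dirichlet V z n) \<in> ell2"
  proof (rule ell2_bounded_partial_sums(1)[where B = 1])
    fix M
    have "(\<lambda>k. \<Sum>n<M. (norm (w (r k) n))\<^sup>2) \<longlonglongrightarrow> (\<Sum>n<M. (norm (t * dirichlet V z n))\<^sup>2)"
      using conv by (intro tendsto_intros) auto
    thus "(\<Sum>n<M. (norm (t * dirichlet V z n))\<^sup>2) \<le> 1"
      by (rule LIMSEQ_le_const2) (use finite_sum_le_ell2_norm[OF w(1)] w(2) in auto)
  qed simp
  from ell2_scale[OF this, of "inverse t"] have "dirichlet V z \<in> ell2"
    using \<open>t \<noteq> 0\<close> by (simp add: mult.assoc[symmetric])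
  with \<open>t \<noteq> 0\<close> r conv show ?thesis by (intro that) auto
qed

lemma bounded_below:
  assumes V0: "V \<longlonglongrightarrow> 0" and V: "\<And>n. \<bar>V n\<bar> \<le> K"
    and z: "z \<notin> complex_of_real ` {-2..2}" and ne: "dirichlet V z \<notin> ell2"
  obtains c where "c > 0" "\<And>w. w \<in> ell2 \<Longrightarrow> c * ell2_norm w \<le> ell2_norm (\<lambda>n. schroedinger V w n - z * w n)"
proof -
  have "\<exists>c>0. \<forall>w\<in>ell2. c * ell2_norm w \<le> ell2_norm (\<lambda>n. schroedinger V w n - z * w n)"
  proof (rule ccontr)
    assume neg: "\<not> ?thesis"
    have "\<exists>w. w \<in> ell2 \<and> ell2_norm w = 1 \<and> ell2_norm (\<lambda>n. schroedinger V w n - z * w n) \<le> inverse (real (Suc k))" for k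
    proof -
      obtain w where w: "w \<in> ell2" "ell2_norm (\<lambda>n. schroedinger V w n - z * w n) < inverse (real (Suc k)) * ell2_norm w"
        using neg by (metis inverse_positive_iff_positive of_nat_0_less_iff zero_less_Suc not_le)
      have D: "(\<lambda>n. schroedinger V w n - z * w n) \<in> ell2"
        by (intro ell2_diff schroedinger_ell2[OF _ V] ell2_scale w)
      have p: "ell2_norm w > 0"
        using w(2) ell2_norm_nonneg[OF D] ell2_norm_nonneg[OF w(1)] by (cases "ell2_norm w = 0") auto
      define c where "c = complex_of_real (inverse (ell2_norm w))"
      have nc: "norm c = inverse (ell2_norm w)"
        using p unfolding c_def norm_of_real by simp
      have "schroedinger V (\<lambda>n. c * w n) n - z * (c * w n) = c * (schroedinger V w n - z * w n)" for n
        using schroedinger_linear[of V c w 0 w n] by (simp add: algebra_simps)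
      hence "ell2_norm (\<lambda>n. schroedinger V (\<lambda>n. c * w n) n - z * (c * w n)) = norm c * ell2_norm (\<lambda>n. schroedinger V w n - z * w n)"
        by (simp add: ell2_norm_scale D)
      also have "\<dots> \<le> inverse (real (Suc k))"
        using w(2) p unfolding nc by (simp add: field_simps)
      finally show ?thesis
        using w p by (intro exI[of _ "\<lambda>n. c * w n"]) (simp add: ell2_scale ell2_norm_scale nc)
    qed
    then obtain w where w: "\<And>k. w k \<in> ell2" "\<And>k. ell2_norm (w k) = 1"
      "\<And>k. ell2_norm (\<lambda>n. schroedinger V (w k) n - z * w k n) \<le> inverse (real (Suc k))"
      by metis
    have "0 \<le> ell2_norm (\<lambda>n. schroedinger V (w k) n - z * w k n)" for k
      by (intro ell2_norm_nonneg ell2_diff schroedinger_ell2[OF _ V] ell2_scale w(1))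
    hence "(\<lambda>k. ell2_norm (\<lambda>n. schroedinger V (w k) n - z * w k n)) \<longlonglongrightarrow> 0"
      by (intro tendsto_sandwich[OF _ _ tendsto_const LIMSEQ_inverse_real_of_nat] always_eventually allI w(3))
    from weyl_sequence[where w = w, OF V0 V z w(1,2) this] ne show False by metis
  qed
  thus ?thesis using that by blast
qed

section \<open>The spectrum outside the band\<close>

text \<open>
  A Fredholm alternative for finitely supported sequences: \<open>H - cnj z\<close> is solved backwards from
  the right end of the support, and orthogonality to \<open>dirichlet V z\<close> is the one condition for the solution
  to arrive at \<open>0\<close> with the correct boundary value.
\<close>

lemma in_range_of_adjoint:
  assumes "g 0 = 0" "\<And>n. n > Suc N \<Longrightarrow> g n = 0" "(\<Sum>n\<le>Suc N. g n * cnj (dirichlet V z n)) = 0"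
  shows "\<exists>w. w 0 = 0 \<and> (\<forall>n>N. w n = 0) \<and> (\<forall>n. schroedinger V w n - cnj z * w n = g n)"
  using assms
proof (induction N arbitrary: g)
  case 0
  have "g 1 = 0" using 0(1,3) by simp
  have "g n = 0" for n
  proof -
    consider "n = 0" | "n = 1" | "n > Suc 0" by linarith
    thus ?thesis using 0(1,2) \<open>g 1 = 0\<close> by cases auto
  qed
  thus ?case by (intro exI[of _ "\<lambda>_. 0"]) (simp add: schroedinger_def)
next
  case (Suc N)
  define a where "a = g (Suc (Suc N))"
  define e where "e n = (if n = Suc N then a else 0)" for n
  define h where "h n = schroedinger V e n - cnj z * e n" for n
  have e0: "e 0 = 0" by (simp add: e_def)
  have h: "h n = (if n = 0 then 0 else if n = N then a else if n = Suc N then (of_real (V n) - cnj z) * a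
                  else if n = Suc (Suc N) then a else 0)" for n
    unfolding h_def by (cases n) (auto simp: schroedinger_Suc[of e, OF e0], auto simp: e_def schroedinger_def algebra_simps)
  have hs: "(\<Sum>n\<le>Suc (Suc N). h n * cnj (dirichlet V z n)) = 0"
  proof -
    have "(\<Sum>n\<le>Suc (Suc N). h n * cnj (dirichlet V z n)) = (\<Sum>n\<in>{N, Suc N, Suc (Suc N)}. h n * cnj (dirichlet V z n))"
      by (rule sum.mono_neutral_right) (auto simp: h)
    also have "\<dots> = 0" by (simp add: h algebra_simps)
    finally show ?thesis .
  qed
  have top: "g (Suc (Suc N)) - h (Suc (Suc N)) = 0" by (simp add: h a_def)
  have "\<exists>w. w 0 = 0 \<and> (\<forall>n>N. w n = 0) \<and> (\<forall>n. schroedinger V w n - cnj z * w n = g n - h n)"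
  proof (rule Suc.IH)
    show "g 0 - h 0 = 0" using Suc.prems(1) by (simp add: h)
    fix n assume "n > Suc N"
    show "g n - h n = 0"
      using Suc.prems(2)[of n] top \<open>n > Suc N\<close> by (cases "n = Suc (Suc N)") (auto simp: h)
  next
    have "(\<Sum>n\<le>Suc (Suc N). (g n - h n) * cnj (dirichlet V z n)) = 0"
      using Suc.prems(3) hs by (simp only: left_diff_distrib sum_subtractf diff_zero)
    thus "(\<Sum>n\<le>Suc N. (g n - h n) * cnj (dirichlet V z n)) = 0"
      using top by (simp only: sum.atMost_Suc[of _ "Suc N"] mult_zero_left add_0_right)
  qed
  then obtain w where w: "w 0 = 0" "\<forall>n>N. w n = 0" "\<forall>n. schroedinger V w n - cnj z * w n = g n - h n"
    by blast
  have "schroedinger V (\<lambda>n. w n + e n) n - cnj z * (w n + e n) = g n" for n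
    using w(3)[rule_format, of n] schroedinger_linear[of V 1 w 1 e n] by (simp add: h_def algebra_simps)
  thus ?case using w(1,2) e0 by (intro exI[of _ "\<lambda>n. w n + e n"]) (auto simp: e_def)
qed

text \<open>
  All solutions of \<open>(H - z) u = f\<close>, parametrised by the value at \<open>1\<close>.
\<close>

fun initial_value_solution :: "(nat \<Rightarrow> real) \<Rightarrow> complex \<Rightarrow> (nat \<Rightarrow> complex) \<Rightarrow> complex \<Rightarrow> nat \<Rightarrow> complex" where
  "initial_value_solution V z f t 0 = 0"
| "initial_value_solution V z f t (Suc 0) = t"
| "initial_value_solution V z f t (Suc (Suc n)) =
     f (Suc n) + (z - of_real (V (Suc n))) * initial_value_solution V z f t (Suc n) - initial_value_solution V z f t n"

lemma initial_value_solution_eq: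
  "f 0 = 0 \<Longrightarrow> schroedinger V (initial_value_solution V z f t) n - z * initial_value_solution V z f t n = f n"
  by (cases n) (simp_all add: schroedinger_Suc, simp_all add: schroedinger_def algebra_simps)

lemma initial_value_solution_affine:
  "initial_value_solution V z f t n = initial_value_solution V z f 0 n + t * dirichlet V z n"
  by (induction V z f t n rule: initial_value_solution.induct) (auto simp: algebra_simps)

text \<open>
  For each \<open>N\<close> the parameter \<open>t\<close> is chosen such that the solution has minimal norm on \<open>{1..N+1}\<close>, that is, its
  restriction \<open>v\<close> is orthogonal to \<open>dirichlet V z\<close>. Then \<open>v = (H - cnj z) w\<close> for some \<open>w\<close> supported in \<open>{1..N}\<close>,
  and \<open>\<parallel>v\<parallel>\<^sup>2 = \<langle>f, w\<rangle> \<le> \<parallel>f\<parallel> \<parallel>v\<parallel> / c\<close> bounds the solution uniformly in \<open>N\<close>; a limit point of the parameters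
  solves the problem on the half-line.
\<close>

lemma surjective_if_adjoint_bounded_below:
  assumes V: "\<And>n. \<bar>V n\<bar> \<le> K" and c: "c > 0"
    and below: "\<And>w. w \<in> ell2 \<Longrightarrow> c * ell2_norm w \<le> ell2_norm (\<lambda>n. schroedinger V w n - cnj z * w n)"
    and f: "f \<in> ell2"
  obtains u where "u \<in> ell2" "\<And>n. schroedinger V u n - z * u n = f n" "ell2_norm u \<le> ell2_norm f / c"
proof -
  let ?u = "initial_value_solution V z f"
  let ?\<phi> = "dirichlet V z"
  have u0: "?u t 0 = 0" for t by simp
  have eq: "schroedinger V (?u t) n - z * ?u t n = f n" for t n
    by (rule initial_value_solution_eq[of f, OF ell2_0[OF f]])
  have "\<exists>t. (\<Sum>n<N. (norm (?u t n))\<^sup>2) \<le> (ell2_norm f / c)\<^sup>2 \<and> norm t \<le> ell2_norm f / c" for N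
  proof -
    define s where "s = (\<Sum>n\<le>Suc N. ?\<phi> n * cnj (?\<phi> n))"
    define S where "S = (\<Sum>n\<le>Suc N. (norm (?\<phi> n))\<^sup>2)"
    have "s = of_real S"
      unfolding s_def S_def by (simp only: of_real_sum complex_norm_square)
    moreover have "S \<ge> (norm (?\<phi> 1))\<^sup>2"
      unfolding S_def by (rule member_le_sum) auto
    ultimately have s: "s \<noteq> 0" by auto
    \<comment> \<open>This parameter makes the restriction to \<open>{1..N+1}\<close> orthogonal to the Dirichlet solution.\<close>
    define t where "t = - (\<Sum>n\<le>Suc N. ?u 0 n * cnj (?\<phi> n)) / s"
    define v where "v n = (if n \<le> Suc N then ?u t n else 0)" for n
    have "(\<Sum>n\<le>Suc N. v n * cnj (?\<phi> n)) = (\<Sum>n\<le>Suc N. ?u 0 n * cnj (?\<phi> n)) + t * s"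
      unfolding s_def v_def sum_distrib_left sum.distrib[symmetric]
      by (rule sum.cong) (auto simp: initial_value_solution_affine[of V z f t] algebra_simps)
    hence "(\<Sum>n\<le>Suc N. v n * cnj (?\<phi> n)) = 0" using s by (simp add: t_def)
    then obtain w where w: "w 0 = 0" "\<forall>n>N. w n = 0" "\<And>n. schroedinger V w n - cnj z * w n = v n"
      using in_range_of_adjoint[of v N V z] by (auto simp: v_def)
    have we: "w \<in> ell2" by (rule ell2_finite_support[of w N, OF w(1)]) (use w(2) in auto)
    have ve: "v \<in> ell2" by (rule ell2_finite_support[of _ "Suc N"]) (auto simp: v_def)
    have H: "schroedinger V u \<in> ell2" if "u \<in> ell2" for u by (rule schroedinger_ell2[OF that V])
    have vw: "v = (\<lambda>n. schroedinger V w n - cnj z * w n)" using w(3) by auto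
    have "complex_of_real ((ell2_norm v)\<^sup>2) = ell2_inner v (\<lambda>n. schroedinger V w n - cnj z * w n)"
      using ell2_inner_self[OF ve] vw by simp
    also have "\<dots> = ell2_inner (\<lambda>n. schroedinger V v n - z * v n) w"
      using schroedinger_symmetric[OF ve we V]
      by (simp add: ell2_inner_diff_right ell2_inner_diff_left ve we H ell2_scale ell2_inner_scale_left ell2_inner_scale_right)
    also have "\<dots> = ell2_inner f w"
      unfolding ell2_inner_def
    proof (intro suminf_cong)
      fix n
      show "(schroedinger V v n - z * v n) * cnj (w n) = f n * cnj (w n)"
      proof (cases "n = 0 \<or> n > N")
        case True thus ?thesis using w(1,2) by auto
      next
        case False
        then obtain m where m: "n = Suc m" "m < N" by (cases n) auto
        have "schroedinger V v n - z * v n = schroedinger V (?u t) n - z * ?u t n"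
          using m by (simp add: schroedinger_Suc v_def)
        thus ?thesis by (simp only: eq)
      qed
    qed
    finally have "(ell2_norm v)\<^sup>2 \<le> ell2_norm f * ell2_norm w"
      using norm_ell2_inner_le[OF f we] by (metis norm_of_real abs_ge_self order_trans)
    also have "\<dots> \<le> ell2_norm f * (ell2_norm v / c)"
      using below[OF we] c ell2_norm_nonneg[OF f] unfolding vw[symmetric]
      by (intro mult_left_mono) (auto simp: field_simps)
    finally have "ell2_norm v * ell2_norm v \<le> (ell2_norm f / c) * ell2_norm v"
      by (simp add: power2_eq_square)
    moreover have "0 \<le> ell2_norm f / c" using ell2_norm_nonneg[OF f] c by simp
    ultimately have nv: "ell2_norm v \<le> ell2_norm f / c"
      using ell2_norm_nonneg[OF ve] by (metis mult_right_le_imp_le order_le_less)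
    have "(\<Sum>n<N. (norm (?u t n))\<^sup>2) = (\<Sum>n<N. (norm (v n))\<^sup>2)"
      by (rule sum.cong) (auto simp: v_def)
    also have "\<dots> \<le> (ell2_norm v)\<^sup>2" by (rule finite_sum_le_ell2_norm[OF ve]) simp
    also have "\<dots> \<le> (ell2_norm f / c)\<^sup>2"
      by (rule power_mono[OF nv ell2_norm_nonneg[OF ve]])
    finally show ?thesis
      using norm_le_ell2_norm[OF ve, of 1] nv by (intro exI[of _ t]) (auto simp: v_def)
  qed
  then obtain t where t: "\<And>N. (\<Sum>n<N. (norm (?u (t N) n))\<^sup>2) \<le> (ell2_norm f / c)\<^sup>2"
      "\<And>N. norm (t N) \<le> ell2_norm f / c"
    by metis
  have "bounded (range t)" unfolding bounded_iff using t(2) by auto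
  then obtain T r where r: "strict_mono r" and T: "(t \<circ> r) \<longlonglongrightarrow> T"
    using bounded_imp_convergent_subsequence by blast
  have ps: "(\<Sum>n<M. (norm (?u T n))\<^sup>2) \<le> (ell2_norm f / c)\<^sup>2" for M
  proof (rule LIMSEQ_le_const2)
    show "(\<lambda>k. \<Sum>n<M. (norm (?u (t (r k)) n))\<^sup>2) \<longlonglongrightarrow> (\<Sum>n<M. (norm (?u T n))\<^sup>2)"
    proof (intro tendsto_intros)
      fix n show "(\<lambda>k. ?u (t (r k)) n) \<longlonglongrightarrow> ?u T n"
        unfolding initial_value_solution_affine[of V z f "t _"] initial_value_solution_affine[of V z f T]
        using T by (intro tendsto_intros) (simp add: o_def)
    qed
    have "(\<Sum>n<M. (norm (?u (t (r k)) n))\<^sup>2) \<le> (ell2_norm f / c)\<^sup>2" if "k \<ge> M" for k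
    proof -
      have "M \<le> r k" using seq_suble[OF r, of k] that by simp
      hence "(\<Sum>n<M. (norm (?u (t (r k)) n))\<^sup>2) \<le> (\<Sum>n<r k. (norm (?u (t (r k)) n))\<^sup>2)"
        by (intro sum_mono2) auto
      thus ?thesis using t(1)[of "r k"] by linarith
    qed
    thus "\<exists>N. \<forall>k\<ge>N. (\<Sum>n<M. (norm (?u (t (r k)) n))\<^sup>2) \<le> (ell2_norm f / c)\<^sup>2" by blast
  qed
  have "?u T \<in> ell2" "(ell2_norm (?u T))\<^sup>2 \<le> (ell2_norm f / c)\<^sup>2"
    using ell2_bounded_partial_sums[OF u0 ps] by auto
  moreover from this(2) have "ell2_norm (?u T) \<le> ell2_norm f / c"
    by (rule power2_le_imp_le) (use c ell2_norm_nonneg[OF f] in auto)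
  ultimately show ?thesis using that eq by blast
qed

lemma dirichlet_cnj: "dirichlet V (cnj z) n = cnj (dirichlet V z n)"
  by (induction V z n rule: dirichlet.induct) auto

lemma dirichlet_cnj_ell2: "dirichlet V (cnj z) \<in> ell2 \<longleftrightarrow> dirichlet V z \<in> ell2"
  unfolding ell2_def by (simp add: dirichlet_cnj)

lemma cnj_in_band: "cnj z \<in> complex_of_real ` {-2..2} \<longleftrightarrow> z \<in> complex_of_real ` {-2..2}"
  by (metis complex_cnj_cnj complex_cnj_complex_of_real image_iff)

text \<open>
  Without an eigenvector at \<open>z\<close> there is none at \<open>cnj z\<close> either, because \<open>V\<close> is real, so both operators
  are bounded below.
\<close>

lemma resolvent_iff:
  assumes V0: "V \<longlonglongrightarrow> 0" and V: "\<And>n. \<bar>V n\<bar> \<le> K" and z: "z \<notin> complex_of_real ` {-2..2}"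
  shows "z \<in> resolvent_set V \<longleftrightarrow> dirichlet V z \<notin> ell2"
proof
  let ?A = "\<lambda>u n. schroedinger V u n - z * u n"
  note dom = schroedinger_dom_eq[of V, OF V]
  show "dirichlet V z \<notin> ell2" if "z \<in> resolvent_set V"
  proof
    assume e: "dirichlet V z \<in> ell2"
    have "inj_on ?A ell2"
      using that unfolding resolvent_set_def dom by (simp add: bij_betw_def)
    moreover have "?A (dirichlet V z) = ?A (\<lambda>n. 0)"
      by (rule ext) (simp add: schroedinger_dirichlet schroedinger_def[of V "\<lambda>n. 0"])
    ultimately have "dirichlet V z = (\<lambda>n. 0)" using e ell2_zero by (rule inj_onD)
    hence "dirichlet V z 1 = 0" by simp
    thus False by simp
  qed
  assume ne: "dirichlet V z \<notin> ell2"
  have "dirichlet V (cnj z) \<notin> ell2" "cnj z \<notin> complex_of_real ` {-2..2}"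
    using ne z by (simp_all only: dirichlet_cnj_ell2 cnj_in_band not_False_eq_True)
  then obtain c where c: "c > 0" "\<And>w. w \<in> ell2 \<Longrightarrow> c * ell2_norm w \<le> ell2_norm (\<lambda>n. schroedinger V w n - cnj z * w n)"
    using bounded_below[OF V0 V] by blast
  obtain c' where c': "c' > 0" "\<And>w. w \<in> ell2 \<Longrightarrow> c' * ell2_norm w \<le> ell2_norm (?A w)"
    using bounded_below[OF V0 V z ne] by blast
  have A: "?A u \<in> ell2" if "u \<in> ell2" for u
    by (intro ell2_diff schroedinger_ell2[OF _ V] ell2_scale that)
  have "inj_on ?A ell2"
  proof (rule inj_onI)
    fix u w assume uw: "u \<in> ell2" "w \<in> ell2" "?A u = ?A w"
    have d: "(\<lambda>n. u n - w n) \<in> ell2" using uw by (intro ell2_diff)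
    have "?A (\<lambda>n. u n - w n) n = 0" for n
    proof -
      have "schroedinger V (\<lambda>n. u n - w n) n = schroedinger V u n - schroedinger V w n"
        using schroedinger_linear[of V 1 u "-1" w n] by simp
      thus ?thesis using fun_cong[OF uw(3), of n] by algebra
    qed
    hence "?A (\<lambda>n. u n - w n) = (\<lambda>n. 0)" by blast
    hence "c' * ell2_norm (\<lambda>n. u n - w n) \<le> ell2_norm (\<lambda>n. 0)" using c'(2)[OF d] by simp
    hence "ell2_norm (\<lambda>n. u n - w n) = 0"
      using ell2_norm_nonneg[OF d] c'(1) ell2_norm_eq_0[OF ell2_zero] by (simp add: mult_le_0_iff)
    hence z: "(\<lambda>n. u n - w n) = (\<lambda>n. 0)" using ell2_norm_eq_0[OF d] by simp
    show "u = w" using fun_cong[OF z] by (intro ext) simp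
  qed
  moreover have "?A ` ell2 = ell2"
  proof (intro equalityI subsetI)
    fix f assume "f \<in> ell2"
    then obtain u where "u \<in> ell2" "\<And>n. ?A u n = f n"
      using surjective_if_adjoint_bounded_below[OF V c(1,2)] by blast
    thus "f \<in> ?A ` ell2" by (intro image_eqI[of _ _ u]) auto
  qed (use A in auto)
  moreover have "\<exists>C. \<forall>u\<in>ell2. ell2_norm u \<le> C * ell2_norm (?A u)"
    using c' by (intro exI[of _ "1 / c'"]) (auto simp: field_simps)
  ultimately show "z \<in> resolvent_set V"
    unfolding resolvent_set_def dom bij_betw_def by blast
qed

lemma eigenvalue_real:
  assumes V: "\<And>n. \<bar>V n\<bar> \<le> K" and e: "dirichlet V z \<in> ell2"
  shows "z \<in> \<real>"
proof -
  have "ell2_norm (dirichlet V z) \<noteq> 0"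
    using ell2_norm_eq_0[OF e] by (metis dirichlet.simps(2) zero_neq_one)
  moreover have "schroedinger V (dirichlet V z) = (\<lambda>n. z * dirichlet V z n)"
    using schroedinger_dirichlet by blast
  hence "of_real (energy V (dirichlet V z)) = z * of_real ((ell2_norm (dirichlet V z))\<^sup>2)"
    using ell2_inner_schroedinger_real[OF e, of V K, OF V] by (simp add: ell2_inner_scale_left e ell2_inner_self)
  ultimately have "z = of_real (energy V (dirichlet V z) / (ell2_norm (dirichlet V z))\<^sup>2)"
    by (simp add: field_simps)
  thus ?thesis by (metis Reals_of_real)
qed

text \<open>
  The real eigenvalues outside the band.
\<close>

definition bound_states :: "(nat \<Rightarrow> real) \<Rightarrow> real set" where
  "bound_states V = {E. E \<notin> {-2..2} \<and> dirichlet V (of_real E) \<in> ell2}"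

lemma spectrum_outside_band:
  assumes V0: "V \<longlonglongrightarrow> 0" and V: "\<And>n. \<bar>V n\<bar> \<le> K"
  shows "spectrum V - complex_of_real ` {-2..2} = complex_of_real ` bound_states V"
proof (intro equalityI subsetI)
  fix z assume z: "z \<in> spectrum V - complex_of_real ` {-2..2}"
  hence e: "dirichlet V z \<in> ell2" using resolvent_iff[OF V0 V] unfolding spectrum_def by blast
  then obtain E where "z = of_real E" using eigenvalue_real[OF V e] by (auto elim: Reals_cases)
  thus "z \<in> complex_of_real ` bound_states V" using e z unfolding bound_states_def by blast
next
  fix z assume "z \<in> complex_of_real ` bound_states V"
  then obtain E where E: "z = of_real E" "E \<notin> {-2..2}" "dirichlet V z \<in> ell2"
    unfolding bound_states_def by blast
  have n: "z \<notin> complex_of_real ` {-2..2}" using E(1,2) by auto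
  thus "z \<in> spectrum V - complex_of_real ` {-2..2}"
    using resolvent_iff[OF V0 V n] E(3) unfolding spectrum_def by blast
qed

text \<open>
  Once the bound states accumulate at most at the band, each of them is isolated in the spectrum. The eigenspace
  is spanned by a single solution of the recursion.
\<close>

lemma bound_state_discrete:
  assumes V0: "V \<longlonglongrightarrow> 0" and V: "\<And>n. \<bar>V n\<bar> \<le> K"
    and fin: "\<And>\<delta>. \<delta> > 0 \<Longrightarrow> finite {E \<in> bound_states V. \<bar>E\<bar> > 2 + \<delta>}"
    and E: "E \<in> bound_states V"
  shows "discrete_eigenvalue V (of_real E)"
proof -
  define F where "F = {E' \<in> bound_states V. \<bar>E'\<bar> > 2 + (\<bar>E\<bar> - 2) / 2} - {E}"
  have E2: "\<bar>E\<bar> > 2" using E unfolding bound_states_def by auto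
  have "finite F" unfolding F_def using E2 by (intro finite_Diff fin) auto
  define T where "T = {z. norm z > 2 + (\<bar>E\<bar> - 2) / 2} - complex_of_real ` F"
  have "open T" unfolding T_def using \<open>finite F\<close>
    by (intro open_Diff open_Collect_less continuous_intros finite_imp_closed finite_imageI)
  have sp: "of_real E \<in> spectrum V" using spectrum_outside_band[OF V0 V] E by blast
  have "T \<inter> spectrum V = {of_real E}"
  proof (intro equalityI subsetI)
    fix z assume z: "z \<in> T \<inter> spectrum V"
    have "norm z > 2" using z E2 by (auto simp: T_def field_simps)
    hence "z \<notin> complex_of_real ` {-2..2}" by auto
    then obtain E' where E': "z = of_real E'" "E' \<in> bound_states V" using spectrum_outside_band[OF V0 V] z by blast
    hence "E' \<notin> F" "\<bar>E'\<bar> > 2 + (\<bar>E\<bar> - 2) / 2" using z by (auto simp: T_def)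
    thus "z \<in> {of_real E}" using E' unfolding F_def by blast
  next
    have "2 + (\<bar>E\<bar> - 2) / 2 < \<bar>E\<bar>" using E2 by (simp add: field_simps)
    thus "z \<in> T \<inter> spectrum V" if "z \<in> {of_real E}" for z
      using that sp by (auto simp: T_def F_def)
  qed
  hence iso: "of_real E isolated_in spectrum V"
    using \<open>open T\<close> sp unfolding isolated_in_def by blast
  have phi: "dirichlet V (of_real E) \<in> eigenspace V (of_real E)"
    using E unfolding eigenspace_def schroedinger_dom_eq[of V, OF V] bound_states_def
    by (auto simp: schroedinger_dirichlet)
  have nz: "dirichlet V (of_real E) \<noteq> (\<lambda>n. 0)" by (metis dirichlet.simps(2) zero_neq_one)
  have "finite_dimensional (eigenspace V (of_real E))"
    unfolding finite_dimensional_def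
  proof (intro exI[of _ "{dirichlet V (of_real E)}"] conjI ballI)
    fix u assume u: "u \<in> eigenspace V (of_real E)"
    hence "u 0 = 0" "\<And>n. schroedinger V u n = of_real E * u n"
      unfolding eigenspace_def schroedinger_dom_eq[of V, OF V] by (auto simp: ell2_0)
    hence "u n = u 1 * dirichlet V (of_real E) n" for n by (rule eigenfunction_unique[of u])
    hence "u = (\<lambda>n. u 1 * dirichlet V (of_real E) n)" by blast
    thus "\<exists>c. u = (\<lambda>n. \<Sum>b\<in>{dirichlet V (complex_of_real E)}. c b * b n)"
      by (intro exI[of _ "\<lambda>_. u 1"]) (simp add: sum.insert)
  qed (use phi in auto)
  with iso phi nz show ?thesis unfolding discrete_eigenvalue_def by blast
qed

section \<open>Variational bounds on the number of bound states\<close>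

text \<open>
  Gaussian elimination, one equation at a time.
\<close>

lemma underdetermined_system:
  fixes A :: "'i \<Rightarrow> 'b \<Rightarrow> complex"
  assumes "finite B" "finite I" "card B < card I"
  shows "\<exists>x. (\<exists>i\<in>I. x i \<noteq> 0) \<and> (\<forall>b\<in>B. (\<Sum>i\<in>I. x i * A i b) = 0)"
  using assms
proof (induction B arbitrary: I A rule: finite_induct)
  case empty
  hence "I \<noteq> {}" by auto
  thus ?case by (intro exI[of _ "\<lambda>_. 1"]) auto
next
  case (insert b B)
  show ?case
  proof (cases "\<forall>i\<in>I. A i b = 0")
    case True
    have "card B < card I" using insert by simp
    then obtain x where "\<exists>i\<in>I. x i \<noteq> 0" "\<forall>c\<in>B. (\<Sum>i\<in>I. x i * A i c) = 0"
      using insert.IH[OF insert.prems(1), of A] by blast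
    thus ?thesis using True by (intro exI[of _ x]) auto
  next
    case False
    then obtain k where k: "k \<in> I" "A k b \<noteq> 0" by blast
    define J where "J = I - {k}"
    have J: "finite J" "k \<notin> J" "I = insert k J" using insert.prems(1) k by (auto simp: J_def)
    have "card B < card J" using insert J by (simp add: J(3))
    then obtain x where x: "\<exists>i\<in>J. x i \<noteq> 0" "\<forall>c\<in>B. (\<Sum>i\<in>J. x i * (A i c - A i b / A k b * A k c)) = 0"
      using insert.IH[of J "\<lambda>i c. A i c - A i b / A k b * A k c"] J(1) by blast
    define s where "s = (\<Sum>i\<in>J. x i * A i b)"
    define y where "y = x(k := - s / A k b)"
    have sum: "(\<Sum>i\<in>I. y i * A i c) = (\<Sum>i\<in>J. x i * A i c) - s / A k b * A k c" for c
    proof -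
      have "(\<Sum>i\<in>J. y i * A i c) = (\<Sum>i\<in>J. x i * A i c)"
        using J(2) by (intro sum.cong) (auto simp: y_def)
      thus ?thesis unfolding J(3) using J(1,2) by (simp add: y_def)
    qed
    have "(\<Sum>i\<in>I. y i * A i c) = 0" if "c \<in> insert b B" for c
    proof (cases "c = b")
      case True thus ?thesis using k(2) sum[of b] by (simp add: s_def)
    next
      case False
      have "0 = (\<Sum>i\<in>J. x i * (A i c - A i b / A k b * A k c))" using x(2) that False by auto
      also have "\<dots> = (\<Sum>i\<in>J. x i * A i c) - s / A k b * A k c"
        unfolding s_def sum_divide_distrib sum_distrib_right sum_subtractf[symmetric]
        by (intro sum.cong) (auto simp: right_diff_distrib)
      finally show ?thesis using sum[of c] by simp
    qed
    moreover have "\<exists>i\<in>I. y i \<noteq> 0" using x(1) J by (auto simp: y_def)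
    ultimately show ?thesis by blast
  qed
qed

lemma ell2_inner_sum_right:
  assumes "\<And>i. i \<in> I \<Longrightarrow> e i \<in> ell2" "w \<in> ell2"
  shows "ell2_inner w (\<lambda>n. \<Sum>i\<in>I. e i n) = (\<Sum>i\<in>I. ell2_inner w (e i))"
proof -
  have "ell2_inner w (\<lambda>n. \<Sum>i\<in>I. e i n) = cnj (ell2_inner (\<lambda>n. \<Sum>i\<in>I. e i n) w)"
    by (rule ell2_inner_cnj[symmetric]) (auto intro: ell2_sum assms)
  also have "\<dots> = (\<Sum>i\<in>I. cnj (ell2_inner (e i) w))"
    using ell2_inner_sum_left[of I e w] assms by simp
  also have "\<dots> = (\<Sum>i\<in>I. ell2_inner w (e i))"
    using assms by (intro sum.cong refl ell2_inner_cnj)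
  finally show ?thesis .
qed

lemma ell2_inner_biorthogonal:
  assumes "finite I" "\<And>i. i \<in> I \<Longrightarrow> f i \<in> ell2" "\<And>i. i \<in> I \<Longrightarrow> e i \<in> ell2"
    and orth: "\<And>i j. i \<in> I \<Longrightarrow> j \<in> I \<Longrightarrow> i \<noteq> j \<Longrightarrow> ell2_inner (f i) (e j) = 0"
  shows "ell2_inner (\<lambda>n. \<Sum>i\<in>I. x i * f i n) (\<lambda>n. \<Sum>i\<in>I. x i * e i n)
           = (\<Sum>i\<in>I. of_real ((norm (x i))\<^sup>2) * ell2_inner (f i) (e i))"
proof -
  have "ell2_inner (\<lambda>n. \<Sum>i\<in>I. x i * f i n) (\<lambda>n. \<Sum>i\<in>I. x i * e i n)
      = (\<Sum>i\<in>I. x i * (\<Sum>j\<in>I. cnj (x j) * ell2_inner (f i) (e j)))"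
  proof -
    let ?w = "\<lambda>n. \<Sum>i\<in>I. x i * e i n"
    have w: "?w \<in> ell2" using assms(3) by (intro ell2_sum ell2_scale)
    have "ell2_inner (\<lambda>n. \<Sum>i\<in>I. x i * f i n) ?w = (\<Sum>i\<in>I. ell2_inner (\<lambda>n. x i * f i n) ?w)"
      using assms(2) w by (intro ell2_inner_sum_left ell2_scale)
    moreover have "ell2_inner (\<lambda>n. x i * f i n) ?w = x i * (\<Sum>j\<in>I. cnj (x j) * ell2_inner (f i) (e j))" if i: "i \<in> I" for i
    proof -
      have "ell2_inner (f i) ?w = (\<Sum>j\<in>I. ell2_inner (f i) (\<lambda>n. x j * e j n))"
        using assms(2)[OF i] assms(3) by (intro ell2_inner_sum_right ell2_scale)
      also have "\<dots> = (\<Sum>j\<in>I. cnj (x j) * ell2_inner (f i) (e j))"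
        using assms(2)[OF i] assms(3) by (intro sum.cong refl ell2_inner_scale_right)
      finally show ?thesis using assms(2)[OF i] w by (simp add: ell2_inner_scale_left)
    qed
    ultimately show ?thesis by simp
  qed
  also have "\<dots> = (\<Sum>i\<in>I. of_real ((norm (x i))\<^sup>2) * ell2_inner (f i) (e i))"
  proof (rule sum.cong[OF refl])
    fix i assume i: "i \<in> I"
    have "(\<Sum>j\<in>I. cnj (x j) * ell2_inner (f i) (e j)) = (\<Sum>j\<in>{i}. cnj (x j) * ell2_inner (f i) (e j))"
      using i assms(1) orth by (intro sum.mono_neutral_right) auto
    thus "x i * (\<Sum>j\<in>I. cnj (x j) * ell2_inner (f i) (e j)) = of_real ((norm (x i))\<^sup>2) * ell2_inner (f i) (e i)"
      by (simp only: complex_norm_square sum.insert[OF finite.emptyI] empty_iff not_False_eq_True sum.empty) simp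
  qed
  finally show ?thesis .
qed

lemma energy_orthogonal_family:
  assumes "finite I" and e: "\<And>i. i \<in> I \<Longrightarrow> e i \<in> ell2" and V: "\<And>n. \<bar>V n\<bar> \<le> K"
    and orth: "\<And>i j. i \<in> I \<Longrightarrow> j \<in> I \<Longrightarrow> i \<noteq> j \<Longrightarrow> ell2_inner (e i) (e j) = 0"
    and orthH: "\<And>i j. i \<in> I \<Longrightarrow> j \<in> I \<Longrightarrow> i \<noteq> j \<Longrightarrow> ell2_inner (schroedinger V (e i)) (e j) = 0"
  shows "energy V (\<lambda>n. \<Sum>i\<in>I. x i * e i n) = (\<Sum>i\<in>I. (norm (x i))\<^sup>2 * energy V (e i))"
    and "(ell2_norm (\<lambda>n. \<Sum>i\<in>I. x i * e i n))\<^sup>2 = (\<Sum>i\<in>I. (norm (x i))\<^sup>2 * (ell2_norm (e i))\<^sup>2)"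
proof -
  let ?u = "\<lambda>n. \<Sum>i\<in>I. x i * e i n"
  have u: "?u \<in> ell2" by (intro ell2_sum ell2_scale e)
  have "of_real ((ell2_norm ?u)\<^sup>2) = (\<Sum>i\<in>I. of_real ((norm (x i))\<^sup>2) * ell2_inner (e i) (e i))"
    using ell2_inner_biorthogonal[of I e e x] assms(1) e orth ell2_inner_self[OF u] by simp
  also have "\<dots> = complex_of_real (\<Sum>i\<in>I. (norm (x i))\<^sup>2 * (ell2_norm (e i))\<^sup>2)"
    using e by (simp add: ell2_inner_self)
  finally show "(ell2_norm ?u)\<^sup>2 = (\<Sum>i\<in>I. (norm (x i))\<^sup>2 * (ell2_norm (e i))\<^sup>2)"
    by (simp only: of_real_eq_iff)
  have "schroedinger V ?u = (\<lambda>n. \<Sum>i\<in>I. x i * schroedinger V (e i) n)"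
    by (rule ext) (rule schroedinger_sum)
  hence "of_real (energy V ?u) = (\<Sum>i\<in>I. of_real ((norm (x i))\<^sup>2) * ell2_inner (schroedinger V (e i)) (e i))"
    using ell2_inner_biorthogonal[of I "\<lambda>i. schroedinger V (e i)" e x] assms(1) e orthH
      ell2_inner_schroedinger_real[OF u, of V K, OF V] schroedinger_ell2[of _ V, OF _ V] by simp
  also have "\<dots> = complex_of_real (\<Sum>i\<in>I. (norm (x i))\<^sup>2 * energy V (e i))"
    using e ell2_inner_schroedinger_real[of _ V K, OF _ V] by simp
  finally show "energy V ?u = (\<Sum>i\<in>I. (norm (x i))\<^sup>2 * energy V (e i))"
    by (simp only: of_real_eq_iff)
qed

abbreviation bound_state :: "(nat \<Rightarrow> real) \<Rightarrow> real \<Rightarrow> nat \<Rightarrow> complex" where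
  "bound_state V E \<equiv> dirichlet V (complex_of_real E)"

lemma schroedinger_bound_state: "schroedinger V (bound_state V E) = (\<lambda>n. of_real E * bound_state V E n)"
  by (rule ext) (rule schroedinger_dirichlet)

lemma bound_state_norm_pos: "bound_state V E \<in> ell2 \<Longrightarrow> ell2_norm (bound_state V E) > 0"
  using norm_le_ell2_norm[of "bound_state V E" 1] by simp

lemma energy_bound_state:
  "bound_state V E \<in> ell2 \<Longrightarrow> energy V (bound_state V E) = E * (ell2_norm (bound_state V E))\<^sup>2"
  unfolding energy_def schroedinger_bound_state by (simp add: ell2_inner_scale_left ell2_inner_self)

lemma bound_states_orthogonal:
  assumes V: "\<And>n. \<bar>V n\<bar> \<le> K" and "bound_state V E \<in> ell2" "bound_state V E' \<in> ell2" "E \<noteq> E'"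
  shows "ell2_inner (bound_state V E) (bound_state V E') = 0"
proof -
  have "of_real E * ell2_inner (bound_state V E) (bound_state V E') = of_real E' * ell2_inner (bound_state V E) (bound_state V E')"
    using schroedinger_symmetric[OF assms(2,3), of V K, OF V] assms(2,3)
    unfolding schroedinger_bound_state by (simp add: ell2_inner_scale_left ell2_inner_scale_right)
  thus ?thesis using assms(4) by simp
qed

text \<open>
  More bound states than sites in \<open>B\<close> would admit a nontrivial combination of eigenvectors that vanishes on
  \<open>B\<close>; as the eigenvectors are orthogonal, its energy exceeds the bound assumed for such sequences.
\<close>

lemma card_bound_states_le:
  assumes V: "\<And>n. \<bar>V n\<bar> \<le> K" and B: "finite B"
    and form: "\<And>u. u \<in> ell2 \<Longrightarrow> (\<And>b. b \<in> B \<Longrightarrow> u b = 0) \<Longrightarrow> \<sigma> * energy V u \<le> C * (ell2_norm u)\<^sup>2"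
  shows "finite {E \<in> bound_states V. \<sigma> * E > C} \<and> card {E \<in> bound_states V. \<sigma> * E > C} \<le> card B"
proof (rule finite_if_finite_subsets_card_bdd)
  fix I assume I: "I \<subseteq> {E \<in> bound_states V. \<sigma> * E > C}" "finite I"
  show "card I \<le> card B"
  proof (rule ccontr)
    assume "\<not> card I \<le> card B"
    then obtain x where x: "\<exists>i\<in>I. x i \<noteq> 0" "\<forall>b\<in>B. (\<Sum>i\<in>I. x i * bound_state V i b) = 0"
      using underdetermined_system[OF B I(2), of "bound_state V"] by auto
    have e: "bound_state V i \<in> ell2" if "i \<in> I" for i using I(1) that by (auto simp: bound_states_def)
    let ?u = "\<lambda>n. \<Sum>i\<in>I. x i * bound_state V i n"
    have orth: "ell2_inner (bound_state V i) (bound_state V j) = 0" if "i \<in> I" "j \<in> I" "i \<noteq> j" for i j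
      using bound_states_orthogonal[of V K, OF V e[OF that(1)] e[OF that(2)] that(3)] .
    have orthH: "ell2_inner (schroedinger V (bound_state V i)) (bound_state V j) = 0" if "i \<in> I" "j \<in> I" "i \<noteq> j" for i j
      unfolding schroedinger_bound_state using orth[OF that] e that by (simp add: ell2_inner_scale_left)
    note fam = energy_orthogonal_family[of I "bound_state V" V K x, OF I(2) e V orth orthH]
    have "\<sigma> * energy V ?u \<le> C * (ell2_norm ?u)\<^sup>2"
      using x(2) by (intro form ell2_sum ell2_scale e) auto
    hence "(\<Sum>i\<in>I. (norm (x i))\<^sup>2 * ((\<sigma> * i - C) * (ell2_norm (bound_state V i))\<^sup>2)) \<le> 0"
      using fam e
      by (simp add: energy_bound_state sum_distrib_left sum_subtractf algebra_simps)
    moreover have "(\<Sum>i\<in>I. (norm (x i))\<^sup>2 * ((\<sigma> * i - C) * (ell2_norm (bound_state V i))\<^sup>2)) > 0"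
    proof -
      obtain k where k: "k \<in> I" "x k \<noteq> 0" using x(1) by blast
      show ?thesis
      proof (rule sum_pos2[OF I(2) k(1)])
        show "0 < (norm (x k))\<^sup>2 * ((\<sigma> * k - C) * (ell2_norm (bound_state V k))\<^sup>2)"
          using k I(1) bound_state_norm_pos[OF e[OF k(1)]] by (intro mult_pos_pos) auto
        fix i assume "i \<in> I"
        thus "0 \<le> (norm (x i))\<^sup>2 * ((\<sigma> * i - C) * (ell2_norm (bound_state V i))\<^sup>2)"
          using I(1) by (intro mult_nonneg_nonneg) (auto intro: less_imp_le)
      qed
    qed
    ultimately show False by simp
  qed
qed

text \<open>
  Bounded sequences that converge at every site converge weakly: the part of \<open>g\<close> beyond \<open>N\<close> has small norm.
\<close>

lemma weak_limit_orthogonal: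
  assumes w: "\<And>k. w k \<in> ell2" "\<And>k. ell2_norm (w k) \<le> 1" and g: "g \<in> ell2"
    and orth: "\<And>k. ell2_inner (w k) g = 0" and v: "v \<in> ell2" "\<And>n. (\<lambda>k. w k n) \<longlonglongrightarrow> v n"
  shows "ell2_inner v g = 0"
proof -
  define T where "T N = (\<Sum>n. (norm (g (n + N)))\<^sup>2)" for N
  have part: "norm (\<Sum>n<N. v n * cnj (g n)) \<le> sqrt (T N)" for N
  proof -
    define h where "h n = (if n < N then 0 else g n)" for n
    have h: "h \<in> ell2"
      by (rule ell2_dominated[OF ell2_summable[OF g]]) (auto simp: h_def ell2_0[OF g])
    have "(ell2_norm h)\<^sup>2 = T N"
      using suminf_split_initial_segment[OF ell2_summable[OF h], of N]
      by (simp add: ell2_norm_sq[OF h] T_def h_def)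
    hence hn: "ell2_norm h = sqrt (T N)"
      using ell2_norm_nonneg[OF h] by (metis real_sqrt_abs abs_of_nonneg)
    have "norm (\<Sum>n<N. w k n * cnj (g n)) \<le> sqrt (T N)" for k
    proof -
      have s: "summable (\<lambda>n. w k n * cnj (g n))" by (rule ell2_summable_inner[OF w(1) g])
      have "ell2_inner (w k) h = (\<Sum>n. w k (n + N) * cnj (g (n + N)))"
        using suminf_split_initial_segment[OF ell2_summable_inner[OF w(1) h], of k N]
        by (simp add: ell2_inner_def h_def)
      moreover have "ell2_inner (w k) g = (\<Sum>n. w k (n + N) * cnj (g (n + N))) + (\<Sum>n<N. w k n * cnj (g n))"
        unfolding ell2_inner_def by (rule suminf_split_initial_segment[OF s])
      ultimately have "(\<Sum>n<N. w k n * cnj (g n)) = - ell2_inner (w k) h"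
        using orth[of k] by (simp add: add_eq_0_iff)
      hence "norm (\<Sum>n<N. w k n * cnj (g n)) \<le> ell2_norm (w k) * ell2_norm h"
        using norm_ell2_inner_le[OF w(1) h] by simp
      also have "\<dots> \<le> 1 * ell2_norm h" by (intro mult_right_mono w ell2_norm_nonneg h)
      finally show ?thesis by (simp add: hn)
    qed
    moreover have "(\<lambda>k. norm (\<Sum>n<N. w k n * cnj (g n))) \<longlonglongrightarrow> norm (\<Sum>n<N. v n * cnj (g n))"
      by (intro tendsto_intros v)
    ultimately show ?thesis by (intro LIMSEQ_le_const2) auto
  qed
  have "(\<lambda>N. norm (\<Sum>n<N. v n * cnj (g n))) \<longlonglongrightarrow> norm (ell2_inner v g)"
    unfolding ell2_inner_def by (intro tendsto_norm summable_LIMSEQ ell2_summable_inner v g)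
  moreover have "(\<lambda>N. sqrt (T N)) \<longlonglongrightarrow> sqrt 0"
  proof (rule tendsto_real_sqrt)
    have "T = (\<lambda>N. (\<Sum>n. (norm (g n))\<^sup>2) - (\<Sum>n<N. (norm (g n))\<^sup>2))"
      unfolding T_def using suminf_minus_initial_segment[OF ell2_summable[OF g]] by blast
    moreover have "(\<lambda>N. (\<Sum>n. (norm (g n))\<^sup>2) - (\<Sum>n<N. (norm (g n))\<^sup>2)) \<longlonglongrightarrow> (\<Sum>n. (norm (g n))\<^sup>2) - (\<Sum>n. (norm (g n))\<^sup>2)"
      by (intro tendsto_intros summable_LIMSEQ ell2_summable g)
    ultimately show "T \<longlonglongrightarrow> 0" by simp
  qed
  ultimately have "norm (ell2_inner v g) \<le> sqrt 0" using part by (intro LIMSEQ_le) auto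
  thus ?thesis by simp
qed

text \<open>
  The supremum \<open>L\<close> of the energy over unit vectors orthogonal to the given eigenvectors exceeds \<open>2\<close>. A
  maximising sequence is a Weyl sequence for \<open>L\<close>, because \<open>L - H\<close> is nonnegative on this invariant subspace and
  the inequality \<open>\<parallel>(L - H) w\<parallel>\<^sup>2 \<le> M \<langle>(L - H) w, w\<rangle>\<close> holds for a nonnegative operator with upper
  bound \<open>M\<close>. Hence \<open>L\<close> is an eigenvalue; its eigenvector is a weak limit of vectors orthogonal to the given ones, so
  \<open>L\<close> is not among the given eigenvalues.
\<close>

lemma another_bound_state:
  assumes V0: "V \<longlonglongrightarrow> 0" and V: "\<And>n. \<bar>V n\<bar> \<le> K"
    and F: "F \<subseteq> bound_states V"
    and u: "u \<in> ell2" "\<And>E. E \<in> F \<Longrightarrow> ell2_inner u (bound_state V E) = 0" "energy V u > 2 * (ell2_norm u)\<^sup>2"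
  shows "\<exists>E\<in>bound_states V. E > 2 \<and> E \<notin> F"
proof -
  have K: "K \<ge> 0" using V[of 0] by linarith
  have Fe: "bound_state V E \<in> ell2" if "E \<in> F" for E using that F by (auto simp: bound_states_def)
  have H: "schroedinger V w \<in> ell2" if "w \<in> ell2" for w by (rule schroedinger_ell2[OF that V])
  define X where "X = {w \<in> ell2. \<forall>E\<in>F. ell2_inner w (bound_state V E) = 0}"
  have Xe: "w \<in> ell2" if "w \<in> X" for w using that by (simp add: X_def)
  have Xs: "(\<lambda>n. c * w n) \<in> X" if "w \<in> X" for w c
    using that Fe by (auto simp: X_def ell2_scale ell2_inner_scale_left)
  have Xd: "(\<lambda>n. w n - v n) \<in> X" if "w \<in> X" "v \<in> X" for w v
    using that Fe by (auto simp: X_def ell2_diff ell2_inner_diff_left)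
  have XH: "schroedinger V w \<in> X" if "w \<in> X" for w
    using that Fe schroedinger_symmetric[of w _ V K, OF _ _ V]
    by (auto simp: X_def H schroedinger_bound_state ell2_inner_scale_right)
  have es: "energy V (\<lambda>n. c * w n) = (norm c)\<^sup>2 * energy V w" if "w \<in> ell2" for c w
    using energy_orthogonal_family(1)[of "{()}" "\<lambda>_. w" V K "\<lambda>_. c"] that V by simp
  define R where "R = energy V ` {w \<in> X. ell2_norm w = 1}"
  define L where "L = Sup R"
  have cr: "\<bar>energy V w\<bar> \<le> (2 + K) * (ell2_norm w)\<^sup>2" if "w \<in> ell2" for w
    using energy_crude[OF that, of V K 1 K] energy_crude[OF that, of V K "-1" K] V by simp
  have bdd: "bdd_above R"
    unfolding bdd_above_def R_def using cr Xe by (intro exI[of _ "2 + K"]) force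
  have unit: "\<exists>v\<in>X. ell2_norm v = 1 \<and> energy V v = energy V w / (ell2_norm w)\<^sup>2"
    if "w \<in> X" "ell2_norm w > 0" for w
  proof -
    define c where "c = complex_of_real (inverse (ell2_norm w))"
    have nc: "norm c = inverse (ell2_norm w)" using that unfolding c_def norm_of_real by simp
    show ?thesis
      using that Xs[OF that(1)] Xe[OF that(1)]
      by (intro bexI[of _ "\<lambda>n. c * w n"]) (auto simp: es ell2_norm_scale nc power_inverse divide_inverse mult.commute)
  qed
  have pos0: "energy V w \<le> L * (ell2_norm w)\<^sup>2" if wX: "w \<in> X" for w
  proof (cases "ell2_norm w = 0")
    case True thus ?thesis using cr[OF Xe[OF wX]] by simp
  next
    case False
    hence p: "ell2_norm w > 0" using ell2_norm_nonneg[OF Xe[OF wX]] by simp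
    obtain v where "v \<in> X" "ell2_norm v = 1" "energy V v = energy V w / (ell2_norm w)\<^sup>2"
      using unit[OF wX p] by blast
    hence "energy V w / (ell2_norm w)\<^sup>2 \<le> L"
      unfolding L_def using bdd by (intro cSup_upper) (auto simp: R_def intro!: image_eqI[of _ _ v])
    thus ?thesis using p by (simp add: divide_le_eq)
  qed
  have uX: "u \<in> X" using u by (simp add: X_def)
  have "ell2_norm u \<noteq> 0" using cr[OF u(1)] u(3) by auto
  hence up: "ell2_norm u > 0" using ell2_norm_nonneg[OF u(1)] by simp
  have L2: "L > 2"
  proof -
    have "2 * (ell2_norm u)\<^sup>2 < L * (ell2_norm u)\<^sup>2" using pos0[OF uX] u(3) by linarith
    thus ?thesis using up by simp
  qed
  have Rne: "R \<noteq> {}" using unit[OF uX up] by (auto simp: R_def)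
  define M where "M = L + 2 + K"
  have M: "M > 0" using L2 K by (simp add: M_def)
  have key: "(ell2_norm (\<lambda>n. schroedinger V w n - of_real L * w n))\<^sup>2 \<le> M * (L - energy V w)"
    if w: "w \<in> X" "ell2_norm w = 1" for w
  proof -
    define D where "D v n = of_real L * v n - schroedinger V v n" for v n
    have DX: "D v \<in> X" if "v \<in> X" for v unfolding D_def by (intro Xd Xs XH that)
    have De: "D v \<in> ell2" if "v \<in> ell2" for v unfolding D_def by (intro ell2_diff ell2_scale H that)
    have Dsym: "ell2_inner (D v) v' = ell2_inner v (D v')" if "v \<in> ell2" "v' \<in> ell2" for v v'
      using that schroedinger_symmetric[OF that, of V K, OF V] unfolding D_def
      by (simp add: ell2_inner_diff_left ell2_inner_diff_right ell2_scale H ell2_inner_scale_left ell2_inner_scale_right)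
    have q: "Re (ell2_inner (D v) v) = L * (ell2_norm v)\<^sup>2 - energy V v" if "v \<in> ell2" for v
      using that unfolding D_def energy_def by (simp add: ell2_inner_diff_left ell2_scale H ell2_inner_scale_left ell2_inner_self)
    have we: "w \<in> ell2" using w Xe by blast
    define y where "y = D w"
    have yX: "y \<in> X" and ye: "y \<in> ell2" using DX[OF w(1)] Xe unfolding y_def by auto
    define \<tau> where "\<tau> = 1 / M"
    define t where "t = complex_of_real \<tau>"
    \<comment> \<open>Nonnegativity of the form of \<open>D\<close> at \<open>w - y / M\<close> is the wanted inequality.\<close>
    define v where "v = (\<lambda>n. w n - t * y n)"
    have vX: "v \<in> X" unfolding v_def by (intro Xd Xs w yX)
    have Dv: "D v = (\<lambda>n. D w n - t * D y n)"
      using schroedinger_linear[of V 1 w "-t" y] unfolding D_def v_def by (simp add: algebra_simps fun_eq_iff)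
    have left: "ell2_inner (D v) g = ell2_inner (D w) g - t * ell2_inner (D y) g" if "g \<in> ell2" for g
      unfolding Dv using De[OF we] De[OF ye] that by (simp add: ell2_inner_diff_left ell2_scale ell2_inner_scale_left)
    have ct: "cnj t = t" by (simp add: t_def)
    have right: "ell2_inner g v = ell2_inner g w - t * ell2_inner g y" if "g \<in> ell2" for g
      unfolding v_def using we ye that by (simp add: ell2_inner_diff_right ell2_scale ell2_inner_scale_right ct)
    have "ell2_inner (D v) v = ell2_inner (D w) w - t * ell2_inner (D w) y - t * (ell2_inner (D y) w - t * ell2_inner (D y) y)"
      using left[OF Xe[OF vX]] right[OF De[OF we]] right[OF De[OF ye]] by simp
    also have "ell2_inner (D y) w = ell2_inner y y" using Dsym[OF ye we] by (simp add: y_def)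
    also have "ell2_inner (D w) y = ell2_inner y y" by (simp add: y_def)
    finally have e: "ell2_inner (D v) v = ell2_inner (D w) w - t * ell2_inner y y - t * (ell2_inner y y - t * ell2_inner (D y) y)" .
    have "Re (ell2_inner (D v) v) = Re (ell2_inner (D w) w) - 2 * \<tau> * (ell2_norm y)\<^sup>2 + \<tau>\<^sup>2 * Re (ell2_inner (D y) y)"
      unfolding e using ye by (simp add: ell2_inner_self t_def power2_eq_square algebra_simps)
    hence "Re (ell2_inner (D v) v) = Re (ell2_inner (D w) w) - 2 * (1 / M) * (ell2_norm y)\<^sup>2 + (1 / M)\<^sup>2 * Re (ell2_inner (D y) y)"
      unfolding \<tau>_def .
    moreover have "Re (ell2_inner (D y) y) \<le> M * (ell2_norm y)\<^sup>2"
      using q[OF ye] cr[OF ye] unfolding M_def by (simp add: algebra_simps abs_le_iff)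
    hence "(1 / M)\<^sup>2 * Re (ell2_inner (D y) y) \<le> (1 / M)\<^sup>2 * (M * (ell2_norm y)\<^sup>2)"
      by (intro mult_left_mono) auto
    hence "(1 / M)\<^sup>2 * Re (ell2_inner (D y) y) \<le> (1 / M) * (ell2_norm y)\<^sup>2"
      using M by (simp add: power2_eq_square)
    moreover have "Re (ell2_inner (D v) v) \<ge> 0" using q[OF Xe[OF vX]] pos0[OF vX] by simp
    moreover have "Re (ell2_inner (D w) w) = L - energy V w" using q[OF we] w(2) by simp
    ultimately have "(1 / M) * (ell2_norm y)\<^sup>2 \<le> L - energy V w" by linarith
    hence "(ell2_norm y)\<^sup>2 \<le> M * (L - energy V w)" using M by (simp add: field_simps)
    moreover have "ell2_norm y = ell2_norm (\<lambda>n. schroedinger V w n - of_real L * w n)"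
      unfolding y_def D_def ell2_norm_def by (simp add: norm_minus_commute)
    ultimately show ?thesis by simp
  qed
  have "\<exists>w\<in>X. ell2_norm w = 1 \<and> energy V w > L - inverse (real (Suc k))" for k
  proof -
    have "L - inverse (real (Suc k)) < Sup R" unfolding L_def by simp
    then obtain e where "e \<in> R" "e > L - inverse (real (Suc k))"
      using less_cSup_iff[OF Rne bdd] by blast
    thus ?thesis by (auto simp: R_def)
  qed
  then obtain w where w: "\<And>k. w k \<in> X" "\<And>k. ell2_norm (w k) = 1" "\<And>k. energy V (w k) > L - inverse (real (Suc k))"
    by metis
  have lim: "(\<lambda>k. ell2_norm (\<lambda>n. schroedinger V (w k) n - of_real L * w k n)) \<longlonglongrightarrow> 0"
  proof -
    have "(\<lambda>k. (ell2_norm (\<lambda>n. schroedinger V (w k) n - of_real L * w k n))\<^sup>2) \<longlonglongrightarrow> 0"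
    proof (rule tendsto_sandwich[OF _ _ tendsto_const])
      show "(\<lambda>k. M * inverse (real (Suc k))) \<longlonglongrightarrow> 0"
        using tendsto_mult[OF tendsto_const LIMSEQ_inverse_real_of_nat, of M] by simp
      have "(ell2_norm (\<lambda>n. schroedinger V (w k) n - of_real L * w k n))\<^sup>2 \<le> M * inverse (real (Suc k))" for k
        using key[OF w(1,2), of k] mult_left_mono[of "L - energy V (w k)" "inverse (real (Suc k))" M] w(3)[of k] M by linarith
      thus "\<forall>\<^sub>F k in sequentially. (ell2_norm (\<lambda>n. schroedinger V (w k) n - of_real L * w k n))\<^sup>2 \<le> M * inverse (real (Suc k))"
        by simp
    qed simp
    from tendsto_real_sqrt[OF this] show ?thesis by (simp add: tendsto_rabs_zero_iff)
  qed
  have band: "complex_of_real L \<notin> complex_of_real ` {-2..2}" using L2 by auto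
  obtain r t where rt: "strict_mono r" "t \<noteq> 0" "bound_state V L \<in> ell2"
    "\<And>n. (\<lambda>k. w (r k) n) \<longlonglongrightarrow> t * bound_state V L n"
    using weyl_sequence[of V K "of_real L" w, OF V0 V band Xe[OF w(1)] w(2) lim] by blast
  have "L \<notin> F"
  proof
    assume LF: "L \<in> F"
    have "ell2_inner (\<lambda>n. t * bound_state V L n) (bound_state V L) = 0"
      by (rule weak_limit_orthogonal[of "\<lambda>k. w (r k)"]) (use w rt LF in \<open>auto simp: X_def ell2_scale\<close>)
    hence "t * of_real ((ell2_norm (bound_state V L))\<^sup>2) = 0"
      using rt(3) by (simp add: ell2_inner_scale_left ell2_inner_self)
    thus False using rt(2) bound_state_norm_pos[OF rt(3)] by simp
  qed
  moreover have "L \<in> bound_states V" using rt(3) L2 by (simp add: bound_states_def)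
  ultimately show ?thesis using L2 by blast
qed

section \<open>Asymptotics of the Wigner--von Neumann coupling\<close>

text \<open>
  The modulus of the zero-energy solution.
\<close>

definition amplitude :: "real \<Rightarrow> real" where
  "amplitude x = 1 / (sqrt x * ln x)"

definition coupling :: "real \<Rightarrow> real" where
  "coupling x = (amplitude (x - 1) - amplitude (x + 1)) / amplitude x"

text \<open>
  The leading part of \<open>coupling x / 4\<close>.
\<close>

definition tilt :: "real \<Rightarrow> real" where
  "tilt x = (1 + 2 / ln x) / (4 * x)"

text \<open>
  A slowly varying \<open>\<psi>\<close> times this weight, with \<open>\<tau> = \<plusminus>(-1)^n\<close>, removes the oscillation of the potential to
  first order at the band edges; \<open>sqrt x\<close> is the critical solution of Hardy's inequality.
\<close>

definition weight :: "real \<Rightarrow> real \<Rightarrow> real" where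
  "weight \<tau> x = (1 + \<tau> * tilt x) * sqrt x"

text \<open>
  If \<open>\<psi>(ln y)\<close> is a polynomial in \<open>ln y\<close>, its values at \<open>x \<plusminus> 1\<close> are finite Taylor expansions about \<open>ln x\<close>. The
  moments are, up to factorials, the coefficients that the derivatives of \<open>\<psi>\<close> receive in the sum over the two neighbours,
  whose parity is opposite to that of \<open>x\<close>. In this way all estimates are about functions of \<open>x\<close>
  alone, whatever the centre and width of \<open>\<psi>\<close>.
\<close>

definition moment :: "nat \<Rightarrow> real \<Rightarrow> real \<Rightarrow> real" where
  "moment k \<tau> x = weight (-\<tau>) (x + 1) * (ln (x + 1) - ln x) ^ k
                + weight (-\<tau>) (x - 1) * (ln (x - 1) - ln x) ^ k"

text \<open>
  The coefficient of \<open>\<psi>\<close> itself in the equation at the band edge.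
\<close>

definition defect :: "real \<Rightarrow> real \<Rightarrow> real" where
  "defect \<tau> x = moment 0 \<tau> x - (2 - \<tau> * coupling x) * weight \<tau> x"

text \<open>
  The remainder is kept exact: its smallness can then be seen without a cancellation between
  different logarithms.
\<close>

lemma inverse_ln_expand:
  fixes x y :: real
  assumes "ln x \<noteq> 0" "ln y \<noteq> 0"
  shows "1 / ln y = 1 / ln x - (ln y - ln x) / (ln x)\<^sup>2 + (ln y - ln x)\<^sup>2 / ((ln x)\<^sup>2 * ln y)"
  using assms by (simp add: field_simps power2_eq_square)

text \<open>
  With \<open>D = ln (x \<plusminus> 1) - ln x\<close> the quotient \<open>ln x / ln (x \<plusminus> 1)\<close> is \<open>1 - D / ln x\<close> up to a remainder of order
  \<open>(D / ln x)\<^sup>2\<close>.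
\<close>

lemma coupling_approx:
  "\<forall>\<^sub>F x in at_top. \<bar>coupling x - 4 * tilt x\<bar> \<le> 5 / (x\<^sup>2 * (ln x)\<^sup>2)"
proof -
  have a: "\<forall>\<^sub>F x::real in at_top. \<bar>sqrt x / sqrt (x-1) * (1 - (ln (x-1) - ln x)/ln x)
      - sqrt x / sqrt (x+1) * (1 - (ln (x+1) - ln x)/ln x) - 4 * ((1 + 2 / ln x) / (4 * x))\<bar>
      \<le> 1 / (x^2 * ln x ^ 2)"
    by real_asymp
  have b: "\<forall>\<^sub>F x::real in at_top.
      \<bar>sqrt x / sqrt (x-1) * (ln (x-1) - ln x)^2 / (ln x * ln (x-1))\<bar> \<le> 2 / (x^2 * ln x ^ 2)"
    by real_asymp
  have c: "\<forall>\<^sub>F x::real in at_top.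
      \<bar>sqrt x / sqrt (x+1) * (ln (x+1) - ln x)^2 / (ln x * ln (x+1))\<bar> \<le> 2 / (x^2 * ln x ^ 2)"
    by real_asymp
  show ?thesis
    using a b c eventually_gt_at_top[of 2]
  proof eventually_elim
    case (elim x)
    have nz: "ln x \<noteq> 0" "ln (x-1) \<noteq> 0" "ln (x+1) \<noteq> 0"
      using elim(4) by auto
    define p m where "p = ln (x+1)" and "m = ln (x-1)"
    have ep: "ln x / p = 1 - (p - ln x) / ln x + (p - ln x)\<^sup>2 / (ln x * p)"
      using nz unfolding p_def by (simp add: field_simps power2_eq_square)
    have em: "ln x / m = 1 - (m - ln x) / ln x + (m - ln x)\<^sup>2 / (ln x * m)"
      using nz unfolding m_def by (simp add: field_simps power2_eq_square)
    have "coupling x = sqrt x / sqrt (x-1) * (ln x / m) - sqrt x / sqrt (x+1) * (ln x / p)"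
      unfolding coupling_def amplitude_def p_def m_def by (simp add: left_diff_distrib)
    also have "\<dots> = (sqrt x / sqrt (x-1) * (1 - (m - ln x) / ln x)
        - sqrt x / sqrt (x+1) * (1 - (p - ln x) / ln x))
        + sqrt x / sqrt (x-1) * (m - ln x)\<^sup>2 / (ln x * m)
        - sqrt x / sqrt (x+1) * (p - ln x)\<^sup>2 / (ln x * p)"
      unfolding ep em by (simp add: algebra_simps)
    finally have eq: "coupling x = \<dots>" .
    have gen: "\<bar>A + B - C - T\<bar> \<le> 5 / e"
      if "\<bar>A - T\<bar> \<le> 1 / e" "\<bar>B\<bar> \<le> 2 / e" "\<bar>C\<bar> \<le> 2 / e" for A B C T e :: real
    proof -
      have "5 / e = 1 / e + 2 / e + 2 / e" by (simp add: add_divide_distrib[symmetric])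
      thus ?thesis using that by linarith
    qed
    show ?case
      unfolding eq tilt_def p_def m_def by (rule gen[OF elim(1-3)])
  qed
qed

text \<open>
  The first and the second moment are those of a second difference: \<open>sqrt y (ln y - ln x)\<close> has vanishing second
  derivative at \<open>y = x\<close>, and \<open>sqrt y (ln y - ln x)\<^sup>2\<close> has second derivative \<open>2 x^(-3/2)\<close> there. The
  contributions of the tilt and the higher moments are of lower order.
\<close>

lemma moments_small:
  "\<forall>\<^sub>F x in at_top. \<forall>\<tau>\<in>{1,-1}.
     \<bar>moment 1 \<tau> x\<bar> \<le> 1 / (x * sqrt x * ln x ^ 3) \<and>
     \<bar>moment 2 \<tau> x - 2 / (x * sqrt x)\<bar> \<le> 1 / (x * sqrt x * ln x ^ 3) \<and>
     \<bar>moment 3 \<tau> x\<bar> \<le> 1 / (x * sqrt x * ln x ^ 3) \<and>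
     \<bar>moment 4 \<tau> x\<bar> \<le> 1 / (x * sqrt x * ln x ^ 3)"
proof -
  define t :: "real \<Rightarrow> real" where "t = (\<lambda>x. (1 + 2 / ln x) / (4 * x))"
  define e :: "real \<Rightarrow> real" where "e = (\<lambda>x. 1 / (2 * (x * sqrt x * ln x ^ 3)))"
  have p1: "\<forall>\<^sub>F x::real in at_top. \<bar>sqrt (x+1) * (ln (x+1) - ln x) + sqrt (x-1) * (ln (x-1) - ln x)\<bar> \<le> e x"
    unfolding e_def by real_asymp
  have p2: "\<forall>\<^sub>F x::real in at_top. \<bar>sqrt (x+1) * (ln (x+1) - ln x)^2 + sqrt (x-1) * (ln (x-1) - ln x)^2 - 2/(x * sqrt x)\<bar> \<le> e x"
    unfolding e_def by real_asymp
  have q1: "\<forall>\<^sub>F x::real in at_top. \<bar>t (x+1) * sqrt (x+1) * (ln (x+1) - ln x) + t (x-1) * sqrt (x-1) * (ln (x-1) - ln x)\<bar> \<le> e x"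
    unfolding e_def t_def by real_asymp
  have q2: "\<forall>\<^sub>F x::real in at_top. \<bar>t (x+1) * sqrt (x+1) * (ln (x+1) - ln x)^2 + t (x-1) * sqrt (x-1) * (ln (x-1) - ln x)^2\<bar> \<le> e x"
    unfolding e_def t_def by real_asymp
  have r3: "\<forall>\<^sub>F x::real in at_top. (1 + t (x+1)) * sqrt (x+1) * \<bar>ln (x+1) - ln x\<bar>^3 \<le> e x"
    unfolding e_def t_def by real_asymp
  have s3: "\<forall>\<^sub>F x::real in at_top. (1 + t (x-1)) * sqrt (x-1) * \<bar>ln (x-1) - ln x\<bar>^3 \<le> e x"
    unfolding e_def t_def by real_asymp
  have r4: "\<forall>\<^sub>F x::real in at_top. (1 + t (x+1)) * sqrt (x+1) * \<bar>ln (x+1) - ln x\<bar>^4 \<le> e x"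
    unfolding e_def t_def by real_asymp
  have s4: "\<forall>\<^sub>F x::real in at_top. (1 + t (x-1)) * sqrt (x-1) * \<bar>ln (x-1) - ln x\<bar>^4 \<le> e x"
    unfolding e_def t_def by real_asymp
  show ?thesis
    using p1 p2 q1 q2 r3 s3 r4 s4 eventually_gt_at_top[of 2]
  proof eventually_elim
    case (elim x)
    have ee: "1 / (x * sqrt x * ln x ^ 3) = 2 * e x"
      unfolding e_def by simp
    have t0: "t (x+1) \<ge> 0" "t (x-1) \<ge> 0"
      using elim(9) unfolding t_def by auto
    have wb: "\<bar>weight (-\<tau>) y\<bar> \<le> (1 + t y) * sqrt y"
      if "\<tau> \<in> {1,-1}" "t y \<ge> 0" "y > 0" for \<tau> y
    proof -
      have "\<bar>1 + (-\<tau>) * t y\<bar> \<le> 1 + t y"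
        using that by auto
      thus ?thesis
        using that unfolding weight_def tilt_def t_def by (simp add: abs_mult mult_right_mono)
    qed
    have hi: "\<bar>moment k \<tau> x\<bar> \<le> 2 * e x"
      if "\<tau> \<in> {1,-1}" "(1 + t (x+1)) * sqrt (x+1) * \<bar>ln (x+1) - ln x\<bar>^k \<le> e x"
        "(1 + t (x-1)) * sqrt (x-1) * \<bar>ln (x-1) - ln x\<bar>^k \<le> e x" for \<tau> k
    proof -
      have "\<bar>moment k \<tau> x\<bar> \<le> \<bar>weight (-\<tau>) (x + 1)\<bar> * \<bar>ln (x + 1) - ln x\<bar> ^ k
                + \<bar>weight (-\<tau>) (x - 1)\<bar> * \<bar>ln (x - 1) - ln x\<bar> ^ k"
        unfolding moment_def by (rule order.trans[OF abs_triangle_ineq]) (simp add: abs_mult power_abs)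
      also have "\<dots> \<le> (1 + t (x+1)) * sqrt (x+1) * \<bar>ln (x+1) - ln x\<bar>^k
            + (1 + t (x-1)) * sqrt (x-1) * \<bar>ln (x-1) - ln x\<bar>^k"
        using wb[OF that(1) t0(1)] wb[OF that(1) t0(2)] elim(9) by (intro add_mono mult_right_mono) auto
      also have "\<dots> \<le> 2 * e x" using that by simp
      finally show ?thesis .
    qed
    have tt: "tilt y = t y" for y unfolding tilt_def t_def by simp
    show ?case
    proof
      fix \<tau> :: real assume \<tau>: "\<tau> \<in> {1,-1}"
      have m: "moment k \<tau> x = (sqrt (x+1) * (ln (x+1) - ln x)^k + sqrt (x-1) * (ln (x-1) - ln x)^k)
         - \<tau> * (t (x+1) * sqrt (x+1) * (ln (x+1) - ln x)^k + t (x-1) * sqrt (x-1) * (ln (x-1) - ln x)^k)" for k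
        unfolding moment_def weight_def tt by (simp add: algebra_simps)
      have split: "\<bar>P - \<tau> * Q - c\<bar> \<le> 2 * e x" if "\<bar>P - c\<bar> \<le> e x" "\<bar>Q\<bar> \<le> e x" for P Q c
        using that \<tau> by auto
      have "\<bar>moment 1 \<tau> x\<bar> \<le> 2 * e x"
        unfolding m[of 1] using split[of _ 0] elim(1,3) \<tau> by simp
      moreover have "\<bar>moment 2 \<tau> x - 2 / (x * sqrt x)\<bar> \<le> 2 * e x"
        unfolding m[of 2] using elim(2,4) \<tau> by (intro split)
      ultimately show "\<bar>moment 1 \<tau> x\<bar> \<le> 1 / (x * sqrt x * ln x ^ 3) \<and>
     \<bar>moment 2 \<tau> x - 2 / (x * sqrt x)\<bar> \<le> 1 / (x * sqrt x * ln x ^ 3) \<and>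
     \<bar>moment 3 \<tau> x\<bar> \<le> 1 / (x * sqrt x * ln x ^ 3) \<and>
     \<bar>moment 4 \<tau> x\<bar> \<le> 1 / (x * sqrt x * ln x ^ 3)"
        using hi[OF \<tau> elim(5,6)] hi[OF \<tau> elim(7,8)] unfolding ee by blast
    qed
  qed
qed

text \<open>
  The second difference of \<open>sqrt\<close> gives \<open>-x^(-3/2) / 4\<close>; that of \<open>tilt x * sqrt x\<close> is negligible.
\<close>

lemma moment0_approx:
  "\<forall>\<^sub>F x in at_top. \<forall>\<tau>\<in>{1,-1}.
     \<bar>moment 0 \<tau> x - (2 - 2 * \<tau> * tilt x) * sqrt x + 1 / (4 * x * sqrt x)\<bar> \<le> 4 / (x * sqrt x * ln x ^ 3)"
proof -
  define e :: "real \<Rightarrow> real" where "e = (\<lambda>x. 1 / (x * sqrt x * ln x ^ 3))"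
  have e1: "\<forall>\<^sub>F x::real in at_top. \<bar>sqrt (x+1)+sqrt (x-1) - 2 * sqrt x + 1/(4*x * sqrt x)\<bar> \<le> e x"
    unfolding e_def by real_asymp
  have e2: "\<forall>\<^sub>F x::real in at_top.
      \<bar>(1 + 2 * (1/ln x - (ln (x+1) - ln x)/(ln x)^2))/(4*(x+1)) * sqrt (x+1)
       + (1 + 2 * (1/ln x - (ln (x-1) - ln x)/(ln x)^2))/(4*(x-1)) * sqrt (x-1)
       - 2 * ((1 + 2 / ln x) / (4 * x)) * sqrt x\<bar> \<le> e x"
    unfolding e_def by real_asymp
  have e3: "\<forall>\<^sub>F x::real in at_top.
      \<bar>2 * ((ln (x+1) - ln x)^2/((ln x)^2 * ln (x+1)))/(4*(x+1)) * sqrt (x+1)\<bar> \<le> e x"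
    unfolding e_def by real_asymp
  have e4: "\<forall>\<^sub>F x::real in at_top.
      \<bar>2 * ((ln (x-1) - ln x)^2/((ln x)^2 * ln (x-1)))/(4*(x-1)) * sqrt (x-1)\<bar> \<le> e x"
    unfolding e_def by real_asymp
  show ?thesis
    using e1 e2 e3 e4 eventually_gt_at_top[of 2]
  proof eventually_elim
    case (elim x)
    have nz: "ln x \<noteq> 0" "ln (x-1) \<noteq> 0" "ln (x+1) \<noteq> 0"
      using elim(5) by auto
    have t: "tilt y = (1 + 2 * (1/ln x - (ln y - ln x)/(ln x)^2))/(4*y)
              + 2 * ((ln y - ln x)^2/((ln x)^2 * ln y))/(4*y)" if "ln y \<noteq> 0" for y
    proof -
      have gen: "(1 + 2 * (a + b)) / c = (1 + 2 * a) / c + 2 * b / c" for a b c :: real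
        by (simp add: add_divide_distrib[symmetric])
      have "tilt y = (1 + 2 * (1 / ln y)) / (4 * y)" unfolding tilt_def by simp
      also have "\<dots> = (1 + 2 * (1/ln x - (ln y - ln x)/(ln x)^2))/(4*y)
              + 2 * ((ln y - ln x)^2/((ln x)^2 * ln y))/(4*y)"
        unfolding inverse_ln_expand[OF nz(1) that] by (rule gen)
      finally show ?thesis .
    qed
    define q where "q = tilt (x+1) * sqrt (x+1) + tilt (x-1) * sqrt (x-1) - 2 * tilt x * sqrt x"
    have "q = ((1 + 2 * (1/ln x - (ln (x+1) - ln x)/(ln x)^2))/(4*(x+1)) * sqrt (x+1)
       + (1 + 2 * (1/ln x - (ln (x-1) - ln x)/(ln x)^2))/(4*(x-1)) * sqrt (x-1)
       - 2 * ((1 + 2 / ln x) / (4 * x)) * sqrt x)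
       + 2 * ((ln (x+1) - ln x)^2/((ln x)^2 * ln (x+1)))/(4*(x+1)) * sqrt (x+1)
       + 2 * ((ln (x-1) - ln x)^2/((ln x)^2 * ln (x-1)))/(4*(x-1)) * sqrt (x-1)"
      unfolding q_def t[OF nz(2)] t[OF nz(3)] distrib_right unfolding tilt_def by linarith
    hence q: "\<bar>q\<bar> \<le> 3 * e x" using elim(2-4) by linarith
    show ?case
    proof
      fix \<tau> :: real assume \<tau>: "\<tau> \<in> {1,-1}"
      have "moment 0 \<tau> x - (2 - 2 * \<tau> * tilt x) * sqrt x
          = (sqrt (x+1)+sqrt (x-1) - 2 * sqrt x) - \<tau> * q"
        unfolding moment_def weight_def q_def by (simp add: algebra_simps)
      moreover have "\<bar>\<tau> * q\<bar> \<le> 3 * e x" using q \<tau> by auto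
      moreover have "4 / (x * sqrt x * ln x ^ 3) = 4 * e x" unfolding e_def by simp
      ultimately show "\<bar>moment 0 \<tau> x - (2 - 2 * \<tau> * tilt x) * sqrt x + 1 / (4 * x * sqrt x)\<bar> \<le> 4 / (x * sqrt x * ln x ^ 3)"
        using elim(1) by linarith
    qed
  qed
qed

text \<open>
  With \<open>v = coupling x\<close> and \<open>a = tilt x\<close> the terms of first order cancel since \<open>v \<approx> 4 a\<close>. In second order there
  remain \<open>4 a\<^sup>2 sqrt x = (1/4 + 1 / ln x + 1 / (ln x)\<^sup>2) x^(-3/2)\<close> and the \<open>-x^(-3/2) / 4\<close> of the
  second difference of \<open>sqrt\<close>. The two quarters cancel: this is the criticality in Hardy's inequality,
  and \<open>x^(-3/2) / ln x\<close> is what is left.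
\<close>

lemma defect_bounds:
  "\<forall>\<^sub>F x in at_top. \<forall>\<tau>\<in>{1,-1}.
     1 / (2 * (x * sqrt x * ln x)) \<le> defect \<tau> x \<and> defect \<tau> x \<le> 2 / (x * sqrt x * ln x)"
proof -
  have L: "\<forall>\<^sub>F x::real in at_top. ln x \<ge> 20" by real_asymp
  have tl: "\<forall>\<^sub>F x::real in at_top. 0 \<le> tilt x \<and> tilt x \<le> 1/5"
    unfolding tilt_def by (intro eventually_conj; real_asymp)
  show ?thesis
    using coupling_approx moment0_approx L tl eventually_gt_at_top[of 2]
  proof eventually_elim
    case (elim x)
    define g where "g = 1 / (x * sqrt x)"
    define m where "m = 1 / ln x"
    define \<delta> where "\<delta> = coupling x - 4 * tilt x"
    have g: "g > 0" using elim(5) unfolding g_def by simp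
    have m: "0 < m" "m \<le> 1/20" using elim(3) unfolding m_def by (auto simp: field_simps)
    have "sqrt x * (5 / (x\<^sup>2 * (ln x)\<^sup>2)) = (5 * m\<^sup>2) * (sqrt x / x\<^sup>2)"
      unfolding m_def by (simp add: field_simps)
    also have "sqrt x / x\<^sup>2 = g"
      using elim(5) unfolding g_def by (simp add: field_simps power2_eq_square)
    finally have "sqrt x * \<bar>\<delta>\<bar> \<le> 5 * m\<^sup>2 * g"
      using mult_left_mono[OF elim(1), of "sqrt x"] elim(5) unfolding \<delta>_def by simp
    have t2: "4 * (tilt x)\<^sup>2 * sqrt x = (1/4 + m + m\<^sup>2) * g"
    proof -
      have "4 * (tilt x)\<^sup>2 * sqrt x = (1 + 2 * m)\<^sup>2 / 4 * (sqrt x / x\<^sup>2)"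
        unfolding tilt_def m_def by (simp add: power_divide power_mult_distrib)
      also have "sqrt x / x\<^sup>2 = g"
        using elim(5) unfolding g_def by (simp add: field_simps power2_eq_square)
      finally show ?thesis by (simp add: power2_eq_square algebra_simps)
    qed
    have main: "\<bar>defect \<tau> x - m * g\<bar> \<le> (8 * m\<^sup>2 + 4 * m^3) * g" if \<tau>: "\<tau> \<in> {1,-1}" for \<tau>
    proof -
      have tau2: "\<tau> * \<tau> = 1" using \<tau> by auto
      have "defect \<tau> x = (moment 0 \<tau> x - (2 - 2 * \<tau> * tilt x) * sqrt x)
          + (\<tau> + tilt x) * (sqrt x * \<delta>) + (1 - \<tau> * \<tau>) * (- coupling x * tilt x * sqrt x) + 4 * (tilt x)\<^sup>2 * sqrt x"
        unfolding defect_def weight_def \<delta>_def by (simp add: algebra_simps power2_eq_square)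
      hence d: "defect \<tau> x - m * g = (moment 0 \<tau> x - (2 - 2 * \<tau> * tilt x) * sqrt x + 1 / (4 * x * sqrt x))
          + (\<tau> + tilt x) * (sqrt x * \<delta>) + m\<^sup>2 * g"
        unfolding t2 tau2 by (simp add: algebra_simps g_def)
      have a: "\<bar>moment 0 \<tau> x - (2 - 2 * \<tau> * tilt x) * sqrt x + 1 / (4 * x * sqrt x)\<bar> \<le> 4 * m^3 * g"
      proof -
        have "4 * m^3 * g = 4 / (x * sqrt x * ln x ^ 3)"
          unfolding m_def g_def by (simp add: power_divide)
        thus ?thesis using bspec[OF elim(2) \<tau>] by simp
      qed
      have b: "\<bar>(\<tau> + tilt x) * (sqrt x * \<delta>)\<bar> \<le> 7 * m\<^sup>2 * g"
      proof -
        have "\<bar>(\<tau> + tilt x) * (sqrt x * \<delta>)\<bar> = \<bar>\<tau> + tilt x\<bar> * (sqrt x * \<bar>\<delta>\<bar>)"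
          using elim(5) by (simp add: abs_mult)
        also have "\<dots> \<le> (6/5) * (5 * m\<^sup>2 * g)"
          using \<open>sqrt x * \<bar>\<delta>\<bar> \<le> 5 * m\<^sup>2 * g\<close> elim(4,5) \<tau>
          by (intro mult_mono[of "\<bar>\<tau> + tilt x\<bar>"]) auto
        also have "\<dots> \<le> 7 * m\<^sup>2 * g" using g by simp
        finally show ?thesis .
      qed
      show ?thesis using a b g unfolding d by (simp add: algebra_simps abs_if split: if_splits)
    qed
    have "m\<^sup>2 \<le> m / 20" using m by (simp add: power2_eq_square)
    moreover have "m^3 \<le> m / 400"
    proof -
      have "m^3 = m * m\<^sup>2" by (simp add: power2_eq_square power3_eq_cube)
      also have "\<dots> \<le> m * (1/20)\<^sup>2" using m by (intro mult_left_mono power_mono) auto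
      finally show ?thesis by (simp add: power2_eq_square)
    qed
    ultimately have "8 * m\<^sup>2 + 4 * m^3 \<le> m / 2" using m by linarith
    hence sm: "(8 * m\<^sup>2 + 4 * m^3) * g \<le> m / 2 * g" using g by simp
    have lo: "m / 2 * g = 1 / (2 * (x * sqrt x * ln x))" and hi: "2 * (m * g) = 2 / (x * sqrt x * ln x)"
      unfolding m_def g_def by simp_all
    have "m * g > 0" using m g by simp
    hence "m / 2 * g \<le> defect \<tau> x \<and> defect \<tau> x \<le> 2 * (m * g)" if "\<tau> \<in> {1,-1}" for \<tau>
      using main[OF that] sm by linarith
    thus ?case unfolding lo hi by blast
  qed
qed

lemma coupling_size: "\<forall>\<^sub>F x in at_top. \<bar>coupling x\<bar> \<le> 2 / x"
proof -
  have "\<forall>\<^sub>F x::real in at_top. \<bar>4 * ((1 + 2 / ln x) / (4 * x))\<bar> + 5 / (x\<^sup>2 * (ln x)\<^sup>2) \<le> 2 / x"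
    by real_asymp
  thus ?thesis
    using coupling_approx
  proof eventually_elim
    case (elim x)
    have gen: "\<bar>c\<bar> \<le> d" if "\<bar>a\<bar> + b \<le> d" "\<bar>c - a\<bar> \<le> b" for a b c d :: real
      using that by linarith
    show ?case by (rule gen[OF elim(1) elim(2)[unfolded tilt_def]])
  qed
qed

text \<open>
  A telescoping majorant, which makes the amplitude square-summable.
\<close>

lemma amplitude_square_le:
  "\<forall>\<^sub>F x in at_top. (amplitude x)\<^sup>2 \<le> 2 * (1 / ln (x - 1) - 1 / ln x)"
  unfolding amplitude_def by real_asymp

lemma weight_pos: "\<forall>\<^sub>F x in at_top. \<forall>\<tau>\<in>{1,-1}. weight \<tau> x > 0"
proof -
  have "\<forall>\<^sub>F x::real in at_top. tilt x < 1 \<and> tilt x > 0"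
    unfolding tilt_def by (intro eventually_conj; real_asymp)
  thus ?thesis using eventually_gt_at_top[of 0]
    by eventually_elim (auto simp: weight_def)
qed

section \<open>The potential, its zero-energy solution and local comparison functions\<close>

definition regular :: "real \<Rightarrow> bool" where
  "regular x \<longleftrightarrow> 20 \<le> ln x \<and> 36 \<le> x \<and> \<bar>coupling x\<bar> \<le> 2 / x \<and>
     (amplitude x)\<^sup>2 \<le> 2 * (1 / ln (x - 1) - 1 / ln x) \<and>
     (\<forall>\<tau>\<in>{1,-1}. 0 < weight \<tau> x \<and>
       1 / (2 * (x * sqrt x * ln x)) \<le> defect \<tau> x \<and> defect \<tau> x \<le> 2 / (x * sqrt x * ln x) \<and>
       \<bar>moment 1 \<tau> x\<bar> \<le> 1 / (x * sqrt x * ln x ^ 3) \<and>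
       \<bar>moment 2 \<tau> x - 2 / (x * sqrt x)\<bar> \<le> 1 / (x * sqrt x * ln x ^ 3) \<and>
       \<bar>moment 3 \<tau> x\<bar> \<le> 1 / (x * sqrt x * ln x ^ 3) \<and>
       \<bar>moment 4 \<tau> x\<bar> \<le> 1 / (x * sqrt x * ln x ^ 3))"

lemma eventually_regular: "\<forall>\<^sub>F x in at_top. regular x"
proof -
  have "\<forall>\<^sub>F x::real in at_top. 20 \<le> ln x" by real_asymp
  thus ?thesis
    using eventually_ge_at_top[of 36] coupling_size amplitude_square_le weight_pos defect_bounds moments_small
  proof eventually_elim
    case (elim x)
    show ?case
      unfolding regular_def
    proof (intro conjI ballI elim(1-4))
      fix \<tau> :: real assume \<tau>: "\<tau> \<in> {1,-1}"
      show "0 < weight \<tau> x" by (rule bspec[OF elim(5) \<tau>])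
    qed (use elim(6,7) in auto)
  qed
qed

text \<open>
  In the variable \<open>t = ln x\<close> the left side minus the right side is approximately
  \<open>x^(-3/2) (\<psi>'' + \<psi> / t)\<close> with \<open>\<psi>'' = -2\<close> and \<open>\<psi> / t \<le> c / (2 t) \<le> 1/2\<close>.
\<close>

lemma supersolution_step:
  assumes x: "regular x" and \<tau>: "\<tau> \<in> {1,-1}" and c: "0 \<le> c" "c \<le> ln x"
  defines "\<psi> \<equiv> \<lambda>y. c / 2 - (ln y - c)\<^sup>2"
  shows "weight (-\<tau>) (x + 1) * \<psi> (x + 1) + weight (-\<tau>) (x - 1) * \<psi> (x - 1)
           \<le> (2 - \<tau> * coupling x) * (weight \<tau> x * \<psi> x)"
proof -
  define g L s where "g = 1 / (x * sqrt x)" and "L = ln x" and "s = ln x - c"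
  have L: "20 \<le> L" and "20 \<le> x" using x by (auto simp: regular_def L_def)
  hence g: "g > 0" by (simp add: g_def)
  define A where "A = c / 2"
  have s: "0 \<le> s" "s \<le> L" using c by (auto simp: s_def L_def)
  have "weight (-\<tau>) (x + 1) * \<psi> (x + 1) + weight (-\<tau>) (x - 1) * \<psi> (x - 1) - (2 - \<tau> * coupling x) * (weight \<tau> x * \<psi> x)
      = (c / 2 - s\<^sup>2) * defect \<tau> x - 2 * s * moment 1 \<tau> x - moment 2 \<tau> x"
    unfolding \<psi>_def defect_def moment_def s_def A_def[symmetric] by (simp add: algebra_simps power2_eq_square)
  also have "\<dots> \<le> g + g / 4 - (2 * g - g / 4)"
  proof -
    have b: "1 / (2 * (x * sqrt x * ln x)) \<le> defect \<tau> x" "defect \<tau> x \<le> 2 / (x * sqrt x * ln x)"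
      "\<bar>moment 1 \<tau> x\<bar> \<le> 1 / (x * sqrt x * ln x ^ 3)"
      "\<bar>moment 2 \<tau> x - 2 / (x * sqrt x)\<bar> \<le> 1 / (x * sqrt x * ln x ^ 3)"
      using x \<tau> unfolding regular_def by blast+
    have e: "1 / (x * sqrt x * ln x ^ 3) = g / L^3" by (simp add: g_def L_def)
    have d0: "0 \<le> defect \<tau> x"
      using b(1) L \<open>20 \<le> x\<close> by (intro order.trans[OF _ b(1)]) (auto simp: L_def)
    have "(c / 2 - s\<^sup>2) * defect \<tau> x \<le> c / 2 * (2 / (x * sqrt x * ln x))"
      using d0 b(2) c(1) by (intro mult_mono) auto
    also have "\<dots> = c / L * g" by (simp add: g_def L_def)
    also have "\<dots> \<le> 1 * g" using c L g by (intro mult_right_mono) (auto simp: L_def)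
    finally have 1: "(c / 2 - s\<^sup>2) * defect \<tau> x \<le> g" by simp
    have "\<bar>s * moment 1 \<tau> x\<bar> \<le> L * (g / L^3)"
      unfolding abs_mult using b(3) s unfolding e by (intro mult_mono) auto
    also have "\<dots> = g / L\<^sup>2" using L by (simp add: field_simps power2_eq_square power3_eq_cube)
    also have "\<dots> \<le> g / 20\<^sup>2" using L g by (intro divide_left_mono power_mono) auto
    finally have 2: "- 2 * s * moment 1 \<tau> x \<le> g / 4" using g by (simp add: abs_le_iff)
    have "g / L^3 \<le> g / 20^3" using L g by (intro divide_left_mono power_mono) auto
    also have "\<dots> \<le> g / 4" using g by simp
    finally have "g / L^3 \<le> g / 4" .
    moreover have "2 / (x * sqrt x) = 2 * g" by (simp add: g_def)
    ultimately have 3: "moment 2 \<tau> x \<ge> 2 * g - g / 4" using b(4) unfolding e by linarith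
    show ?thesis using 1 2 3 g by linarith
  qed
  also have "\<dots> \<le> 0" using g by simp
  finally show ?thesis by simp
qed

text \<open>
  With \<open>A = 32 c\<close> and \<open>s = t - c\<close> the function \<open>\<psi> = (A - s\<^sup>2)\<^sup>2 - A\<^sup>2 / 4\<close> is convex near its zeros
  \<open>s\<^sup>2 = A / 2\<close>, unlike a quadratic bump, while \<open>\<psi> / t\<close> dominates \<open>\<psi>'' = 12 s\<^sup>2 - 4 A\<close> in the middle.
  The margin is uniform and absorbs the error terms.
\<close>

lemma subsolution_step:
  assumes x: "regular x" and \<tau>: "\<tau> \<in> {1,-1}" and c: "64 \<le> c" and s: "(ln x - c)\<^sup>2 < 16 * c"
  defines "\<psi> \<equiv> \<lambda>y. (32 * c - (ln y - c)\<^sup>2)\<^sup>2 - (16 * c)\<^sup>2"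
  shows "(2 - \<tau> * coupling x) * (weight \<tau> x * \<psi> x)
           < weight (-\<tau>) (x + 1) * \<psi> (x + 1) + weight (-\<tau>) (x - 1) * \<psi> (x - 1)"
proof -
  define g L s A where "g = 1 / (x * sqrt x)" and "L = ln x" and "s = ln x - c" and "A = 32 * c"
  have L: "20 \<le> L" and "20 \<le> x" using x by (auto simp: regular_def L_def)
  hence g: "g > 0" by (simp add: g_def)
  have A: "A \<ge> 2048" using c by (simp add: A_def)
  have s2: "s\<^sup>2 < A / 2" using s by (simp add: s_def A_def)
  have "s\<^sup>2 \<le> (c / 2)\<^sup>2"
  proof -
    have "16 * c \<le> c / 4 * c" using c by (intro mult_right_mono) auto
    also have "\<dots> = (c / 2)\<^sup>2" by (simp add: power2_eq_square)
    finally show ?thesis using s2 by (simp add: A_def)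
  qed
  hence sc: "\<bar>s\<bar> \<le> c / 2" using c by (metis abs_le_square_iff abs_of_nonneg divide_nonneg_nonneg order_trans zero_le_numeral)
  have Lc: "c / 2 \<le> L" "L \<le> 2 * c" using sc c unfolding L_def s_def by linarith+
  have b: "1 / (2 * (x * sqrt x * ln x)) \<le> defect \<tau> x"
      "\<bar>moment 1 \<tau> x\<bar> \<le> 1 / (x * sqrt x * ln x ^ 3)"
      "\<bar>moment 2 \<tau> x - 2 / (x * sqrt x)\<bar> \<le> 1 / (x * sqrt x * ln x ^ 3)"
      "\<bar>moment 3 \<tau> x\<bar> \<le> 1 / (x * sqrt x * ln x ^ 3)"
      "\<bar>moment 4 \<tau> x\<bar> \<le> 1 / (x * sqrt x * ln x ^ 3)"
      using x \<tau> unfolding regular_def by blast+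
  define e where "e = g / L^3"
  have e: "1 / (x * sqrt x * ln x ^ 3) = e" by (simp add: g_def L_def e_def)
  have e0: "e \<ge> 0" using g L by (simp add: e_def)
  define q where "q = (A - s\<^sup>2)\<^sup>2 - (A / 2)\<^sup>2"
  have q: "q > 0"
  proof -
    have "(A / 2)\<^sup>2 < (A - s\<^sup>2)\<^sup>2" using s2 A by (intro power_strict_mono) auto
    thus ?thesis by (simp add: q_def)
  qed
  have exp: "weight (-\<tau>) (x + 1) * \<psi> (x + 1) + weight (-\<tau>) (x - 1) * \<psi> (x - 1) - (2 - \<tau> * coupling x) * (weight \<tau> x * \<psi> x)
      = q * defect \<tau> x + (- 4 * s * (A - s\<^sup>2)) * moment 1 \<tau> x + (6 * s\<^sup>2 - 2 * A) * moment 2 \<tau> x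
        + 4 * s * moment 3 \<tau> x + moment 4 \<tau> x"
    unfolding \<psi>_def defect_def moment_def s_def q_def A_def
    by (simp add: algebra_simps power2_eq_square power3_eq_cube power4_eq_xxxx)
  have sA: "\<bar>s\<bar> \<le> A" using sc c by (simp add: A_def)
  have main: "q * defect \<tau> x \<ge> 8 * q / A * g"
  proof -
    have "8 * q / A * g = q * (g / (4 * c))" using c by (simp add: A_def field_simps)
    also have "\<dots> \<le> q * (g / (2 * L))"
      using q g L Lc by (intro mult_left_mono divide_left_mono) auto
    also have "g / (2 * L) = 1 / (2 * (x * sqrt x * ln x))" by (simp add: g_def L_def)
    finally show ?thesis using mult_left_mono[OF b(1), of q] q by linarith
  qed
  have m1: "(- 4 * s * (A - s\<^sup>2)) * moment 1 \<tau> x \<ge> - (4 * A\<^sup>2) * e"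
  proof -
    have "\<bar>(- 4 * s * (A - s\<^sup>2)) * moment 1 \<tau> x\<bar> \<le> (4 * A * A) * e"
      unfolding abs_mult using sA s2 A b(2) e by (intro mult_mono) auto
    also have "(4 * A * A) * e = (4 * A\<^sup>2) * e" by (simp add: power2_eq_square)
    finally show ?thesis by linarith
  qed
  have m2: "(6 * s\<^sup>2 - 2 * A) * moment 2 \<tau> x \<ge> (6 * s\<^sup>2 - 2 * A) * (2 * g) - (5 * A) * e"
  proof -
    have "\<bar>(6 * s\<^sup>2 - 2 * A) * (moment 2 \<tau> x - 2 / (x * sqrt x))\<bar> \<le> (5 * A) * e"
    proof -
      have "\<bar>6 * s\<^sup>2 - 2 * A\<bar> \<le> 5 * A" using s2 A zero_le_power2[of s] by linarith
      thus ?thesis unfolding abs_mult using A b(3) unfolding e by (intro mult_mono) auto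
    qed
    moreover have "2 / (x * sqrt x) = 2 * g" by (simp add: g_def)
    ultimately show ?thesis by (simp add: abs_le_iff right_diff_distrib)
  qed
  have m3: "4 * s * moment 3 \<tau> x \<ge> - (4 * A) * e"
  proof -
    have "\<bar>4 * s * moment 3 \<tau> x\<bar> \<le> (4 * A) * e"
      unfolding abs_mult using sA b(4) e by (intro mult_mono) auto
    thus ?thesis by (simp add: abs_le_iff)
  qed
  have m4: "moment 4 \<tau> x \<ge> - e" using b(5) e by (simp add: abs_le_iff)
  have err: "(4 * A\<^sup>2 + 9 * A + 1) * e \<le> A * g"
  proof -
    have "9 * A + 1 \<le> 10 * A\<^sup>2"
      using self_le_power[of A 2] A by linarith
    hence "(4 * A\<^sup>2 + 9 * A + 1) * e \<le> (14 * A\<^sup>2) * e" using e0 by (intro mult_right_mono) auto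
    also have "\<dots> \<le> (14 * A\<^sup>2) * (g / (c / 2) ^ 3)"
      unfolding e_def using g c Lc L by (intro mult_left_mono divide_left_mono power_mono) auto
    also have "\<dots> = A * g * (3584 / c\<^sup>2)" using c by (simp add: A_def field_simps power2_eq_square power3_eq_cube)
    also have "\<dots> \<le> A * g * 1"
    proof (rule mult_left_mono)
      have "64\<^sup>2 \<le> c\<^sup>2" using c by (intro power_mono) auto
      thus "3584 / c\<^sup>2 \<le> 1" using c by (simp add: field_simps)
    qed (use A g in auto)
    finally show ?thesis by simp
  qed
  have "0 < ((A - 2 * s\<^sup>2)\<^sup>2 + 4 * (s\<^sup>2)\<^sup>2) / A * g"
    using s2 A g by (intro mult_pos_pos divide_pos_pos add_pos_nonneg) (auto simp: zero_less_power2)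
  also have "\<dots> = 8 * q / A * g + (6 * s\<^sup>2 - 2 * A) * (2 * g) - A * g"
    using A by (simp add: q_def field_simps power2_eq_square)
  finally show ?thesis
    using exp main m1 m2 m3 m4 err by (simp add: algebra_simps)
qed

definition potential :: "nat \<Rightarrow> nat \<Rightarrow> real" where
  "potential m n = (-1) ^ n * coupling (real (n + m))"

text \<open>
  With signs \<open>+ + - -\<close> the two neighbours of every site have opposite signs, so
  the equation at \<open>n\<close> is the definition of the coupling.
\<close>

lemma zero_energy_solution:
  assumes reg: "\<And>x. x \<ge> real m \<Longrightarrow> regular x"
  shows "\<exists>u\<in>ell2. (\<exists>n\<ge>1. u n \<noteq> 0) \<and> solves_schroedinger (potential m) 0 u"
proof -
  define u where "u n = (if n = 0 then 0 else complex_of_real ((- 1) ^ (n div 2) * amplitude (real (n + m))))" for n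
  have x: "20 \<le> real (n + m)" "ln (real (n + m)) \<ge> 20" for n using reg[of "real (n + m)"] by (auto simp: regular_def)
  have pos: "amplitude (real (n + m)) > 0" for n using x[of n] by (simp add: amplitude_def)
  define f where "f n = 2 / ln (real n + real m)" for n
  have "f \<longlonglongrightarrow> 0" unfolding f_def by real_asymp
  hence sf: "summable (\<lambda>n. f n - f (Suc n))" by (rule telescope_summable')
  have "summable (\<lambda>n. (norm (u (Suc n)))\<^sup>2)"
  proof (rule summable_comparison_test'[OF sf, where N=0])
    fix n
    have "regular (real (Suc n + m))" by (rule reg) simp
    hence "(amplitude (real (Suc n + m)))\<^sup>2 \<le> f n - f (Suc n)"
      unfolding regular_def f_def by (simp add: add_ac)
    thus "norm ((norm (u (Suc n)))\<^sup>2) \<le> f n - f (Suc n)"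
      by (simp add: u_def norm_mult norm_power power_mult_distrib)
  qed
  hence "summable (\<lambda>n. (norm (u n))\<^sup>2)"
    by (subst (asm) summable_Suc_iff[of "\<lambda>n. (norm (u n))\<^sup>2"])
  hence "u \<in> ell2" by (rule ell2_I[rotated]) (simp add: u_def)
  moreover have "\<exists>n\<ge>1. u n \<noteq> 0" using pos[of 1] by (intro exI[of _ 1]) (simp add: u_def)
  moreover have "solves_schroedinger (potential m) 0 u"
    unfolding solves_schroedinger_def
  proof (intro allI impI)
    fix n :: nat assume n: "n \<ge> 2"
    define a b c where "a = amplitude (real (n + m) - 1)" and "b = amplitude (real (n + m) + 1)" and "c = amplitude (real (n + m))"
    have cc: "coupling (real (n + m)) * c = a - b"
      using pos[of n] by (simp add: coupling_def a_def b_def c_def)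
    have args: "amplitude (real (n + 1 + m)) = b" "amplitude (real (n - 1 + m)) = a"
      using n by (simp_all add: a_def b_def of_nat_diff add_ac)
    have "(-1) ^ ((n + 1) div 2) * b + (-1) ^ ((n - 1) div 2) * a
        + potential m n * ((-1) ^ (n div 2) * c) = 0"
    proof (cases "even n")
      case True
      then obtain k where k: "n = 2 * Suc k" using n by (metis dvdE not0_implies_Suc mult_0_right not_numeral_le_zero)
      have "(-1) ^ ((n + 1) div 2) * b + (-1) ^ ((n - 1) div 2) * a
        + potential m n * ((-1) ^ (n div 2) * c) = - ((-1) ^ k) * b + (-1) ^ k * a - (-1) ^ k * (coupling (real (n + m)) * c)"
        unfolding potential_def using True by (simp add: k)
      thus ?thesis unfolding cc by (simp add: algebra_simps)
    next
      case False
      then obtain k where k: "n = 2 * k + 1" by (auto elim: oddE)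
      have "(-1) ^ ((n + 1) div 2) * b + (-1) ^ ((n - 1) div 2) * a
        + potential m n * ((-1) ^ (n div 2) * c) = - ((-1) ^ k) * b + (-1) ^ k * a - (-1) ^ k * (coupling (real (n + m)) * c)"
        unfolding potential_def using False by (simp add: k)
      thus ?thesis unfolding cc by (simp add: algebra_simps)
    qed
    hence "complex_of_real ((-1) ^ ((n + 1) div 2) * b + (-1) ^ ((n - 1) div 2) * a
        + potential m n * ((-1) ^ (n div 2) * c)) = 0" by (simp only: of_real_0)
    thus "u (n + 1) + u (n - 1) + complex_of_real (potential m n) * u n = complex_of_real 0 * u n"
      using n unfolding u_def args c_def[symmetric] by simp
  qed
  ultimately show ?thesis by blast
qed

lemma potential_bound:
  assumes "regular (real (n + m))" shows "\<bar>potential m n\<bar> \<le> 2 / real (n + m)"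
  using assms by (simp add: potential_def regular_def abs_mult power_abs)

section \<open>Upper bound on the number of bound states\<close>

text \<open>
  The blocks are intervals of length comparable to \<open>\<surd>t\<close> in \<open>t = ln x\<close>: block \<open>j\<close> is \<open>j\<^sup>2 / 36 \<le> t < (j + 1)\<^sup>2 / 36\<close>.
\<close>

definition block :: "real \<Rightarrow> nat" where
  "block x = nat \<lfloor>6 * sqrt (ln x)\<rfloor>"

lemma block_bounds:
  assumes "20 \<le> ln x"
  shows "1 \<le> block x" "real (block x) \<le> 6 * sqrt (ln x)"
    "(real (block x))\<^sup>2 / 36 \<le> ln x" "ln x \<le> (real (block x) + 1)\<^sup>2 / 36"
proof -
  have "sqrt 1 \<le> sqrt (ln x)" using assms by (intro real_sqrt_le_mono) simp
  hence ge: "6 \<le> 6 * sqrt (ln x)" by simp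
  thus "1 \<le> block x" unfolding block_def by linarith
  have fl: "real (block x) = of_int \<lfloor>6 * sqrt (ln x)\<rfloor>" using ge unfolding block_def by simp
  thus le: "real (block x) \<le> 6 * sqrt (ln x)" by simp
  have lt: "6 * sqrt (ln x) \<le> real (block x) + 1" unfolding fl by linarith
  have sq: "(6 * sqrt (ln x))\<^sup>2 = 36 * ln x" using assms by (simp add: power_mult_distrib)
  show "(real (block x))\<^sup>2 / 36 \<le> ln x"
    using power_mono[OF le, of 2] sq by simp
  show "ln x \<le> (real (block x) + 1)\<^sup>2 / 36"
    using power_mono[OF lt, of 2] sq ge by simp
qed

lemma block_mono: "1 \<le> x \<Longrightarrow> x \<le> y \<Longrightarrow> block x \<le> block y"
  unfolding block_def by (intro nat_mono floor_mono mult_left_mono real_sqrt_le_mono) auto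

text \<open>
  The supersolution of \<open>supersolution_step\<close> centred at the left end \<open>c = j\<^sup>2 / 36\<close> of block \<open>j\<close>.
\<close>

definition profile :: "nat \<Rightarrow> real \<Rightarrow> real" where
  "profile j y = (real j)\<^sup>2 / 72 - (ln y - (real j)\<^sup>2 / 36)\<^sup>2"

text \<open>
  The profile stays positive slightly beyond the right end of its block, because the width, at
  most \<open>j / 9\<close>, is smaller than \<open>\<surd>(c/2) = j / \<surd>72\<close>. The excess \<open>1/36\<close> covers the first site of the next block.
\<close>

lemma profile_pos:
  assumes j: "1 \<le> j" and l: "(real j)\<^sup>2 / 36 \<le> ln y" and u: "ln y \<le> (real j + 1)\<^sup>2 / 36 + 1 / 36"
  shows "profile j y > 0"
proof -
  have "ln y - (real j)\<^sup>2 / 36 \<le> (2 * real j + 2) / 36" using u by (simp add: power2_eq_square field_simps)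
  also have "\<dots> \<le> real j / 9" using j by simp
  finally have "(ln y - (real j)\<^sup>2 / 36)\<^sup>2 \<le> (real j / 9)\<^sup>2" using l by (intro power_mono) auto
  also have "\<dots> < (real j)\<^sup>2 / 72" using j by (simp add: power_divide)
  finally show ?thesis by (simp add: profile_def)
qed

text \<open>
  The sites at which a new block starts.
\<close>

definition breaks :: "nat \<Rightarrow> nat \<Rightarrow> nat set" where
  "breaks m N = {n \<in> {1..N}. block (real (n + m)) \<noteq> block (real (n + m) - 1)}"

lemma card_breaks_le:
  assumes "1 \<le> m"
  shows "card (breaks m N) \<le> block (real (N + m))"
proof -
  let ?f = "\<lambda>n. block (real (n + m))"
  have mono: "?f n \<le> ?f n'" if "n \<le> n'" for n n'
    using that assms by (intro block_mono) auto
  have jump: "?f n' < ?f n" if "n \<in> breaks m N" "n' < n" for n n'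
  proof -
    have "?f n' \<le> block (real (n + m) - 1)" using that assms by (intro block_mono) (auto simp: breaks_def)
    moreover have "block (real (n + m) - 1) \<le> ?f n" using that assms by (intro block_mono) (auto simp: breaks_def)
    moreover have "block (real (n + m) - 1) \<noteq> ?f n" using that by (simp add: breaks_def)
    ultimately show ?thesis by linarith
  qed
  have "inj_on ?f (breaks m N)"
  proof (rule inj_onI)
    fix a b assume "a \<in> breaks m N" "b \<in> breaks m N" "?f a = ?f b"
    thus "a = b" using jump[of a b] jump[of b a] by (cases a b rule: linorder_cases) auto
  qed
  moreover have "?f ` breaks m N \<subseteq> {1..block (real (N + m))}"
  proof safe
    fix n assume n: "n \<in> breaks m N"
    hence "?f 0 < ?f n" by (intro jump) (auto simp: breaks_def)
    moreover have "?f n \<le> ?f N" using n by (intro mono) (simp add: breaks_def)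
    ultimately show "?f n \<in> {1..block (real (N + m))}" by simp
  qed
  ultimately have "card (breaks m N) \<le> card {1..block (real (N + m))}"
    by (intro card_inj_on_le[of ?f]) auto
  thus ?thesis by simp
qed

lemma potential_le_half:
  assumes reg: "\<And>x. x \<ge> real m \<Longrightarrow> regular x"
  shows "\<bar>potential m n\<bar> \<le> 1 / 2"
proof -
  have "20 \<le> real (n + m)" using reg[of "real (n + m)"] by (simp add: regular_def)
  hence "2 / real (n + m) \<le> 2 / 20" by (intro divide_left_mono) auto
  thus ?thesis using potential_bound[of n m] reg[of "real (n + m)"] by simp
qed

lemma potential_tendsto_0:
  assumes reg: "\<And>x. x \<ge> real m \<Longrightarrow> regular x"
  shows "potential m \<longlonglongrightarrow> 0"
proof (rule Lim_null_comparison)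
  show "(\<lambda>n. 2 / (real n + real m)) \<longlonglongrightarrow> 0" by real_asymp
  have "norm (potential m n) \<le> 2 / (real n + real m)" for n
    using potential_bound[of n m] reg[of "real (n + m)"] by simp
  thus "\<forall>\<^sub>F n in sequentially. norm (potential m n) \<le> 2 / (real n + real m)" by simp
qed

text \<open>
  Vanishing at the breaks, \<open>u\<close> only has edges inside a single block, where the profile of that block
  provides the weights for \<open>energy_le\<close>. Beyond site \<open>N + 1\<close> the potential itself is small enough.
\<close>

lemma energy_decoupled:
  assumes reg: "\<And>x. x \<ge> real m \<Longrightarrow> regular x" and \<sigma>: "\<sigma> \<in> {1,-1}"
    and u: "u \<in> ell2" and B: "\<And>b. b \<in> insert (Suc N) (breaks m N) \<Longrightarrow> u b = 0"
  shows "\<sigma> * energy (potential m) u \<le> (2 + 2 / real (N + m)) * (ell2_norm u)\<^sup>2"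
proof -
  define p where "p j n = weight (\<sigma> * (-1) ^ n) (real (n + m)) * profile j (real (n + m))" for j n
  define J where "J n = block (real (n + m))" for n
  define a where "a n = (if n \<le> N then p (J n) (Suc n) / p (J n) n else 1)" for n
  \<comment> \<open>The profile of a block may be negative to the left of it, so at a break, where \<open>u\<close> vanishes, the weight is
    set to \<open>0\<close> instead of the quotient.\<close>
  define b where "b n = (if n \<le> N then (if n = 0 \<or> n \<in> breaks m N then 0 else p (J n) (n - 1) / p (J n) n) else 1)" for n
  have sgn: "\<sigma> * (-1) ^ n \<in> {1,-1}" for n :: nat using \<sigma> by (cases "even n") auto
  have rg: "regular (real (n + m))" for n by (rule reg) simp
  have L: "20 \<le> ln (real (n + m))" and x20: "20 \<le> real (n + m)" for n using rg[of n] by (simp_all add: regular_def)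
  have w: "weight (\<sigma> * (-1) ^ n) (real (n + m)) > 0" for n using rg[of n] sgn[of n] unfolding regular_def by blast
  have J1: "1 \<le> J n" for n unfolding J_def by (rule block_bounds[OF L])
  have p0: "p (J n) n > 0" for n
    unfolding p_def using w block_bounds(3,4)[OF L[of n]] J1[of n]
    by (intro mult_pos_pos profile_pos) (auto simp: J_def intro: order.trans)
  have lnSuc: "ln (real (Suc n + m)) \<le> ln (real (n + m)) + 1 / 36" for n
  proof -
    have x36: "36 \<le> real (n + m)" using rg[of n] by (simp add: regular_def)
    define x where "x = real (n + m)"
    have x: "36 \<le> x" using x36 by (simp add: x_def)
    have "real (Suc n + m) = x + 1" by (simp add: x_def)
    also have "\<dots> = x * (1 + 1 / x)" using x by (simp add: distrib_left)
    finally have "real (Suc n + m) = x * (1 + 1 / x)" .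
    hence "ln (real (Suc n + m)) = ln x + ln (1 + 1 / x)"
      using x by (simp add: ln_mult_pos add_pos_pos)
    also have "ln (1 + 1 / x) \<le> 1 / x"
      using x by (intro ln_add_one_self_le_self) auto
    also have "1 / x \<le> 1 / 36" using x by (intro divide_left_mono) auto
    finally show ?thesis by (simp add: x_def)
  qed
  have ps: "p (J n) (Suc n) > 0" for n
  proof -
    have "ln (real (n + m)) \<le> ln (real (Suc n + m))" using x20[of n] by simp
    thus ?thesis
      unfolding p_def using w[of "Suc n"] block_bounds(3,4)[OF L[of n]] J1[of n] lnSuc[of n]
      by (intro mult_pos_pos profile_pos) (auto simp: J_def)
  qed
  have same: "J (Suc n) = J n" if "Suc n \<le> N" "Suc n \<notin> breaks m N" for n
    using that by (simp add: breaks_def J_def add_ac)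
  have a_pos: "a n \<ge> 0" for n using p0[of n] ps[of n] by (simp add: a_def)
  have b_pos: "b n \<ge> 0" for n
  proof (cases "n = 0 \<or> n \<in> breaks m N \<or> n > N")
    case False
    then obtain k where k: "n = Suc k" by (cases n) auto
    hence "J n = J k" using False same[of k] by simp
    hence "p (J n) (n - 1) > 0" using p0[of k] k by simp
    thus ?thesis using p0[of n] False by (simp add: b_def)
  qed (auto simp: b_def)
  show ?thesis
  proof (rule energy_le[OF u, of "potential m" "1/2" \<sigma> a b])
    show "\<bar>potential m n\<bar> \<le> 1 / 2" for n by (rule potential_le_half[OF reg])
    show "2 * (norm (u (Suc n)) * norm (u n)) \<le> a n * (norm (u n))\<^sup>2 + b (Suc n) * (norm (u (Suc n)))\<^sup>2" for n
    proof (cases "u n = 0 \<or> u (Suc n) = 0")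
      case True thus ?thesis using a_pos[of n] b_pos[of "Suc n"] by auto
    next
      case False
      hence nb: "Suc n \<noteq> Suc N" "Suc n \<notin> breaks m N" using B by auto
      show ?thesis
      proof (cases "Suc n \<le> N")
        case True
        define r where "r = p (J n) (Suc n) / p (J n) n"
        have r: "r > 0" using p0[of n] ps[of n] by (simp add: r_def)
        have "a n = r" using True by (simp add: a_def r_def)
        moreover have "b (Suc n) = 1 / r" using True nb same[OF True nb(2)] by (simp add: b_def r_def)
        moreover have "2 * (norm (u (Suc n)) * norm (u n)) \<le> r * (norm (u n))\<^sup>2 + 1 / r * (norm (u (Suc n)))\<^sup>2"
        proof -
          have "0 \<le> (r * norm (u n) - norm (u (Suc n)))\<^sup>2 / r" using r by simp
          also have "\<dots> = r * (norm (u n))\<^sup>2 + 1 / r * (norm (u (Suc n)))\<^sup>2 - 2 * (norm (u (Suc n)) * norm (u n))"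
            using r by (simp add: power2_eq_square field_simps)
          finally show ?thesis by simp
        qed
        ultimately show ?thesis by simp
      next
        case False
        hence "a n = 1" "b (Suc n) = 1" using nb(1) by (simp_all add: a_def b_def)
        thus ?thesis using sum_squares_bound[of "norm (u (Suc n))" "norm (u n)"] by simp
      qed
    qed
    show "a n + b n + \<sigma> * potential m n \<le> 2 + 2 / real (N + m)" if "u n \<noteq> 0" for n
    proof -
      have n0: "n \<noteq> 0" using that ell2_0[OF u] by metis
      have nb: "n \<noteq> Suc N" "n \<notin> breaks m N" using that B by auto
      show ?thesis
      proof (cases "n \<le> N")
        case True
        obtain k where k: "n = Suc k" using n0 by (cases n) auto
        let ?x = "real (n + m)" and ?\<tau> = "\<sigma> * (-1) ^ n"
        have pe: "p (J n) i = weight (\<sigma> * (-1) ^ i) (real (i + m)) * ((real (J n))\<^sup>2 / 36 / 2 - (ln (real (i + m)) - (real (J n))\<^sup>2 / 36)\<^sup>2)" for i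
          by (simp add: p_def profile_def)
        have x1: "real (Suc n + m) = ?x + 1" "real (k + m) = ?x - 1" using k by simp_all
        have s1: "\<sigma> * (-1) ^ Suc n = - ?\<tau>" "\<sigma> * (-1) ^ k = - ?\<tau>" using k by simp_all
        have "p (J n) (Suc n) + p (J n) k \<le> (2 - ?\<tau> * coupling ?x) * p (J n) n"
          unfolding pe x1 s1
          by (rule supersolution_step[OF rg sgn]) (use block_bounds(3)[OF L[of n]] in \<open>auto simp: J_def\<close>)
        hence "(p (J n) (Suc n) + p (J n) k) / p (J n) n \<le> 2 - ?\<tau> * coupling ?x"
          using p0[of n] by (simp add: divide_le_eq)
        moreover have "a n + b n = (p (J n) (Suc n) + p (J n) k) / p (J n) n"
          using True n0 nb k by (simp add: a_def b_def add_divide_distrib)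
        moreover have "\<sigma> * potential m n = ?\<tau> * coupling ?x" by (simp add: potential_def)
        moreover have "0 \<le> 2 / real (N + m)" by simp
        ultimately show ?thesis by linarith
      next
        case False
        have "\<sigma> * potential m n \<le> \<bar>potential m n\<bar>" using \<sigma> by auto
        also have "\<dots> \<le> 2 / real (n + m)" by (rule potential_bound[OF rg])
        also have "\<dots> \<le> 2 / real (N + m)" using False x20[of N] by (intro divide_left_mono) auto
        finally show ?thesis using False by (simp add: a_def b_def)
      qed
    qed
  qed (use \<sigma> a_pos b_pos in auto)
qed

text \<open>
  There are about \<open>6 \<surd>ln (N + m)\<close> breaks up to \<open>N\<close>, and each of them costs at most one bound state at either side
  of the band.
\<close>

lemma count_bound_states:
  assumes reg: "\<And>x. x \<ge> real m \<Longrightarrow> regular x" and m: "1 \<le> m"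
  shows "finite {E \<in> bound_states (potential m). \<bar>E\<bar> > 2 + 2 / real (N + m)}"
    and "card {E \<in> bound_states (potential m). \<bar>E\<bar> > 2 + 2 / real (N + m)} \<le> 2 * (block (real (N + m)) + 1)"
proof -
  let ?S = "\<lambda>\<sigma>. {E \<in> bound_states (potential m). \<sigma> * E > 2 + 2 / real (N + m)}"
  have fb: "finite (breaks m N)" by (simp add: breaks_def)
  have S: "finite (?S \<sigma>) \<and> card (?S \<sigma>) \<le> block (real (N + m)) + 1" if "\<sigma> \<in> {1,-1}" for \<sigma>
  proof -
    have "finite (?S \<sigma>) \<and> card (?S \<sigma>) \<le> card (insert (Suc N) (breaks m N))"
    proof (rule card_bound_states_le)
      show "\<bar>potential m n\<bar> \<le> 1 / 2" for n by (rule potential_le_half[OF reg])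
      show "\<sigma> * energy (potential m) u \<le> (2 + 2 / real (N + m)) * (ell2_norm u)\<^sup>2"
        if "u \<in> ell2" "\<And>b. b \<in> insert (Suc N) (breaks m N) \<Longrightarrow> u b = 0" for u
        using reg \<open>\<sigma> \<in> {1,-1}\<close> that by (rule energy_decoupled)
    qed (use fb in simp)
    moreover have "card (insert (Suc N) (breaks m N)) \<le> block (real (N + m)) + 1"
      using card_breaks_le[OF m, of N] card_insert_le_m1 fb by (simp add: card_insert_if)
    ultimately show ?thesis by linarith
  qed
  have split: "{E \<in> bound_states (potential m). \<bar>E\<bar> > 2 + 2 / real (N + m)} = ?S 1 \<union> ?S (-1)"
    by (auto simp: abs_if split: if_splits)
  show "finite {E \<in> bound_states (potential m). \<bar>E\<bar> > 2 + 2 / real (N + m)}"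
    unfolding split using S by blast
  show "card {E \<in> bound_states (potential m). \<bar>E\<bar> > 2 + 2 / real (N + m)} \<le> 2 * (block (real (N + m)) + 1)"
    unfolding split mult_2
    by (rule order.trans[OF card_Un_le add_mono]) (rule conjunct2[OF S], simp)+
qed

lemma bound_states_near_band:
  assumes reg: "\<And>x. x \<ge> real m \<Longrightarrow> regular x" and E: "E \<in> bound_states (potential m)"
  shows "\<bar>E\<bar> \<le> 2 + 1 / 2"
proof (rule ccontr)
  assume "\<not> \<bar>E\<bar> \<le> 2 + 1 / 2"
  define \<sigma> :: real where "\<sigma> = sgn E"
  have \<sigma>: "\<sigma> \<in> {1,-1}" "\<sigma> * E > 2 + 1 / 2" using \<open>\<not> \<bar>E\<bar> \<le> 2 + 1 / 2\<close> by (auto simp: \<sigma>_def sgn_if)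
  have "finite {E \<in> bound_states (potential m). \<sigma> * E > 2 + 1/2} \<and> card {E \<in> bound_states (potential m). \<sigma> * E > 2 + 1/2} \<le> card ({}::nat set)"
  proof (rule card_bound_states_le)
    show half: "\<bar>potential m n\<bar> \<le> 1 / 2" for n by (rule potential_le_half[OF reg])
    show "\<sigma> * energy (potential m) u \<le> (2 + 1/2) * (ell2_norm u)\<^sup>2" if "u \<in> ell2" for u
      by (rule energy_crude[OF that half \<sigma>(1) half])
  qed simp
  thus False using E \<sigma>(2) by auto
qed

section \<open>Infinitely many bound states\<close>

text \<open>
  The positive part \<open>y\<close> of the subsolution \<open>p\<close> around \<open>c\<close>. Where \<open>y > 0\<close> its neighbours are at
  least those of \<open>p\<close>, as \<open>p\<close> is nonpositive just outside, so \<open>(H - 2) y > 0\<close> there and the energy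
  exceeds \<open>2 \<parallel>y\<parallel>\<^sup>2\<close>.
\<close>

lemma test_function:
  assumes reg: "\<And>x. x \<ge> real m \<Longrightarrow> regular x"
  shows "\<exists>u M'. u \<in> ell2 \<and> (\<forall>n. u n \<noteq> 0 \<longrightarrow> M < n \<and> n < M') \<and>
           2 * (ell2_norm u)\<^sup>2 < energy (potential m) u"
proof -
  \<comment> \<open>The support lies in \<open>ln x > c / 2\<close>, hence beyond \<open>M\<close>.\<close>
  define c where "c = 64 + 2 * ln (real (M + m + 2))"
  have c: "c \<ge> 64" by (simp add: c_def)
  have m36: "36 \<le> real m" using reg[of "real m"] by (simp add: regular_def)
  define near where "near x \<longleftrightarrow> (ln x - c)\<^sup>2 < 16 * c" for x
  define \<psi> where "\<psi> = (\<lambda>y. (32 * c - (ln y - c)\<^sup>2)\<^sup>2 - (16 * c)\<^sup>2)"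
  define p where "p n = weight ((-1) ^ n) (real (n + m)) * \<psi> (real (n + m))" for n
  define y where "y n = (if near (real (n + m)) then p n else 0)" for n
  define u where "u n = complex_of_real (y n)" for n
  have rg: "regular (real (n + m))" for n by (rule reg) simp
  have w: "weight ((-1) ^ n) (real (n + m)) > 0" for n
    using rg[of n] unfolding regular_def by (cases "even n") auto
  have sq: "16 * c \<le> (c / 2)\<^sup>2"
  proof -
    have "16 * c \<le> c / 4 * c" using c by (intro mult_right_mono) auto
    thus ?thesis by (simp add: power2_eq_square)
  qed
  have range: "c / 2 < ln x \<and> ln x < 2 * c" if "near x" for x
  proof -
    have "\<bar>ln x - c\<bar>\<^sup>2 < (c / 2)\<^sup>2" using that sq unfolding near_def by simp
    hence "\<bar>ln x - c\<bar> < c / 2" by (rule power2_less_imp_less) (use c in auto)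
    thus ?thesis using c by linarith
  qed
  have lower: "M + 2 < n" if "near (real (n + m))" for n
  proof -
    have "ln (real (M + m + 2)) < ln (real (n + m))" using range[OF that] by (simp add: c_def)
    hence "real (M + m + 2) < real (n + m)" using m36 by (subst (asm) ln_less_cancel_iff) auto
    thus ?thesis by simp
  qed
  define S where "S = {n. near (real (n + m))}"
  have upper: "n < nat \<lceil>exp (2 * c)\<rceil>" if "n \<in> S" for n
  proof -
    have "exp (ln (real (n + m))) < exp (2 * c)"
      using range[of "real (n + m)"] that by (simp add: S_def del: exp_ln)
    hence "real (n + m) < exp (2 * c)" using m36 by (subst (asm) exp_ln) auto
    thus ?thesis by linarith
  qed
  have fS: "finite S" using upper by (intro finite_subset[of S "{..<nat \<lceil>exp (2 * c)\<rceil>}"]) auto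
  have psi_pos: "\<psi> x > 0" if "near x" for x
  proof -
    have "(16 * c)\<^sup>2 < (32 * c - (ln x - c)\<^sup>2)\<^sup>2"
      using that c unfolding near_def by (intro power_strict_mono) auto
    thus ?thesis by (simp add: \<psi>_def)
  qed
  have yp: "y n = p n" "p n > 0" if "n \<in> S" for n
    using that w[of n] psi_pos by (auto simp: y_def p_def S_def)
  have y0: "y n = 0" if "n \<notin> S" for n using that by (simp add: y_def S_def)
  have ne: "S \<noteq> {}"
  proof -
    have "exp c \<ge> real m"
    proof -
      have "ln (real m) \<le> ln (real (M + m + 2))" using m36 by simp
      also have "\<dots> \<le> c" using m36 by (simp add: c_def)
      finally show ?thesis using m36 by (metis exp_le_cancel_iff exp_ln less_le_trans zero_less_numeral)
    qed
    define n where "n = nat \<lceil>exp c\<rceil> - m"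
    have n: "exp c \<le> real (n + m)" "real (n + m) \<le> exp c + 1"
      using \<open>exp c \<ge> real m\<close> by (simp_all add: n_def of_nat_diff) linarith+
    have "c \<le> ln (real (n + m))" using n(1) m36 by (subst ln_ge_iff) auto
    moreover have "ln (real (n + m)) \<le> c + 1"
    proof -
      have "exp c + 1 \<le> exp c * exp 1"
      proof -
        have "exp c * 2 \<le> exp c * exp 1" using exp_ge_add_one_self[of 1] by (intro mult_left_mono) auto
        moreover have "1 \<le> exp c" using c by simp
        ultimately show ?thesis by linarith
      qed
      hence "real (n + m) \<le> exp (c + 1)" using n(2) by (simp add: exp_add)
      hence "ln (real (n + m)) \<le> ln (exp (c + 1))" using m36 by (intro ln_le_cancel_iff[THEN iffD2]) auto
      thus ?thesis by simp
    qed
    ultimately have "\<bar>ln (real (n + m)) - c\<bar> \<le> 1" by simp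
    hence "(ln (real (n + m)) - c)\<^sup>2 \<le> 1" by (simp add: abs_square_le_1)
    hence "n \<in> S" using c unfolding S_def near_def by simp
    thus ?thesis by blast
  qed
  have above: "p k \<le> y k" if "n \<in> S" "k = Suc n \<or> n = Suc k" for n k
  proof (cases "k \<in> S")
    case True thus ?thesis using yp by simp
  next
    case False
    have x: "20 \<le> real (n + m)" "20 \<le> real (k + m)" using rg[of n] rg[of k] by (simp_all add: regular_def)
    have "\<bar>ln (real (k + m)) - ln (real (n + m))\<bar> \<le> 1"
    proof -
      have step: "ln (real (Suc i + m)) \<le> ln (real (i + m)) + 1 \<and> ln (real (i + m)) \<le> ln (real (Suc i + m))"
        if "20 \<le> real (i + m)" for i
      proof -
        have "real (Suc i + m) \<le> real (i + m) * exp 1"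
        proof -
          have "real (i + m) * 2 \<le> real (i + m) * exp 1" using exp_ge_add_one_self[of 1] by (intro mult_left_mono) auto
          thus ?thesis using that by simp
        qed
        hence "ln (real (Suc i + m)) \<le> ln (real (i + m) * exp 1)"
          using that by (subst ln_le_cancel_iff) auto
        also have "\<dots> = ln (real (i + m)) + 1" using that by (subst ln_mult_pos) auto
        finally show ?thesis using that by simp
      qed
      show ?thesis
        using that(2)
      proof
        assume e: "k = Suc n"
        show ?thesis using step[OF x(1)] unfolding e by linarith
      next
        assume e: "n = Suc k"
        show ?thesis using step[OF x(2)] unfolding e by linarith
      qed
    qed
    moreover have "\<bar>ln (real (n + m)) - c\<bar> \<le> c / 2"
    proof -
      have "(ln (real (n + m)) - c)\<^sup>2 \<le> (c / 2)\<^sup>2" using that(1) sq by (simp add: S_def near_def)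
      thus ?thesis using c by (simp add: abs_le_square_iff[symmetric])
    qed
    ultimately have "\<bar>ln (real (k + m)) - c\<bar> \<le> \<bar>ln (real (n + m)) - c\<bar> + 1" by linarith
    hence "\<bar>ln (real (k + m)) - c\<bar>\<^sup>2 \<le> (\<bar>ln (real (n + m)) - c\<bar> + 1)\<^sup>2" by (intro power_mono) auto
    also have "\<dots> = (ln (real (n + m)) - c)\<^sup>2 + 2 * \<bar>ln (real (n + m)) - c\<bar> + 1"
      by (simp add: power2_sum)
    also have "\<dots> \<le> 48 * c"
      using that(1) \<open>\<bar>ln (real (n + m)) - c\<bar> \<le> c / 2\<close> c by (simp add: S_def near_def)
    finally have "(ln (real (k + m)) - c)\<^sup>2 \<le> 48 * c" by simp
    moreover have "16 * c \<le> (ln (real (k + m)) - c)\<^sup>2" using False by (simp add: S_def near_def)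
    ultimately have "\<bar>32 * c - (ln (real (k + m)) - c)\<^sup>2\<bar> \<le> \<bar>16 * c\<bar>" using c by linarith
    hence "\<psi> (real (k + m)) \<le> 0" unfolding \<psi>_def by (simp add: abs_le_square_iff)
    hence "p k \<le> 0" using w[of k] unfolding p_def by (simp add: mult_le_0_iff)
    thus ?thesis using y0[OF False] by simp
  qed
  have gain: "y (n + 1) + y (n - 1) + potential m n * y n - 2 * y n > 0" if n: "n \<in> S" for n
  proof -
    obtain k where k: "n = Suc k" using lower[of n] n by (cases n) (auto simp: S_def)
    have "(2 - (-1) ^ n * coupling (real (n + m))) * (weight ((-1) ^ n) (real (n + m)) * \<psi> (real (n + m)))
        < weight (- ((-1) ^ n)) (real (n + m) + 1) * \<psi> (real (n + m) + 1)
          + weight (- ((-1) ^ n)) (real (n + m) - 1) * \<psi> (real (n + m) - 1)"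
      unfolding \<psi>_def by (rule subsolution_step[OF rg _ c]) (use n in \<open>auto simp: S_def near_def minus_one_power_iff\<close>)
    hence "(2 - potential m n) * p n < p (n + 1) + p (n - 1)"
      unfolding p_def potential_def using k by (simp add: add_ac)
    moreover have "p (n + 1) \<le> y (n + 1)" "p (n - 1) \<le> y (n - 1)" using above[OF n] k by simp_all
    ultimately show ?thesis using yp(1)[OF n] by (simp add: left_diff_distrib)
  qed
  have S0: "0 \<notin> S" using lower[of 0] by (auto simp: S_def)
  have u: "u \<in> ell2"
  proof (rule ell2_finite_support)
    show "u 0 = 0" using y0[OF S0] by (simp add: u_def)
    show "u n = 0" if "nat \<lceil>exp (2 * c)\<rceil> < n" for n
      using upper[of n] y0[of n] that by (cases "n \<in> S") (auto simp: u_def)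
  qed
  let ?f = "\<lambda>n. schroedinger (potential m) u n - 2 * u n"
  have H: "schroedinger (potential m) u \<in> ell2"
    by (rule schroedinger_ell2[OF u]) (rule potential_le_half[OF reg])
  have "ell2_inner ?f u = (\<Sum>n\<in>S. ?f n * cnj (u n))"
    unfolding ell2_inner_def by (rule suminf_finite[OF fS]) (simp add: u_def y0)
  also have "\<dots> = (\<Sum>n\<in>S. of_real ((y (n + 1) + y (n - 1) + potential m n * y n - 2 * y n) * y n))"
  proof (rule sum.cong[OF refl])
    fix n assume "n \<in> S"
    then obtain k where k: "n = Suc k" using S0 by (cases n) auto
    have "u 0 = 0" using ell2_0[OF u] .
    thus "?f n * cnj (u n) = of_real ((y (n + 1) + y (n - 1) + potential m n * y n - 2 * y n) * y n)"
      unfolding k by (simp add: schroedinger_Suc) (simp add: u_def)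
  qed
  finally have e: "ell2_inner ?f u = of_real (\<Sum>n\<in>S. (y (n + 1) + y (n - 1) + potential m n * y n - 2 * y n) * y n)"
    by simp
  have "ell2_inner ?f u = ell2_inner (schroedinger (potential m) u) u - 2 * ell2_inner u u"
    using u H by (simp add: ell2_inner_diff_left ell2_scale ell2_inner_scale_left)
  hence "energy (potential m) u - 2 * (ell2_norm u)\<^sup>2 = Re (ell2_inner ?f u)"
    by (simp add: energy_def ell2_inner_self[OF u])
  also have "\<dots> > 0"
    unfolding e Re_complex_of_real using gain yp fS ne by (intro sum_pos mult_pos_pos) auto
  finally have en: "2 * (ell2_norm u)\<^sup>2 < energy (potential m) u" by simp
  have "M < n \<and> n < nat \<lceil>exp (2 * c)\<rceil>" if "u n \<noteq> 0" for n
  proof -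
    have "n \<in> S" using that y0[of n] by (auto simp: u_def)
    thus ?thesis using upper[of n] lower[of n] by (simp add: S_def)
  qed
  with u en show ?thesis by blast
qed

text \<open>
  Otherwise more test functions than bound states, with pairwise separated supports, have a nontrivial combination
  orthogonal to all bound states, and its energy is still above the band edge.
\<close>

lemma infinitely_many_bound_states:
  assumes reg: "\<And>x. x \<ge> real m \<Longrightarrow> regular x"
  shows "infinite (bound_states (potential m))"
proof
  let ?V = "potential m" and ?B = "bound_states (potential m)"
  assume fin: "finite ?B"
  obtain U h where U: "\<And>M. U M \<in> ell2" "\<And>M n. U M n \<noteq> 0 \<Longrightarrow> M < n \<and> n < h M"
    "\<And>M. 2 * (ell2_norm (U M))\<^sup>2 < energy ?V (U M)"
    using test_function[OF reg] by metis
  \<comment> \<open>The gap of one site keeps \<open>H (e i)\<close> orthogonal to \<open>e j\<close> as well.\<close>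
  define lo where "lo = rec_nat 0 (\<lambda>_ M. h M + 1)"
  define e where "e i = U (lo i)" for i
  have lo: "lo (Suc i) = h (lo i) + 1" for i by (simp add: lo_def)
  have ex: "\<exists>n. U M n \<noteq> 0" for M
  proof (rule ccontr)
    assume "\<nexists>n. U M n \<noteq> 0"
    hence "U M = (\<lambda>_. 0)" by auto
    thus False using U(3)[of M] by (simp add: energy_def ell2_inner_def ell2_norm_def)
  qed
  have hM: "M < h M" for M
  proof -
    obtain n where "U M n \<noteq> 0" using ex by blast
    thus ?thesis using U(2)[of M n] by linarith
  qed
  have "lo i \<le> lo (Suc i)" for i using hM[of "lo i"] by (simp add: lo)
  hence mono: "lo i \<le> lo j" if "i \<le> j" for i j
    by (rule lift_Suc_mono_le[of lo, OF _ that])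
  have apart: "k + 1 < n" if "i < j" "e i k \<noteq> 0" "e j n \<noteq> 0" for i j k n
  proof -
    have "k < h (lo i)" by (rule conjunct2[OF U(2)[OF that(2)[unfolded e_def]]])
    moreover have "lo j < n" by (rule conjunct1[OF U(2)[OF that(3)[unfolded e_def]]])
    moreover have "h (lo i) + 1 \<le> lo j" using mono[of "Suc i" j] that(1) by (simp add: lo)
    ultimately show ?thesis by linarith
  qed
  have far: "e i k = 0" if "i \<noteq> j" "e j n \<noteq> 0" "k \<le> n + 1" "n \<le> k + 1" for i j k n
  proof (rule ccontr)
    assume k: "e i k \<noteq> 0"
    show False
    proof (cases "i < j")
      case True
      from apart[OF True k that(2)] that(4) show False by linarith
    next
      case False
      hence "j < i" using that(1) by simp
      from apart[OF this that(2) k] that(3) show False by linarith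
    qed
  qed
  have orth: "ell2_inner (e i) (e j) = 0" "ell2_inner (schroedinger ?V (e i)) (e j) = 0" if "i \<noteq> j" for i j
  proof -
    have "e i n * cnj (e j n) = 0 \<and> schroedinger ?V (e i) n * cnj (e j n) = 0" for n
    proof (cases "e j n = 0")
      case False
      have z: "e i n = 0" "e i (n + 1) = 0" "e i (n - 1) = 0"
        using far[OF that False] by simp_all
      hence "schroedinger ?V (e i) n = 0"
        unfolding schroedinger_def by (cases "n = 1") (simp_all add: numeral_2_eq_2)
      thus ?thesis using z by simp
    qed simp
    hence "(\<lambda>n. e i n * cnj (e j n)) = (\<lambda>n. 0)" "(\<lambda>n. schroedinger ?V (e i) n * cnj (e j n)) = (\<lambda>n. 0)"
      by blast+
    thus "ell2_inner (e i) (e j) = 0" "ell2_inner (schroedinger ?V (e i)) (e j) = 0" by (simp_all only: ell2_inner_def suminf_zero)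
  qed
  define I where "I = {..card ?B}"
  obtain x where x: "\<exists>i\<in>I. x i \<noteq> 0" "\<forall>E\<in>?B. (\<Sum>i\<in>I. x i * ell2_inner (e i) (bound_state ?V E)) = 0"
    using underdetermined_system[OF fin, of I "\<lambda>i E. ell2_inner (e i) (bound_state ?V E)"] by (auto simp: I_def)
  define u where "u = (\<lambda>n. \<Sum>i\<in>I. x i * e i n)"
  have ee: "e i \<in> ell2" for i using U(1) by (simp add: e_def)
  have u: "u \<in> ell2" unfolding u_def by (intro ell2_sum ell2_scale ee)
  have "ell2_inner u (bound_state ?V E) = 0" if "E \<in> ?B" for E
  proof -
    have E: "bound_state ?V E \<in> ell2" using that by (simp add: bound_states_def)
    have "ell2_inner u (bound_state ?V E) = (\<Sum>i\<in>I. x i * ell2_inner (e i) (bound_state ?V E))"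
      unfolding u_def using E by (simp add: ell2_inner_sum_left ell2_scale ee ell2_inner_scale_left)
    thus ?thesis using x(2) that by simp
  qed
  moreover have "2 * (ell2_norm u)\<^sup>2 < energy ?V u"
  proof -
    note fam = energy_orthogonal_family[of I e ?V "1/2" x, OF _ ee potential_le_half[OF reg] orth, folded u_def]
    have fI: "finite I" by (simp add: I_def)
    obtain k where k: "k \<in> I" "x k \<noteq> 0" using x(1) by blast
    have "0 < (\<Sum>i\<in>I. (norm (x i))\<^sup>2 * (energy ?V (e i) - 2 * (ell2_norm (e i))\<^sup>2))"
    proof (rule sum_pos2[OF fI k(1)])
      show "0 < (norm (x k))\<^sup>2 * (energy ?V (e k) - 2 * (ell2_norm (e k))\<^sup>2)"
        using k(2) U(3)[of "lo k"] by (simp add: e_def)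
      show "0 \<le> (norm (x i))\<^sup>2 * (energy ?V (e i) - 2 * (ell2_norm (e i))\<^sup>2)" for i
        using U(3)[of "lo i"] by (simp add: e_def)
    qed
    also have "\<dots> = energy ?V u - 2 * (ell2_norm u)\<^sup>2"
      using fam fI by (simp add: sum_subtractf right_diff_distrib sum_distrib_left mult_ac)
    finally show ?thesis by simp
  qed
  moreover have "?V \<longlonglongrightarrow> 0"
    by (rule potential_tendsto_0[OF reg])
  ultimately show False
    using another_bound_state[of ?V "1/2" ?B u] potential_le_half[OF reg] u by blast
qed


section \<open>Enumeration of the bound states and their decay\<close>

text \<open>
  The elements are picked in turn, each with the largest \<open>k\<close> among the remaining ones. None is missed, because
  only finitely many elements have a value of \<open>k\<close> as large as that of a given one.
\<close>

lemma decreasing_enumeration: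
  fixes k :: "'a \<Rightarrow> real"
  assumes inf: "infinite S" and pos: "\<And>x. x \<in> S \<Longrightarrow> k x > 0"
    and fin: "\<And>\<delta>. \<delta> > 0 \<Longrightarrow> finite {x \<in> S. k x > \<delta>}"
  shows "\<exists>f :: nat \<Rightarrow> 'a. bij_betw f UNIV S \<and> (\<forall>i j. i \<le> j \<longrightarrow> k (f j) \<le> k (f i))"
proof -
  have fin': "finite {x \<in> S. k x \<ge> \<delta>}" if "\<delta> > 0" for \<delta>
    by (rule finite_subset[OF _ fin[of "\<delta> / 2"]]) (use that in auto)
  have top: "\<exists>x. x \<in> X \<and> (\<forall>y\<in>X. k y \<le> k x)" if X: "X \<subseteq> S" "X \<noteq> {}" for X
  proof -
    obtain z where z: "z \<in> X" using X by blast
    define Y where "Y = {x \<in> X. k x \<ge> k z}"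
    have "finite Y" unfolding Y_def by (rule finite_subset[OF _ fin'[of "k z"]]) (use X z pos in auto)
    moreover have "Y \<noteq> {}" using z by (auto simp: Y_def)
    ultimately have "Max (k ` Y) \<in> k ` Y" by (intro Max_in) auto
    then obtain x where "x \<in> Y" "k x = Max (k ` Y)" by auto
    with \<open>finite Y\<close> have x: "x \<in> Y" "\<forall>y\<in>Y. k y \<le> k x" by auto
    have "k y \<le> k x" if "y \<in> X" for y
    proof (cases "y \<in> Y")
      case False
      thus ?thesis using x(1) that by (auto simp: Y_def)
    qed (use x in auto)
    thus ?thesis using x(1) by (auto simp: Y_def)
  qed
  define pick where "pick X = (SOME x. x \<in> X \<and> (\<forall>y\<in>X. k y \<le> k x))" for X
  define R where "R = rec_nat S (\<lambda>_ X. X - {pick X})"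
  define f where "f n = pick (R n)" for n
  have R: "R 0 = S" "R (Suc n) = R n - {f n}" for n by (simp_all add: R_def f_def)
  have Rinf: "R n \<subseteq> S \<and> infinite (R n)" for n
    by (induction n) (auto simp: R inf)
  have f: "f n \<in> R n" "\<And>y. y \<in> R n \<Longrightarrow> k y \<le> k (f n)" for n
  proof -
    have "R n \<noteq> {}" using Rinf[of n] by auto
    from someI_ex[OF top[OF conjunct1[OF Rinf] this]] show "f n \<in> R n" "\<And>y. y \<in> R n \<Longrightarrow> k y \<le> k (f n)"
      unfolding f_def pick_def by blast+
  qed
  have Rmono: "R j \<subseteq> R i" if "i \<le> j" for i j
    by (rule lift_Suc_antimono_le[of R, OF _ that]) (auto simp: R)
  have gone: "f i \<notin> R j" if "i < j" for i j
    using Rmono[of "Suc i" j] that by (auto simp: R)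
  have "inj f"
  proof (rule injI)
    fix i j assume "f i = f j"
    thus "i = j" using gone[of i j] gone[of j i] f(1)[of i] f(1)[of j] by (cases i j rule: linorder_cases) auto
  qed
  moreover have "range f = S"
  proof (intro equalityI subsetI)
    fix x assume "x \<in> S"
    show "x \<in> range f"
    proof (rule ccontr)
      assume "x \<notin> range f"
      hence "x \<in> R n" for n using \<open>x \<in> S\<close> by (induction n) (auto simp: R)
      hence "range f \<subseteq> {y \<in> S. k y \<ge> k x}" using f Rinf by blast
      hence "finite (range f)" using fin'[OF pos[OF \<open>x \<in> S\<close>]] finite_subset by blast
      thus False using \<open>inj f\<close> finite_imageD by blast
    qed
  qed (use f Rinf in blast)
  moreover have "k (f j) \<le> k (f i)" if "i \<le> j" for i j
    using f(1)[of j] f(2)[of _ i] Rmono[OF that] by blast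
  ultimately show ?thesis by (intro exI[of _ f]) (auto simp: bij_betw_def)
qed

lemma infdist_band:
  assumes "E \<notin> {-2..2::real}"
  shows "infdist E {-2..2} = \<bar>E\<bar> - 2"
proof (rule antisym)
  have "infdist E {-2..2} \<le> dist E (2 * sgn E)" by (intro infdist_le) (auto simp: sgn_if)
  thus "infdist E {-2..2} \<le> \<bar>E\<bar> - 2" using assms by (auto simp: dist_real_def sgn_if split: if_splits)
  have "\<bar>E\<bar> - 2 \<le> dist E a" if "a \<in> {-2..2}" for a using that by (auto simp: dist_real_def)
  hence "\<bar>E\<bar> - 2 \<le> (INF a\<in>{-2..2}. dist E a)" by (intro cINF_greatest) auto
  thus "\<bar>E\<bar> - 2 \<le> infdist E {-2..2}" by (simp add: infdist_notempty)
qed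

text \<open>
  The finitely many exceptions are accommodated by a smaller constant, since \<open>d\<close> stays below \<open>1/2\<close>.
\<close>

lemma gaussian_rate:
  fixes d :: "nat \<Rightarrow> real"
  assumes half: "\<And>n. d n \<le> 1 / 2" and ev: "\<forall>\<^sub>F n in sequentially. d n \<le> exp (- (real n)\<^sup>2 / 1000)"
  obtains c where "c > 0" "\<And>n. d n \<le> exp (- c * (real n)\<^sup>2)"
proof -
  obtain N where N: "\<And>n. n \<ge> N \<Longrightarrow> d n \<le> exp (- (real n)\<^sup>2 / 1000)"
    using ev unfolding eventually_sequentially by blast
  define c where "c = min (1 / 1000) (ln 2 / ((real N)\<^sup>2 + 1))"
  have c: "c > 0" unfolding c_def by (auto simp: add_nonneg_pos)
  have "d n \<le> exp (- c * (real n)\<^sup>2)" for n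
  proof (cases "n \<ge> N")
    case True
    have "c \<le> 1 / 1000" unfolding c_def by (rule min.cobounded1)
    hence "c * (real n)\<^sup>2 \<le> 1 / 1000 * (real n)\<^sup>2" by (intro mult_right_mono) auto
    thus ?thesis using N[OF True] by (simp add: order.trans)
  next
    case False
    have "c * (real n)\<^sup>2 \<le> ln 2 / ((real N)\<^sup>2 + 1) * ((real N)\<^sup>2 + 1)"
    proof (rule mult_mono)
      have "(real n)\<^sup>2 \<le> (real N)\<^sup>2" using False by (intro power_mono) auto
      thus "(real n)\<^sup>2 \<le> (real N)\<^sup>2 + 1" by linarith
    qed (auto simp: c_def)
    also have "\<dots> = ln 2"
    proof -
      have "(real N)\<^sup>2 + 1 \<noteq> 0" by (metis add_nonneg_pos less_irrefl zero_le_power2 zero_less_one)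
      thus ?thesis by simp
    qed
    finally have "exp (- ln 2) \<le> exp (- c * (real n)\<^sup>2)" by simp
    thus ?thesis using half[of n] by (simp add: exp_minus)
  qed
  with c that show ?thesis by blast
qed

theorem theorem1p1:
  "\<exists>(V :: nat \<Rightarrow> real) (E :: nat \<Rightarrow> real) (d :: nat \<Rightarrow> real).
     infinite (spectrum V - complex_of_real ` {-2..2}) \<and>
     bij_betw (\<lambda>n. complex_of_real (E n)) {1..} (spectrum V - complex_of_real ` {-2..2}) \<and>
     (\<forall>n\<ge>1. discrete_eigenvalue V (complex_of_real (E n))) \<and>
     (\<forall>n\<ge>1. d n = infdist (E n) {-2..2}) \<and>
     (\<forall>n\<ge>1. d (n + 1) \<le> d n) \<and>
     d \<longlonglongrightarrow> 0 \<and>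
     (\<exists>u\<in>ell2. (\<exists>n\<ge>1. u n \<noteq> 0) \<and> solves_schroedinger V 0 u) \<and>
     (\<exists>c>0. \<forall>n\<ge>1. d n \<le> exp (- c * (real n)\<^sup>2))"
proof -
  obtain X where X: "\<And>x. x \<ge> X \<Longrightarrow> regular x"
    using eventually_regular unfolding eventually_at_top_linorder by blast
  define m where "m = nat \<lceil>X\<rceil> + 1"
  have reg: "regular x" if "x \<ge> real m" for x
    using that by (intro X) (simp add: m_def, linarith)
  have m1: "1 \<le> m" by (simp add: m_def)
  define V where "V = potential m"
  define B where "B = bound_states V"
  have V0: "V \<longlonglongrightarrow> 0" unfolding V_def by (rule potential_tendsto_0[OF reg])
  have V: "\<bar>V n\<bar> \<le> 1 / 2" for n unfolding V_def by (rule potential_le_half[OF reg])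
  have inf: "infinite B" unfolding B_def V_def by (rule infinitely_many_bound_states[OF reg])
  have pos: "\<bar>E\<bar> - 2 > 0" if "E \<in> B" for E using that by (auto simp: B_def bound_states_def)
  have cnt: "finite {E \<in> B. \<bar>E\<bar> > 2 + 2 / real (N + m)}"
    "card {E \<in> B. \<bar>E\<bar> > 2 + 2 / real (N + m)} \<le> 2 * (block (real (N + m)) + 1)" for N
    unfolding B_def V_def by (rule count_bound_states[OF reg m1], assumption)+
  have fin: "finite {E \<in> B. \<bar>E\<bar> - 2 > \<delta>}" if "\<delta> > 0" for \<delta>
  proof -
    define N where "N = nat \<lceil>2 / \<delta>\<rceil>"
    have "2 / \<delta> \<le> real (N + m)" unfolding N_def by linarith
    hence "2 / real (N + m) \<le> \<delta>" using that m1 by (simp add: field_simps)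
    hence "{E \<in> B. \<bar>E\<bar> - 2 > \<delta>} \<subseteq> {E \<in> B. \<bar>E\<bar> > 2 + 2 / real (N + m)}" by auto
    thus ?thesis using cnt(1) by (rule finite_subset)
  qed
  have "\<exists>f :: nat \<Rightarrow> real. bij_betw f UNIV B \<and> (\<forall>i j. i \<le> j \<longrightarrow> \<bar>f j\<bar> - 2 \<le> \<bar>f i\<bar> - 2)"
    by (rule decreasing_enumeration[OF inf]) (fact pos, fact fin)
  then obtain f :: "nat \<Rightarrow> real" where f: "bij_betw f UNIV B" "\<And>i j. i \<le> j \<Longrightarrow> \<bar>f j\<bar> - 2 \<le> \<bar>f i\<bar> - 2"
    by blast
  have fB: "f n \<in> B" for n using f(1) by (auto simp: bij_betw_def)
  define E where "E n = f (n - 1)" for n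
  define d where "d n = infdist (E n) {-2..2}" for n
  have d: "d n = \<bar>f (n - 1)\<bar> - 2" for n
    unfolding d_def E_def by (rule infdist_band) (use fB in \<open>simp add: B_def bound_states_def\<close>)
  have few: "d n \<le> 2 / real (N + m)" if "2 * (block (real (N + m)) + 1) < n" for n N
  proof (rule ccontr)
    assume "\<not> d n \<le> 2 / real (N + m)"
    hence far: "\<bar>f (n - 1)\<bar> > 2 + 2 / real (N + m)" unfolding d by linarith
    have "f ` {..<n} \<subseteq> {E \<in> B. \<bar>E\<bar> > 2 + 2 / real (N + m)}"
    proof safe
      fix i assume "i < n"
      hence "\<bar>f (n - 1)\<bar> - 2 \<le> \<bar>f i\<bar> - 2" by (intro f(2)) simp
      thus "2 + 2 / real (N + m) < \<bar>f i\<bar>" using far by linarith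
    qed (rule fB)
    hence "card (f ` {..<n}) \<le> 2 * (block (real (N + m)) + 1)"
      using card_mono[OF cnt(1)] cnt(2) order.trans by blast
    moreover have "card (f ` {..<n}) = n"
      using f(1) by (subst card_image) (auto simp: bij_betw_def intro: inj_on_subset)
    ultimately show False using that by simp
  qed
  have "\<forall>\<^sub>F n in sequentially. real m + 1 \<le> exp ((real n)\<^sup>2 / 576)" by real_asymp
  moreover have "\<forall>\<^sub>F n in sequentially. 2 / (exp ((real n)\<^sup>2 / 576) - 1) \<le> exp (- (real n)\<^sup>2 / 1000)" by real_asymp
  ultimately have "\<forall>\<^sub>F n in sequentially. d n \<le> exp (- (real n)\<^sup>2 / 1000)"
    using eventually_gt_at_top[of 4]
  proof eventually_elim
    case (elim n)
    \<comment> \<open>With \<open>N + m\<close> close to this value, the count \<open>12 \<surd>ln (N + m) + 2\<close> is at most \<open>n / 2 + 2 < n\<close>.\<close>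
    define e where "e = exp ((real n)\<^sup>2 / 576)"
    define N where "N = nat \<lfloor>e\<rfloor> - m"
    have me: "real m + 1 \<le> e" using elim(1) by (simp add: e_def)
    hence "real (N + m) = of_int \<lfloor>e\<rfloor>" unfolding N_def by (simp add: of_nat_diff le_nat_floor nat_le_iff le_floor_iff)
    hence Ne: "real (N + m) \<le> e" "e - 1 \<le> real (N + m)" by linarith+
    have N1: "real (N + m) \<ge> 1" using m1 by simp
    have r: "regular (real (N + m))" by (rule reg) simp
    have "ln (real (N + m)) \<le> ln e" using Ne(1) N1 by (intro ln_le_cancel_iff[THEN iffD2]) auto
    hence "sqrt (ln (real (N + m))) \<le> sqrt ((real n / 24)\<^sup>2)"
      by (intro real_sqrt_le_mono) (simp add: e_def power_divide)
    hence "6 * sqrt (ln (real (N + m))) \<le> real n / 4" by simp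
    hence "real (block (real (N + m))) \<le> real n / 4"
      using block_bounds(2)[of "real (N + m)"] r by (simp add: regular_def)
    hence "real (2 * (block (real (N + m)) + 1)) < real n" using elim(3) by simp
    hence "2 * (block (real (N + m)) + 1) < n" by (simp only: of_nat_less_iff)
    hence "d n \<le> 2 / real (N + m)" by (rule few)
    also have "\<dots> \<le> 2 / (e - 1)" using Ne(2) me m1 by (intro divide_left_mono) auto
    also have "\<dots> \<le> exp (- (real n)\<^sup>2 / 1000)" using elim(2) by (simp add: e_def)
    finally show ?case .
  qed
  moreover have "d n \<le> 1 / 2" for n
    unfolding d using bound_states_near_band[OF reg, of m "f (n - 1)"] fB[of "n - 1"] by (simp add: B_def V_def)
  ultimately obtain c where c: "c > 0" "\<And>n. d n \<le> exp (- c * (real n)\<^sup>2)"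
    using gaussian_rate[of d] by blast
  have d0: "d \<longlonglongrightarrow> 0"
  proof (rule tendsto_sandwich[OF _ _ tendsto_const])
    show "(\<lambda>n. exp (- c * (real n)\<^sup>2)) \<longlonglongrightarrow> 0" using c(1) by real_asymp
    show "\<forall>\<^sub>F n in sequentially. 0 \<le> d n" unfolding d_def by (intro always_eventually allI infdist_nonneg)
  qed (use c in auto)
  have sp: "spectrum V - complex_of_real ` {-2..2} = complex_of_real ` B"
    unfolding B_def by (rule spectrum_outside_band[OF V0 V])
  have inf': "infinite (complex_of_real ` B)" using inf by (simp add: finite_image_iff inj_on_def)
  have bij: "bij_betw (\<lambda>n. complex_of_real (E n)) {1..} (complex_of_real ` B)"
  proof -
    have "bij_betw (\<lambda>n. n - 1) {1::nat..} UNIV" by (rule bij_betwI[of _ _ _ Suc]) auto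
    hence "bij_betw (f \<circ> (\<lambda>n. n - 1)) {1..} B" using f(1) by (rule bij_betw_trans)
    moreover have "bij_betw complex_of_real B (complex_of_real ` B)" by (simp add: bij_betw_def inj_on_def)
    ultimately have "bij_betw (complex_of_real \<circ> (f \<circ> (\<lambda>n. n - 1))) {1..} (complex_of_real ` B)" by (rule bij_betw_trans)
    thus ?thesis by (simp add: o_def E_def)
  qed
  have disc: "discrete_eigenvalue V (complex_of_real (E n))" for n
  proof (rule bound_state_discrete[OF V0 V])
    show "E n \<in> bound_states V" using fB by (simp add: E_def B_def)
    show "finite {E \<in> bound_states V. 2 + \<delta> < \<bar>E\<bar>}" if "\<delta> > 0" for \<delta>
      using fin[OF that] unfolding B_def by (rule rev_finite_subset) auto
  qed
  have dec: "d (n + 1) \<le> d n" for n unfolding d by (rule f(2)) simp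
  have zero: "\<exists>u\<in>ell2. (\<exists>n\<ge>1. u n \<noteq> 0) \<and> solves_schroedinger V 0 u"
    unfolding V_def by (rule zero_energy_solution) (rule reg)
  show ?thesis
  proof (rule exI[of _ V], rule exI[of _ E], rule exI[of _ d], unfold sp, intro conjI allI impI)
    show "\<exists>c>0. \<forall>n\<ge>1. d n \<le> exp (- c * (real n)\<^sup>2)" using c by blast
    show "d n = infdist (E n) {-2..2}" for n by (rule d_def)
    show "discrete_eigenvalue V (complex_of_real (E n))" for n by (rule disc)
    show "d (n + 1) \<le> d n" for n by (rule dec)
  qed (rule inf' bij d0 zero)+
qed

end
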